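(* Let $G$ be a finite graph and $n\ge 0$ an integer. Then $A(n,G)\otimes \mathbb{Z}/2$ has an $\mathcal{A}_2$ action if and only if $s_2\chi(G)\leq n$.
   Context: Graphs are simple and undirected, and are regarded as simplicial complexes whose simplices are the empty set, the vertices and the edges. Let $\Delta^{n-1}$ be the full simplex on the vertex set $\{x_1,\dots,x_n\}$, let $G$ have vertex set $\{y_1,\dots,y_m\}$, and let $K=\Delta^{n-1}\ast G=\{\sigma\cup\tau\mid \sigma\in\Delta^{n-1},\tau\in G\}$ be the join. Then $A(n,G)$ is the graded Stanley-Reisner ring $\mathbb{Z}[x_1,\dots,x_n,y_1,\dots,y_m]/I_K$ with degrees $|x_i|=4$, $|y_j|=6$, where $I_K$ is the ideal generated by the square-free monomials $v_1\cdots v_k$ with $\{v_1,\dots,v_k\}\notin K$. An $n$-span colouring of a graph $G$ over a field $\mathbf{k}$ is a function assigning to each vertex $x$ a pair $(U_x,V_x)$ of a $1$-dimensional subspace $U_x$ and an $(n-1)$-dimensional subspace $V_x$ of $\mathbf{k}^n$ such that $U_x\not\subset V_x$ for every vertex $x$, and $U_x\subset V_y$, $U_y\subset V_x$ for every edge $(x,y)$. The span chromatic number $s_{\mathbf{k}}\chi(G)$ is the least $n$ for which one exists, and $s_2\chi=s_{\mathbb{Z}/2}\chi$. $\mathcal{A}_2$ is the mod-$2$ Steenrod algebra. An $\mathcal{A}_2$ action on a commutative graded unital $\mathbb{Z}/2$-algebra $A^*$ always means a graded $\mathcal{A}_2$-module structure that satisfies the Cartan formula $\mathrm{Sq}^k(xy)=\sum_{0\le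 i\le k}\mathrm{Sq}^i(x)\mathrm{Sq}^{k-i}(y)$ (with $\mathrm{Sq}^0=\mathrm{id}$) and is unstable: for $x\in A^d$, $\mathrm{Sq}^d(x)=x^2$ and $\mathrm{Sq}^k(x)=0$ for $k>d$. *)

theory Defs
  imports
    Complex_Main
    "HOL-Algebra.QuotRing"
    "HOL-Algebra.Generated_Groups"
    "HOL-Library.Poly_Mapping"
    "HOL-Library.Function_Algebras"
    "HOL-Library.Z2"
begin

section \<open>Graphs and simplicial complexes\<close>

text \<open>Edges are two-element sets of vertices. The vertex set may be empty.\<close>

definition finite_simple_graph :: "'a set \<Rightarrow> 'a set set \<Rightarrow> bool" where
  "finite_simple_graph V E \<longleftrightarrow>
     finite V \<and> E \<subseteq> {{u, v} | u v. u \<in> V \<and> v \<in> V \<and> u \<noteq> v}"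

text \<open>The variables \<open>x\<^sub>1, \<dots>, x\<^sub>n\<close> are \<open>X 0, \<dots>, X (n - 1)\<close>; the variable
  \<open>y\<^sub>v\<close> of a vertex \<open>v\<close> is \<open>Y v\<close>.\<close>

datatype 'a var = X nat | Y 'a

definition graph_complex :: "'a set \<Rightarrow> 'a set set \<Rightarrow> 'a var set set" where
  "graph_complex V E = {{}} \<union> {{Y v} | v. v \<in> V} \<union> {Y ` e | e. e \<in> E}"

definition full_simplex :: "nat \<Rightarrow> 'a var set set" where
  "full_simplex n = Pow (X ` {..<n})"

definition complex_join :: "'v set set \<Rightarrow> 'v set set \<Rightarrow> 'v set set" where
  "complex_join K L = {\<sigma> \<union> \<tau> | \<sigma> \<tau>. \<sigma> \<in> K \<and> \<tau> \<in> L}"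

section \<open>Stanley-Reisner rings\<close>

text \<open>A monomial is a finitely supported exponent function \<open>'v \<Rightarrow>\<^sub>0 nat\<close>, and a polynomial is
  a finitely supported coefficient function on monomials.\<close>

definition poly_ring :: "'v set \<Rightarrow> (('v \<Rightarrow>\<^sub>0 nat) \<Rightarrow>\<^sub>0 int) ring" where
  "poly_ring vs = \<lparr>carrier = {p. \<forall>m\<in>Poly_Mapping.keys p. Poly_Mapping.keys m \<subseteq> vs},
     mult = (*), one = 1, zero = 0, add = (+)\<rparr>"

definition squarefree_monomial :: "'v set \<Rightarrow> ('v \<Rightarrow>\<^sub>0 nat) \<Rightarrow>\<^sub>0 int" where
  "squarefree_monomial \<sigma> = Poly_Mapping.single (\<Sum>v\<in>\<sigma>. Poly_Mapping.single v 1) 1"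

definition stanley_reisner_ideal ::
    "'v set \<Rightarrow> 'v set set \<Rightarrow> (('v \<Rightarrow>\<^sub>0 nat) \<Rightarrow>\<^sub>0 int) set" where
  "stanley_reisner_ideal vs K =
     genideal (poly_ring vs) {squarefree_monomial \<sigma> | \<sigma>. \<sigma> \<subseteq> vs \<and> \<sigma> \<notin> K}"

definition stanley_reisner_ring ::
    "'v set \<Rightarrow> 'v set set \<Rightarrow> (('v \<Rightarrow>\<^sub>0 nat) \<Rightarrow>\<^sub>0 int) set ring" where
  "stanley_reisner_ring vs K = poly_ring vs Quot stanley_reisner_ideal vs K"

text \<open>The part of degree \<open>d\<close> when the variable \<open>v\<close> has degree \<open>deg v\<close>.\<close>

definition stanley_reisner_grading ::
    "('v \<Rightarrow> nat) \<Rightarrow> 'v set \<Rightarrow> 'v set set \<Rightarrow> nat \<Rightarrow> (('v \<Rightarrow>\<^sub>0 nat) \<Rightarrow>\<^sub>0 int) set set" where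
  "stanley_reisner_grading deg vs K d =
     {stanley_reisner_ideal vs K +>\<^bsub>poly_ring vs\<^esub> p | p. p \<in> carrier (poly_ring vs) \<and>
        (\<forall>m\<in>Poly_Mapping.keys p. (\<Sum>v\<in>Poly_Mapping.keys m. Poly_Mapping.lookup m v * deg v) = d)}"

definition A_vars :: "nat \<Rightarrow> 'a set \<Rightarrow> 'a var set" where
  "A_vars n V = X ` {..<n} \<union> Y ` V"

definition A_complex :: "nat \<Rightarrow> 'a set \<Rightarrow> 'a set set \<Rightarrow> 'a var set set" where
  "A_complex n V E = complex_join (full_simplex n) (graph_complex V E)"

fun var_degree :: "'a var \<Rightarrow> nat" where
  "var_degree (X i) = 4"
| "var_degree (Y v) = 6"

definition A_ring ::
    "nat \<Rightarrow> 'a set \<Rightarrow> 'a set set \<Rightarrow> (('a var \<Rightarrow>\<^sub>0 nat) \<Rightarrow>\<^sub>0 int) set ring" where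
  "A_ring n V E = stanley_reisner_ring (A_vars n V) (A_complex n V E)"

definition A_grading ::
    "nat \<Rightarrow> 'a set \<Rightarrow> 'a set set \<Rightarrow> nat \<Rightarrow> (('a var \<Rightarrow>\<^sub>0 nat) \<Rightarrow>\<^sub>0 int) set set" where
  "A_grading n V E = stanley_reisner_grading var_degree (A_vars n V) (A_complex n V E)"

section \<open>Tensor products of commutative rings over the integers\<close>

text \<open>The free abelian group on \<open>R \<times> S\<close>, with the product extending
  \<open>(r, s) (r', s') = (r r', s s')\<close> biadditively.\<close>

definition free_pair_ring ::
    "('r, 'm) ring_scheme \<Rightarrow> ('s, 'k) ring_scheme \<Rightarrow> (('r \<times> 's) \<Rightarrow>\<^sub>0 int) ring" where
  "free_pair_ring R S = \<lparr>carrier = {f. Poly_Mapping.keys f \<subseteq> carrier R \<times> carrier S},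
     mult = (\<lambda>f g. \<Sum>p\<in>Poly_Mapping.keys f. \<Sum>q\<in>Poly_Mapping.keys g.
        Poly_Mapping.single (fst p \<otimes>\<^bsub>R\<^esub> fst q, snd p \<otimes>\<^bsub>S\<^esub> snd q) (Poly_Mapping.lookup f p * Poly_Mapping.lookup g q)),
     one = Poly_Mapping.single (\<one>\<^bsub>R\<^esub>, \<one>\<^bsub>S\<^esub>) 1, zero = 0, add = (+)\<rparr>"

definition tensor_relations ::
    "('r, 'm) ring_scheme \<Rightarrow> ('s, 'k) ring_scheme \<Rightarrow> (('r \<times> 's) \<Rightarrow>\<^sub>0 int) set" where
  "tensor_relations R S =
     {Poly_Mapping.single (r \<oplus>\<^bsub>R\<^esub> r', s) 1
        - Poly_Mapping.single (r, s) 1 - Poly_Mapping.single (r', s) 1 | r r' s.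
        r \<in> carrier R \<and> r' \<in> carrier R \<and> s \<in> carrier S} \<union>
     {Poly_Mapping.single (r, s \<oplus>\<^bsub>S\<^esub> s') 1
        - Poly_Mapping.single (r, s) 1 - Poly_Mapping.single (r, s') 1 | r s s'.
        r \<in> carrier R \<and> s \<in> carrier S \<and> s' \<in> carrier S}"

text \<open>A relation times a pair is again a relation, so the ideal generated by the relations is
  the subgroup they generate, and the quotient is the tensor product of abelian groups with its
  usual multiplication.\<close>

definition tensor_ring ::
    "('r, 'm) ring_scheme \<Rightarrow> ('s, 'k) ring_scheme \<Rightarrow> (('r \<times> 's) \<Rightarrow>\<^sub>0 int) set ring" where
  "tensor_ring R S =
     free_pair_ring R S Quot genideal (free_pair_ring R S) (tensor_relations R S)"

definition pure_tensor ::
    "('r, 'm) ring_scheme \<Rightarrow> ('s, 'k) ring_scheme \<Rightarrow> 'r \<Rightarrow> 's \<Rightarrow> (('r \<times> 's) \<Rightarrow>\<^sub>0 int) set" where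
  "pure_tensor R S r s =
     genideal (free_pair_ring R S) (tensor_relations R S)
       +>\<^bsub>free_pair_ring R S\<^esub> Poly_Mapping.single (r, s) 1"

text \<open>The grading on the tensor product of a graded ring \<open>R\<close> with a ring \<open>S\<close> in degree \<open>0\<close>.\<close>

definition tensor_grading ::
    "('r, 'm) ring_scheme \<Rightarrow> (nat \<Rightarrow> 'r set) \<Rightarrow> ('s, 'k) ring_scheme
      \<Rightarrow> nat \<Rightarrow> (('r \<times> 's) \<Rightarrow>\<^sub>0 int) set set" where
  "tensor_grading R Gr S d =
     generate (add_monoid (tensor_ring R S))
       {pure_tensor R S r s | r s. r \<in> Gr d \<and> s \<in> carrier S}"

definition Z2_ring :: "bit ring" where
  "Z2_ring = \<lparr>carrier = UNIV, mult = (*), one = 1, zero = 0, add = (+)\<rparr>"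

section \<open>The mod 2 Steenrod algebra\<close>

text \<open>The associative unital algebra over \<open>\<int>/2\<close> presented by generators \<open>Sq\<^sup>i\<close>, \<open>i \<ge> 0\<close>, with
  the relation \<open>Sq\<^sup>0 = 1\<close> and the Adem relations. It is the quotient of the terms in the
  generators by the congruence generated by the ring axioms, \<open>x + x = 0\<close>, and these relations.\<close>

datatype sq_term = SqT nat | ZeroT | OneT | AddT sq_term sq_term | MulT sq_term sq_term

fun sum_term :: "sq_term list \<Rightarrow> sq_term" where
  "sum_term [] = ZeroT"
| "sum_term (t # ts) = AddT t (sum_term ts)"

definition adem_rhs :: "nat \<Rightarrow> nat \<Rightarrow> sq_term" where
  "adem_rhs a b = sum_term
     (map (\<lambda>j. if odd ((b - 1 - j) choose (a - 2 * j)) then MulT (SqT (a + b - j)) (SqT j)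
               else ZeroT)
       [0..<a div 2 + 1])"

inductive steenrod_eq :: "sq_term \<Rightarrow> sq_term \<Rightarrow> bool" where
  refl: "steenrod_eq s s"
| sym: "steenrod_eq s t \<Longrightarrow> steenrod_eq t s"
| trans: "steenrod_eq s t \<Longrightarrow> steenrod_eq t u \<Longrightarrow> steenrod_eq s u"
| add_cong: "steenrod_eq s s' \<Longrightarrow> steenrod_eq t t' \<Longrightarrow> steenrod_eq (AddT s t) (AddT s' t')"
| mul_cong: "steenrod_eq s s' \<Longrightarrow> steenrod_eq t t' \<Longrightarrow> steenrod_eq (MulT s t) (MulT s' t')"
| add_assoc: "steenrod_eq (AddT (AddT s t) u) (AddT s (AddT t u))"
| add_comm: "steenrod_eq (AddT s t) (AddT t s)"
| add_zero: "steenrod_eq (AddT ZeroT s) s"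
| char_two: "steenrod_eq (AddT s s) ZeroT"
| mul_assoc: "steenrod_eq (MulT (MulT s t) u) (MulT s (MulT t u))"
| one_mul: "steenrod_eq (MulT OneT s) s"
| mul_one: "steenrod_eq (MulT s OneT) s"
| distrib_right: "steenrod_eq (MulT (AddT s t) u) (AddT (MulT s u) (MulT t u))"
| distrib_left: "steenrod_eq (MulT s (AddT t u)) (AddT (MulT s t) (MulT s u))"
| Sq_zero: "steenrod_eq (SqT 0) OneT"
| adem: "0 < a \<Longrightarrow> a < 2 * b \<Longrightarrow> steenrod_eq (MulT (SqT a) (SqT b)) (adem_rhs a b)"

lemma equivp_steenrod_eq: "equivp steenrod_eq"
  by (intro equivpI reflpI sympI transpI)
     (blast intro: steenrod_eq.refl steenrod_eq.sym steenrod_eq.trans)+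

quotient_type steenrod = sq_term / steenrod_eq
  by (rule equivp_steenrod_eq)

instantiation steenrod :: "{ring, monoid_mult}"
begin

lift_definition zero_steenrod :: steenrod is ZeroT .

lift_definition one_steenrod :: steenrod is OneT .

lift_definition plus_steenrod :: "steenrod \<Rightarrow> steenrod \<Rightarrow> steenrod" is AddT
  by (rule steenrod_eq.add_cong)

lift_definition times_steenrod :: "steenrod \<Rightarrow> steenrod \<Rightarrow> steenrod" is MulT
  by (rule steenrod_eq.mul_cong)

definition uminus_steenrod :: "steenrod \<Rightarrow> steenrod" where
  "uminus_steenrod a = a"

definition minus_steenrod :: "steenrod \<Rightarrow> steenrod \<Rightarrow> steenrod" where
  "minus_steenrod a b = a + b"

instance
proof
  fix a b c :: steenrod
  show "a + b + c = a + (b + c)" by transfer (rule steenrod_eq.add_assoc)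
  show "a + b = b + a" by transfer (rule steenrod_eq.add_comm)
  show "0 + a = a" by transfer (rule steenrod_eq.add_zero)
  show "- a + a = 0" unfolding uminus_steenrod_def by transfer (rule steenrod_eq.char_two)
  show "a - b = a + - b" by (simp add: uminus_steenrod_def minus_steenrod_def)
  show "a * b * c = a * (b * c)" by transfer (rule steenrod_eq.mul_assoc)
  show "1 * a = a" by transfer (rule steenrod_eq.one_mul)
  show "a * 1 = a" by transfer (rule steenrod_eq.mul_one)
  show "(a + b) * c = a * c + b * c" by transfer (rule steenrod_eq.distrib_right)
  show "a * (b + c) = a * b + a * c" by transfer (rule steenrod_eq.distrib_left)
qed

end

lift_definition Sq :: "nat \<Rightarrow> steenrod" is SqT .

inductive_set steenrod_grading :: "nat \<Rightarrow> steenrod set" for d :: nat where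
  zero: "0 \<in> steenrod_grading d"
| mono: "sum_list is = d \<Longrightarrow> prod_list (map Sq is) \<in> steenrod_grading d"
| add: "a \<in> steenrod_grading d \<Longrightarrow> b \<in> steenrod_grading d \<Longrightarrow> a + b \<in> steenrod_grading d"

text \<open>An action of the Steenrod algebra on a commutative \<open>\<int>/2\<close>-algebra \<open>R\<close>, whose part of
  degree \<open>d\<close> is \<open>Gr d\<close>. Additivity in both arguments is bilinearity over the field \<open>\<int>/2\<close>.\<close>

definition steenrod_action ::
    "('r, 'm) ring_scheme \<Rightarrow> (nat \<Rightarrow> 'r set) \<Rightarrow> (steenrod \<Rightarrow> 'r \<Rightarrow> 'r) \<Rightarrow> bool" where
  "steenrod_action R Gr act \<longleftrightarrow>
     (\<forall>a. \<forall>x\<in>carrier R. act a x \<in> carrier R) \<and>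
     (\<forall>a. \<forall>x\<in>carrier R. \<forall>y\<in>carrier R. act a (x \<oplus>\<^bsub>R\<^esub> y) = act a x \<oplus>\<^bsub>R\<^esub> act a y) \<and>
     (\<forall>a b. \<forall>x\<in>carrier R. act (a + b) x = act a x \<oplus>\<^bsub>R\<^esub> act b x) \<and>
     (\<forall>x\<in>carrier R. act 1 x = x) \<and>
     (\<forall>a b. \<forall>x\<in>carrier R. act (a * b) x = act a (act b x)) \<and>
     (\<forall>k d. \<forall>a\<in>steenrod_grading k. \<forall>x\<in>Gr d. act a x \<in> Gr (k + d)) \<and>
     (\<forall>k. \<forall>x\<in>carrier R. \<forall>y\<in>carrier R. act (Sq k) (x \<otimes>\<^bsub>R\<^esub> y) =
        (\<Oplus>\<^bsub>R\<^esub>i\<in>{..k}. act (Sq i) x \<otimes>\<^bsub>R\<^esub> act (Sq (k - i)) y)) \<and>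
     (\<forall>d. \<forall>x\<in>Gr d. act (Sq d) x = x \<otimes>\<^bsub>R\<^esub> x \<and> (\<forall>k>d. act (Sq k) x = \<zero>\<^bsub>R\<^esub>))"

section \<open>Span colourings\<close>

text \<open>The space \<open>k\<^sup>n\<close> is the set of functions \<open>nat \<Rightarrow> k\<close> vanishing outside \<open>{..<n}\<close>.\<close>

definition coord_scale :: "'k::field \<Rightarrow> (nat \<Rightarrow> 'k) \<Rightarrow> nat \<Rightarrow> 'k" where
  "coord_scale c v = (\<lambda>i. c * v i)"

definition coord_space :: "nat \<Rightarrow> (nat \<Rightarrow> 'k::field) set" where
  "coord_space n = {v. \<forall>i\<ge>n. v i = 0}"

global_interpretation coord: vector_space coord_scale
  by standard (auto simp: coord_scale_def fun_eq_iff algebra_simps)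

definition coord_subspace :: "nat \<Rightarrow> nat \<Rightarrow> (nat \<Rightarrow> 'k::field) set \<Rightarrow> bool" where
  "coord_subspace n d W \<longleftrightarrow>
     coord.subspace W \<and> W \<subseteq> coord_space n \<and> coord.dim W = d"

text \<open>For \<open>n = 0\<close> the truncated dimension \<open>n - 1 = 0\<close> is harmless: there is no one-dimensional
  subspace of \<open>k\<^sup>0\<close>, so only the graph without vertices has a colouring.\<close>

definition span_colouring ::
    "nat \<Rightarrow> 'a set \<Rightarrow> 'a set set \<Rightarrow> ('a \<Rightarrow> (nat \<Rightarrow> 'k::field) set \<times> (nat \<Rightarrow> 'k) set) \<Rightarrow> bool" where
  "span_colouring n V E c \<longleftrightarrow>
     (\<forall>x\<in>V. coord_subspace n 1 (fst (c x)) \<and> coord_subspace n (n - 1) (snd (c x)) \<and>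
        \<not> fst (c x) \<subseteq> snd (c x)) \<and>
     (\<forall>x y. {x, y} \<in> E \<longrightarrow> fst (c x) \<subseteq> snd (c y) \<and> fst (c y) \<subseteq> snd (c x))"

definition span_chromatic_number :: "'k::field itself \<Rightarrow> 'a set \<Rightarrow> 'a set set \<Rightarrow> nat" where
  "span_chromatic_number k V E =
     (LEAST n. \<exists>c :: 'a \<Rightarrow> (nat \<Rightarrow> 'k) set \<times> (nat \<Rightarrow> 'k) set. span_colouring n V E c)"

end

(*
Modulo 2 the ring is the Stanley-Reisner ring over the field with two elements, so an action is
determined by the squares of the variables.

From an action to a colouring: let \<phi> v be the coefficient of y_v in Sq^2 on the span of the x_i, and
let a v w be the coefficient of y_w in Sq^4 y_v.  The Adem relation Sq^2 Sq^4 = Sq^6 + Sq^5 Sq^1 gives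
\<phi> w (a v w) = \<delta>_(v,w), and \<phi> u (a v w) = \<phi> w (a v u) for every edge uw.  The Cartan formula for
the relation y_u y_w y_z = 0 gives a u z = 0 as soon as z has a neighbour other than u.  Hence
(a v v, \<phi> v) is a colouring up to a correction at the leaves of the graph.

From a colouring to an action: the total square
  x |-> x + s^2 \<phi>(x) + s^4 x^2,   y_v |-> y_v + s^4 a_v y_v + s^6 y_v^2
is a ring homomorphism.  It satisfies the Bullett-Macdonald identity because this is an identity of
ring homomorphisms, which can be checked on the variables.  The Adem relations are its coefficients,
extracted with the dual of the basis (s + s^2)^i of the power series.
*)
theory Submission
  imports Defs "HOL-Computational_Algebra.Polynomial_FPS"
begin

section \<open>Polynomial algebra in characteristic two: truncation and substitution\<close>

section \<open>Polynomials over the field with two elements\<close>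

text \<open>The leaves need a correction because the vanishing of a u z is won from three distinct
  vertices, and an end vertex has only one neighbour. Nothing forces the naive colouring to be
  orthogonal there; but no other vertex is adjacent to it, so its functional or its vector may be
  changed.

  For the other direction the squares are prescribed on the full polynomial ring, which is free on
  its variables. The Cartan formula and instability hold there exactly, the Adem relations only
  modulo the ideal. The ideal is preserved because the x_i are cone points: a non-face is always
  witnessed by variables that divide their own total squares.

  The Bullett-Macdonald identity in two parameters is P(s^2 + s t) P(t^2) = P(t^2 + s t) P(s^2),
  where P(r) is the sum of all r^k Sq^k. Here t = 1, since the grading recovers the exponent that t
  would record.

  The tensor product consists of cosets of formal sums of cosets. It is traded for a ring of normal
  forms: polynomials over \<open>bit\<close> supported on face monomials, multiplied and then
  truncated.\<close>

lemma keys_add_nat: "Poly_Mapping.keys (m + m' :: 'v \<Rightarrow>\<^sub>0 nat) = Poly_Mapping.keys m \<union> Poly_Mapping.keys m'"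
  by (auto simp: in_keys_iff lookup_add)

lemma keys_sum_single:
  "finite \<sigma> \<Longrightarrow> Poly_Mapping.keys (\<Sum>v\<in>\<sigma>. Poly_Mapping.single v (1::nat)) = \<sigma>"
  by (induction rule: finite_induct) (simp_all add: keys_add_nat)

lemma add_self_eq_zero [simp]: "(p :: 'k \<Rightarrow>\<^sub>0 bit) + p = 0"
  by (simp add: poly_mapping_eq_iff fun_eq_iff lookup_add)

lemma sum_single_eq: "(\<Sum>k\<in>Poly_Mapping.keys p. Poly_Mapping.single k (Poly_Mapping.lookup p k)) = p"
  by (rule poly_mapping_eqI)
    (auto simp: lookup_sum lookup_single when_def sum.delta' in_keys_iff sum.delta cong: if_cong)

lemma poly_mapping_add_induct [case_names zero single add]:
  assumes "P 0" "\<And>k c. P (Poly_Mapping.single k c)" "\<And>p q. P p \<Longrightarrow> P q \<Longrightarrow> P (p + q)"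
  shows "P (p :: 'k \<Rightarrow>\<^sub>0 'c::comm_monoid_add)"
proof -
  have "P (\<Sum>k\<in>K. Poly_Mapping.single k (Poly_Mapping.lookup p k))" if "finite K" for K
    using that by induction (auto intro: assms)
  from this[of "Poly_Mapping.keys p"] show ?thesis by (simp add: sum_single_eq)
qed

lemma single_bit_cases: "Poly_Mapping.single k (c::bit) = 0 \<or> Poly_Mapping.single k c = Poly_Mapping.single k 1"
  by (cases c) auto

definition var2 :: "'v \<Rightarrow> ('v \<Rightarrow>\<^sub>0 nat) \<Rightarrow>\<^sub>0 bit" where
  "var2 v = Poly_Mapping.single (Poly_Mapping.single v 1) 1"

lemma monomial_mult_induct [case_names one var mult]:
  assumes "P 1" "\<And>v. P (var2 v)" "\<And>p q. P p \<Longrightarrow> P q \<Longrightarrow> P (p * q)"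
  shows "P (Poly_Mapping.single m (1::bit))"
proof (induction m rule: poly_mapping_add_induct)
  case zero
  then show ?case using assms(1) by simp
next
  case (single v k)
  show ?case
  proof (induction k)
    case 0
    then show ?case using assms(1) by simp
  next
    case (Suc k)
    have "Poly_Mapping.single (Poly_Mapping.single v (Suc k)) (1::bit)
      = var2 v * Poly_Mapping.single (Poly_Mapping.single v k) 1"
      by (simp add: var2_def mult_single flip: single_add)
    then show ?case using assms Suc by simp
  qed
next
  case (add m m')
  have "Poly_Mapping.single (m + m') (1::bit) = Poly_Mapping.single m 1 * Poly_Mapping.single m' 1"
    by (simp add: mult_single)
  then show ?case using assms add by simp
qed

lemma mpoly_induct [case_names zero monomial add]:
  assumes "P 0" "\<And>m. P (Poly_Mapping.single m 1)" "\<And>p q. P p \<Longrightarrow> P q \<Longrightarrow> P (p + q)"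
  shows "P (p :: 'k \<Rightarrow>\<^sub>0 bit)"
proof (induction p rule: poly_mapping_add_induct)
  case (single k c)
  then show ?case using single_bit_cases[of k c] assms(1,2) by auto
qed (use assms in blast)+

text \<open>Reduces identities between ring homomorphisms to constants and variables.\<close>

lemma mpoly_ring_induct [case_names zero one var add mult]:
  assumes "P 0" "P 1" "\<And>v. P (var2 v)" "\<And>p q. P p \<Longrightarrow> P q \<Longrightarrow> P (p + q)" "\<And>p q. P p \<Longrightarrow> P q \<Longrightarrow> P (p * q)"
  shows "P p"
proof (induction p rule: mpoly_induct)
  case (monomial m)
  show ?case by (rule monomial_mult_induct) (use assms in blast)+
qed (use assms in blast)+

subsection \<open>Restriction to a set of monomials\<close>

text \<open>Projection onto the span of the monomials in \<open>M\<close>. With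
  \<open>M = faces K\<close> it computes normal forms modulo the Stanley-Reisner ideal; with a
  condition on the weight it extracts a homogeneous part.\<close>

lift_definition restr :: "'k set \<Rightarrow> ('k \<Rightarrow>\<^sub>0 'c::zero) \<Rightarrow> 'k \<Rightarrow>\<^sub>0 'c" is
  "\<lambda>M f k. if k \<in> M then f k else 0"
  by (erule rev_finite_subset) auto

lemma lookup_restr: "Poly_Mapping.lookup (restr M p) k = (if k \<in> M then Poly_Mapping.lookup p k else 0)"
  by transfer simp

lemma keys_restr: "Poly_Mapping.keys (restr M p) = Poly_Mapping.keys p \<inter> M"
  by (auto simp: in_keys_iff lookup_restr split: if_splits)

lemma restr_zero [simp]: "restr M 0 = 0"
  by (rule poly_mapping_eqI) (simp add: lookup_restr)

lemma restr_add: "restr M (p + q) = restr M p + restr M (q :: 'k \<Rightarrow>\<^sub>0 'c::comm_monoid_add)"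
  by (rule poly_mapping_eqI) (simp add: lookup_restr lookup_add)

lemma restr_sum: "restr M (sum f I) = (\<Sum>i\<in>I. restr M (f i :: 'k \<Rightarrow>\<^sub>0 'c::comm_monoid_add))"
  by (induction I rule: infinite_finite_induct) (simp_all add: restr_add)

lemma restr_id: "Poly_Mapping.keys p \<subseteq> M \<Longrightarrow> restr M p = p"
  by (rule poly_mapping_eqI) (auto simp: lookup_restr in_keys_iff)

lemma restr_eq_zero_iff: "restr M p = 0 \<longleftrightarrow> Poly_Mapping.keys p \<inter> M = {}"
  by (auto simp: poly_mapping_eq_iff fun_eq_iff lookup_restr in_keys_iff)

lemma restr_restr: "restr M (restr N p) = restr (M \<inter> N) p"
  by (rule poly_mapping_eqI) (simp add: lookup_restr)

lemma restr_split: "p = restr M p + restr (- M) (p :: 'k \<Rightarrow>\<^sub>0 'c::comm_monoid_add)"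
  by (rule poly_mapping_eqI) (simp add: lookup_restr lookup_add)

definition faces :: "'v set set \<Rightarrow> ('v \<Rightarrow>\<^sub>0 nat) set" where
  "faces K = {m. Poly_Mapping.keys m \<in> K}"

definition simplicial_complex :: "'v set set \<Rightarrow> bool" where
  "simplicial_complex K \<longleftrightarrow> {} \<in> K \<and> (\<forall>\<sigma>\<in>K. Pow \<sigma> \<subseteq> K)"

lemma faces_addD: "simplicial_complex K \<Longrightarrow> m + m' \<in> faces K \<Longrightarrow> m \<in> faces K"
  by (auto simp: simplicial_complex_def faces_def keys_add_nat)

text \<open>The non-face monomials span an ideal, because a factor of a face monomial is again a
  face monomial. Truncating a factor is therefore invisible once the product is truncated.\<close>

lemma restr_faces_mult_left:
  assumes "simplicial_complex K"
  shows "restr (faces K) (restr (faces K) p * q) = restr (faces K) (p * (q :: ('v \<Rightarrow>\<^sub>0 nat) \<Rightarrow>\<^sub>0 'c::comm_semiring_1))"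
proof -
  have "restr (faces K) (restr (- faces K) p * q) = 0"
    unfolding restr_eq_zero_iff
  proof (intro equals0I, elim IntE)
    fix m assume "m \<in> Poly_Mapping.keys (restr (- faces K) p * q)" "m \<in> faces K"
    then obtain m1 m2 where "m = m1 + m2" "m1 \<in> Poly_Mapping.keys (restr (- faces K) p)"
      using keys_mult[of "restr (- faces K) p" q] by blast
    then show False
      using faces_addD[OF assms, of m1 m2] \<open>m \<in> faces K\<close> by (simp add: keys_restr)
  qed
  moreover have "p * q = restr (faces K) p * q + restr (- faces K) p * q"
    by (simp only: restr_split[symmetric] flip: ring_distribs)
  ultimately show ?thesis by (simp add: restr_add)
qed

lemma restr_faces_mult_right:
  assumes "simplicial_complex K"
  shows "restr (faces K) (p * restr (faces K) q) = restr (faces K) (p * (q :: ('v \<Rightarrow>\<^sub>0 nat) \<Rightarrow>\<^sub>0 'c::comm_semiring_1))"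
  using restr_faces_mult_left[OF assms, of q p] by (simp add: mult.commute)

subsection \<open>Substitution\<close>

definition mon :: "('v \<Rightarrow> 'r::comm_ring_1) \<Rightarrow> ('v \<Rightarrow>\<^sub>0 nat) \<Rightarrow> 'r" where
  "mon g m = (\<Prod>v\<in>Poly_Mapping.keys m. g v ^ Poly_Mapping.lookup m v)"

lemma mon_superset: "finite W \<Longrightarrow> Poly_Mapping.keys m \<subseteq> W \<Longrightarrow> mon g m = (\<Prod>v\<in>W. g v ^ Poly_Mapping.lookup m v)"
  unfolding mon_def by (rule prod.mono_neutral_left) (auto simp: in_keys_iff)

lemma mon_zero [simp]: "mon g 0 = 1"
  by (simp add: mon_def)

lemma mon_add: "mon g (m + m') = mon g m * mon g m'"
  by (simp add: mon_superset[of "Poly_Mapping.keys m \<union> Poly_Mapping.keys m'"] keys_add_nat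
      lookup_add power_add prod.distrib)

lemma mon_single: "mon g (Poly_Mapping.single v k) = g v ^ k"
  by (simp add: mon_superset[of "{v}"])

text \<open>This is a ring homomorphism only if \<open>1 + 1 = 0\<close> in the target.\<close>

definition subst :: "('v \<Rightarrow> 'r::comm_ring_1) \<Rightarrow> (('v \<Rightarrow>\<^sub>0 nat) \<Rightarrow>\<^sub>0 bit) \<Rightarrow> 'r" where
  "subst g p = (\<Sum>m\<in>Poly_Mapping.keys p. mon g m)"

lemma subst_zero [simp]: "subst g 0 = 0"
  by (simp add: subst_def)

lemma subst_single: "subst g (Poly_Mapping.single m 1) = mon g m"
  by (simp add: subst_def)

lemma subst_one [simp]: "subst g 1 = 1"
  by (simp add: subst_def)

lemma subst_var: "subst g (var2 v) = g v"
  by (simp only: var2_def subst_single mon_single power_one_right)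

lemma subst_add:
  assumes "(2 :: 'r::comm_ring_1) = 0"
  shows "subst (g :: 'v \<Rightarrow> 'r) (p + q) = subst g p + subst g q"
proof -
  define W where "W = Poly_Mapping.keys p \<union> Poly_Mapping.keys q"
  have eq: "subst g r = (\<Sum>m\<in>W. if Poly_Mapping.lookup r m = 1 then mon g m else 0)"
    if "Poly_Mapping.keys r \<subseteq> W" for r
    unfolding subst_def
    by (rule sum.mono_neutral_cong_left) (use that in \<open>auto simp: W_def in_keys_iff\<close>)
  have two: "x + x = 0" for x :: 'r
    by (simp only: assms mult_zero_left flip: mult_2)
  \<comment> \<open>A monomial in both supports cancels in \<open>p + q\<close> and is counted twice
    on the other side; this is where 2 = 0 is used.\<close>
  have split: "(if b + c = 1 then x else 0) = (if b = 1 then x else 0) + (if c = 1 then x else 0)"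
    for b c :: bit and x :: 'r
    by (cases b; cases c) (simp_all add: two)
  have "subst g (p + q) = (\<Sum>m\<in>W. if Poly_Mapping.lookup p m + Poly_Mapping.lookup q m = 1 then mon g m else 0)"
    using keys_add[of p q] by (subst eq) (simp_all only: W_def lookup_add)
  also have "\<dots> = (\<Sum>m\<in>W. if Poly_Mapping.lookup p m = 1 then mon g m else 0)
      + (\<Sum>m\<in>W. if Poly_Mapping.lookup q m = 1 then mon g m else 0)"
    by (simp only: split sum.distrib)
  also have "\<dots> = subst g p + subst g q"
    by (simp only: eq[of p] eq[of q] W_def Un_upper1 Un_upper2)
  finally show ?thesis .
qed

lemma subst_mult:
  assumes "(2 :: 'r::comm_ring_1) = 0"
  shows "subst (g :: 'v \<Rightarrow> 'r) (p * q) = subst g p * subst g q"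
proof (induction p rule: mpoly_induct)
  case (monomial m)
  show ?case
    by (induction q rule: mpoly_induct)
      (simp_all add: subst_add[OF assms] ring_distribs mult_single subst_single mon_add)
qed (simp_all add: subst_add[OF assms] ring_distribs)

lemma mpoly_two_eq_zero [simp]: "(2 :: ('v \<Rightarrow>\<^sub>0 nat) \<Rightarrow>\<^sub>0 bit) = 0"
  by (metis add_self_eq_zero one_add_one)

lemma mpoly_poly_two_eq_zero [simp]: "(2 :: (('v \<Rightarrow>\<^sub>0 nat) \<Rightarrow>\<^sub>0 bit) poly) = 0"
  by (simp add: numeral_poly)

section \<open>The power series coefficients behind the Adem relations\<close>

section \<open>Binomial coefficients modulo two\<close>

text \<open>Modulo two this is the series \<open>(1 + X)\<close> to the power \<open>- (a + 1)\<close>.\<close>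

definition neg_binomial :: "nat \<Rightarrow> 'r::comm_ring_1 fps" where
  "neg_binomial a = Abs_fps (\<lambda>j. of_nat ((a + j) choose j))"

text \<open>Pascal's rule gives two summands, which are equal by symmetry.\<close>

lemma even_central_binomial: "0 < k \<Longrightarrow> even ((2 * k) choose k)"
proof (cases k)
  case (Suc j)
  have "Suc (2 * j) choose j = Suc (2 * j) choose Suc j"
    by (subst binomial_symmetric) auto
  then show ?thesis using Suc by simp
qed simp

context
  assumes two: "(2 :: 'r::comm_ring_1) = 0"
begin

lemma char2_add_self: "(x :: 'r) + x = 0"
  by (metis two mult_2 mult_zero_left)

lemma char2_of_nat: "(of_nat k :: 'r) = (if odd k then 1 else 0)"
proof (induction k)
  case (Suc k)
  then show ?case by (simp add: two)
qed simp

text \<open>Pascal's rule: the summand by which the two coefficients differ occurs twice and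
  vanishes modulo two.\<close>

lemma neg_binomial_Suc: "(1 + fps_X) * neg_binomial (Suc a) = (neg_binomial a :: 'r fps)"
proof (rule fps_ext)
  fix j
  show "fps_nth ((1 + fps_X) * neg_binomial (Suc a)) j = fps_nth (neg_binomial a :: 'r fps) j"
  proof (cases j)
    case (Suc i)
    have "Suc a + Suc i choose Suc i = (Suc a + i choose i) + (a + Suc i choose Suc i)"
      by simp
    then have "of_nat (Suc a + Suc i choose Suc i) + of_nat (Suc a + i choose i)
      = (of_nat (Suc a + i choose i) + of_nat (Suc a + i choose i)) + (of_nat (a + Suc i choose Suc i) :: 'r)"
      by (simp only: of_nat_add add_ac)
    also have "\<dots> = of_nat (a + Suc i choose Suc i)"
      by (simp only: char2_add_self add_0_left)
    finally show ?thesis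
      using Suc by (simp add: neg_binomial_def fps_mult_fps_X_plus_1_nth del: binomial_Suc_Suc)
  qed (simp add: neg_binomial_def fps_mult_fps_X_plus_1_nth)
qed

lemma neg_binomial_0: "(1 + fps_X) * neg_binomial 0 = (1 :: 'r fps)"
proof (rule fps_ext)
  fix j
  show "fps_nth ((1 + fps_X) * neg_binomial 0) j = fps_nth (1 :: 'r fps) j"
    by (cases j) (simp_all add: neg_binomial_def fps_mult_fps_X_plus_1_nth two)
qed

lemma neg_binomial_mult_le: "i \<le> a \<Longrightarrow> (1 + fps_X) ^ i * neg_binomial a = (neg_binomial (a - i) :: 'r fps)"
proof (induction i arbitrary: a)
  case (Suc i)
  then obtain b where b: "a = Suc b" by (cases a) auto
  have "(1 + fps_X) ^ Suc i * neg_binomial a = (1 + fps_X) ^ i * (neg_binomial b :: 'r fps)"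
    by (simp only: b power_Suc2 mult.assoc neg_binomial_Suc)
  then show ?case using Suc.IH[of b] Suc.prems b by simp
qed simp

lemma neg_binomial_mult_gr:
  assumes "a < e"
  shows "(1 + fps_X) ^ e * neg_binomial a = ((1 + fps_X) ^ (e - Suc a) :: 'r fps)"
proof -
  obtain d where e: "e = d + 1 + a"
    using that[of "e - Suc a"] assms by simp
  have "(1 + fps_X) ^ e * neg_binomial a
    = (1 + fps_X) ^ d * ((1 + fps_X) * ((1 + fps_X) ^ a * (neg_binomial a :: 'r fps)))"
    by (simp only: e power_add mult.assoc power_one_right)
  then show ?thesis by (simp only: neg_binomial_mult_le[OF order_refl] diff_self_eq_0 neg_binomial_0) (simp add: e)
qed

lemma fps_X_power_mult_nth': "fps_nth (fps_X ^ k * f) j = (if k \<le> j then fps_nth f (j - k) else (0 :: 'r))"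
  by (simp add: fps_X_power_mult_nth)

text \<open>Orthonormality of the coefficient functionals and the powers of X + X^2. For i <= a the
  series is X^i (1 + X)^-(a - i + 1), and its coefficient at a is a central binomial coefficient,
  even unless i = a. For i > a it is divisible by X^(a + 1).\<close>

lemma nth_neg_binomial_X_power:
  "fps_nth ((fps_X * (1 + fps_X)) ^ i * neg_binomial a) a = (if i = a then 1 else 0 :: 'r)"
proof (cases "i \<le> a")
  case True
  have "(fps_X * (1 + fps_X)) ^ i * neg_binomial a = fps_X ^ i * ((1 + fps_X) ^ i * (neg_binomial a :: 'r fps))"
    by (simp only: power_mult_distrib mult.assoc)
  also have "fps_nth \<dots> a = of_nat ((2 * (a - i)) choose (a - i))"
    using True by (simp only: neg_binomial_mult_le[OF True] fps_X_power_mult_nth') (simp add: neg_binomial_def mult_2)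
  finally show ?thesis
    using even_central_binomial[of "a - i"] True by (auto simp: char2_of_nat)
qed (simp only: power_mult_distrib mult.assoc fps_X_power_mult_nth', simp)

text \<open>For e > a the exponent e - a - 1 is not negative, so an ordinary binomial coefficient
  appears. With e = a + b - j it is (b - 1 - j) choose (a - 2 j), the Adem coefficient.\<close>

lemma nth_neg_binomial_power:
  assumes "a < e"
  shows "fps_nth (fps_X ^ (2 * j) * (1 + fps_X) ^ e * neg_binomial a) a
    = (if 2 * j \<le> a \<and> odd ((e - Suc a) choose (a - 2 * j)) then 1 else 0 :: 'r)"
proof -
  have "fps_nth ((1 + fps_X) ^ k) i = (of_nat (k choose i) :: 'r)" for k i
  proof (induction k arbitrary: i)
    case (Suc k)
    then show ?case
      by (cases i) (simp_all add: fps_mult_fps_X_plus_1_nth)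
  qed (simp add: binomial_eq_0)
  then show ?thesis
    by (simp only: mult.assoc neg_binomial_mult_gr[OF assms] fps_X_power_mult_nth' char2_of_nat) simp
qed

end

section \<open>Total squares on the variables, and composition of total squares\<close>

section \<open>The total square of a colouring\<close>

text \<open>The next two lemmas are the Bullett-Macdonald identity on the variables; \<open>q\<close> is the square of the
  parameter.\<close>

lemma char2_identity_X:
  fixes x F G q :: "'r::comm_ring_1"
  assumes "(2::'r) = 0"
  defines "R \<equiv> q + q^2" and "T \<equiv> 1 + q"
  shows "(x + F * R + x^2 * R^2) + (F + G * R^2 + F^2 * R^3) + (x + F * R + x^2 * R^2)^2
    = (x + F * T + x^2 * T^2) + q^2 * (F + G * T^2 + F^2 * T^3) + q^4 * (x + F * T + x^2 * T^2)^2"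
proof -
  \<comment> \<open>Expanded without using 2 = 0, the two sides differ by twice the last
    polynomial.\<close>
  have "(x + F * R + x^2 * R^2) + (F + G * R^2 + F^2 * R^3) + (x + F * R + x^2 * R^2)^2
    = (x + F * T + x^2 * T^2) + q^2 * (F + G * T^2 + F^2 * T^3) + q^4 * (x + F * T + x^2 * T^2)^2
      + 2 * (x * F * q + x * F * q^2 - x * F * q^4 - x * F * q^5 - x^2 * q + x^2 * q^3 + x^2 * F * q^3 + 2 * x^2 * F * q^4 - 2 * x^2 * F * q^6 - x^2 * F * q^7 + x^3 * q^2 + 2 * x^3 * q^3 - 2 * x^3 * q^5 - x^3 * q^6)"
    unfolding R_def T_def by (simp add: algebra_simps eval_nat_numeral)
  then show ?thesis by (simp only: assms(1) mult_zero_left add_0_right)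
qed

lemma char2_identity_Y:
  fixes a F y q :: "'r::comm_ring_1"
  assumes "(2::'r) = 0"
  defines "R \<equiv> q + q^2" and "T \<equiv> 1 + q"
  shows "F * y - y^2 dvd
     ((y + a * y * R^2 + y^2 * R^3) + (a + F * R + a^2 * R^2) * (y + a * y * R^2 + y^2 * R^3) + (y + a * y * R^2 + y^2 * R^3)^2)
     - ((y + a * y * T^2 + y^2 * T^3) + q^4 * ((a + F * T + a^2 * T^2) * (y + a * y * T^2 + y^2 * T^3)) + q^6 * (y + a * y * T^2 + y^2 * T^3)^2)"
    (is "_ dvd ?H1 - ?H2")
proof -
  \<comment> \<open>Expanded without using 2 = 0: a multiple of the relation F y = y^2, whose
    cofactor is q + q^2 + q^4 + q^5 + a (q^3 + q^7) modulo two, plus an even remainder.\<close>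
  have "?H1 - ?H2 = (F * y - y^2) * (q + q^2 + q^3 * a - q^4 + 2 * q^4 * a - q^5 - 2 * q^6 * a - q^7 * a)
      + 2 * (- q * y * a - q * y^2 + q^2 * y * a^2 - q^2 * y^2 + q^2 * y^2 * a + q^3 * y * a + 2 * q^3 * y * a^2 + 3 * q^3 * y^2 * a + q^3 * y^3 + q^4 * y^2 + 3 * q^4 * y^2 * a + 3 * q^4 * y^3 - 2 * q^5 * y * a^2 + q^5 * y^2 + 3 * q^5 * y^3 + q^5 * y^3 * a - q^6 * y * a^2 - 3 * q^6 * y^2 * a + 4 * q^6 * y^3 * a - 3 * q^7 * y^2 * a - 3 * q^7 * y^3 + 5 * q^7 * y^3 * a - q^8 * y^2 * a - 3 * q^8 * y^3 - q^9 * y^3 - 5 * q^9 * y^3 * a - 4 * q^10 * y^3 * a - q^11 * y^3 * a)"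
    unfolding R_def T_def by (simp add: algebra_simps eval_nat_numeral)
  then have "?H1 - ?H2 = (F * y - y^2) * (q + q^2 + q^3 * a - q^4 + 2 * q^4 * a - q^5 - 2 * q^6 * a - q^7 * a)"
    by (simp only: assms(1) mult_zero_left add_0_right)
  then show ?thesis by (metis dvd_triv_left)
qed

subsection \<open>Evaluation of polynomials along a homomorphism\<close>

text \<open>Horner form of the map that extends \<open>e\<close> and sends the polynomial variable
  to \<open>c\<close>. A general \<open>e\<close> is allowed because a second total square is going
  to be applied to the coefficients of the first.\<close>

definition eval_hom :: "('r::comm_ring_1 \<Rightarrow> 's::comm_ring_1) \<Rightarrow> 's \<Rightarrow> 'r poly \<Rightarrow> 's" where
  "eval_hom e c p = fold_coeffs (\<lambda>a r. e a + c * r) p 0"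

locale comm_ring_hom_fun =
  fixes e :: "'r::comm_ring_1 \<Rightarrow> 's::comm_ring_1"
  assumes e_zero [simp]: "e 0 = 0" and e_one [simp]: "e 1 = 1"
    and e_add: "e (p + q) = e p + e q" and e_mult: "e (p * q) = e p * e q"
begin

lemma e_power: "e (p ^ k) = e p ^ k"
  by (induction k) (simp_all add: e_mult)

lemma e_sum: "e (sum f I) = (\<Sum>i\<in>I. e (f i))"
  by (induction I rule: infinite_finite_induct) (simp_all add: e_add)

lemma eval_hom_zero [simp]: "eval_hom e c 0 = 0"
  by (simp add: eval_hom_def)

lemma eval_hom_pCons [simp]: "eval_hom e c (pCons a p) = e a + c * eval_hom e c p"
  by (cases "pCons a p = 0") (auto simp: eval_hom_def)

lemma eval_hom_add: "eval_hom e c (p + q) = eval_hom e c p + eval_hom e c q"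
  by (induction p q rule: poly_induct2) (simp_all add: e_add algebra_simps)

lemma eval_hom_smult: "eval_hom e c (smult a p) = e a * eval_hom e c p"
  by (induction p) (simp_all add: e_mult algebra_simps)

lemma eval_hom_mult: "eval_hom e c (p * q) = eval_hom e c p * eval_hom e c q"
  by (induction p) (simp_all add: eval_hom_add eval_hom_smult algebra_simps)

lemma eval_hom_altdef:
  assumes "degree p \<le> N"
  shows "eval_hom e c p = (\<Sum>k\<le>N. e (coeff p k) * c ^ k)"
  using assms
proof (induction p arbitrary: N)
  case (pCons a p)
  show ?case
  proof (cases N)
    case 0
    then have "p = 0" using pCons by (metis degree_pCons_eq_if le_zero_eq nat.distinct(1))
    then show ?thesis using 0 by simp
  next
    case (Suc M)
    then have "degree p \<le> M" using pCons by (auto split: if_splits)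
    then show ?thesis
      using pCons.IH[of M] Suc by (simp add: sum.atMost_Suc_shift sum_distrib_left algebra_simps del: sum.atMost_Suc)
  qed
qed simp

lemma comm_ring_hom_fun_eval_hom: "comm_ring_hom_fun (eval_hom e c)"
  by standard (simp_all add: eval_hom_add eval_hom_mult one_pCons)

end

lemma comm_ring_hom_fun_const: "comm_ring_hom_fun (\<lambda>a. [:a:])"
  by standard (auto simp: one_pCons)

lemma comm_ring_hom_fun_compose:
  assumes "comm_ring_hom_fun f" "comm_ring_hom_fun g"
  shows "comm_ring_hom_fun (\<lambda>x. f (g x))"
  using assms by (simp add: comm_ring_hom_fun_def)

section \<open>A model of the Stanley-Reisner ring modulo two by normal forms\<close>

section \<open>Stanley-Reisner rings over the field with two elements\<close>

definition weight :: "('v \<Rightarrow> nat) \<Rightarrow> ('v \<Rightarrow>\<^sub>0 nat) \<Rightarrow> nat" where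
  "weight deg m = (\<Sum>v\<in>Poly_Mapping.keys m. Poly_Mapping.lookup m v * deg v)"

lemma weight_superset:
  "finite W \<Longrightarrow> Poly_Mapping.keys m \<subseteq> W \<Longrightarrow> weight deg m = (\<Sum>v\<in>W. Poly_Mapping.lookup m v * deg v)"
  unfolding weight_def by (rule sum.mono_neutral_left) (auto simp: in_keys_iff)

lemma weight_add: "weight deg (m + m') = weight deg m + weight deg m'"
  by (simp add: weight_superset[of "Poly_Mapping.keys m \<union> Poly_Mapping.keys m'"] keys_add_nat
      lookup_add add_mult_distrib sum.distrib)

lemma weight_zero [simp]: "weight deg 0 = 0"
  by (simp add: weight_def)

lemma weight_single [simp]: "weight deg (Poly_Mapping.single v k) = k * deg v"
  by (simp add: weight_superset[of "{v}"])

definition homog :: "('v \<Rightarrow> nat) \<Rightarrow> nat \<Rightarrow> (('v \<Rightarrow>\<^sub>0 nat) \<Rightarrow>\<^sub>0 'c::zero) set" where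
  "homog deg d = {p. \<forall>m\<in>Poly_Mapping.keys p. weight deg m = d}"

lemma homog_zero [simp]: "0 \<in> homog deg d"
  by (simp add: homog_def)

lemma homog_one [simp]: "1 \<in> homog deg 0"
  by (simp add: homog_def)

lemma homog_single: "weight deg m = d \<Longrightarrow> Poly_Mapping.single m c \<in> homog deg d"
  by (simp add: homog_def)

lemma homog_add: "p \<in> homog deg d \<Longrightarrow> q \<in> homog deg d \<Longrightarrow> p + q \<in> homog deg d"
  unfolding homog_def using keys_add[of p q] by blast

lemma homog_sum: "(\<And>i. i \<in> I \<Longrightarrow> f i \<in> homog deg d) \<Longrightarrow> sum f I \<in> homog deg d"
  by (induction I rule: infinite_finite_induct) (simp_all add: homog_add)

lemma homog_mult:
  assumes "p \<in> homog deg d" "q \<in> homog deg e"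
  shows "p * q \<in> homog deg (d + e)"
  unfolding homog_def
proof (intro CollectI ballI)
  fix m assume "m \<in> Poly_Mapping.keys (p * q)"
  then obtain m1 m2 where "m = m1 + m2" "m1 \<in> Poly_Mapping.keys p" "m2 \<in> Poly_Mapping.keys q"
    using keys_mult[of p q] by blast
  then show "weight deg m = d + e"
    using assms by (simp add: homog_def weight_add)
qed

lemma homog_restr: "p \<in> homog deg d \<Longrightarrow> restr M p \<in> homog deg d"
  by (simp add: homog_def keys_restr)

lemma restr_weight:
  "p \<in> homog deg d \<Longrightarrow> restr {m. weight deg m = e} p = (if d = e then p else 0)"
  by (auto simp: homog_def restr_eq_zero_iff intro!: restr_id)

text \<open>Every class modulo the Stanley-Reisner ideal has exactly one representative supported on
  face monomials, so here equality of classes is equality of polynomials.\<close>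

definition sr2_ring :: "'v set set \<Rightarrow> (('v \<Rightarrow>\<^sub>0 nat) \<Rightarrow>\<^sub>0 bit) ring" where
  "sr2_ring K = \<lparr>carrier = {p. Poly_Mapping.keys p \<subseteq> faces K},
     monoid.mult = (\<lambda>p q. restr (faces K) (p * q)), one = 1, zero = 0, add = (+)\<rparr>"

definition sr2_grading :: "('v \<Rightarrow> nat) \<Rightarrow> 'v set set \<Rightarrow> nat \<Rightarrow> (('v \<Rightarrow>\<^sub>0 nat) \<Rightarrow>\<^sub>0 bit) set" where
  "sr2_grading deg K d = carrier (sr2_ring K) \<inter> homog deg d"

lemma sr2_ring_simps [simp]:
  "monoid.mult (sr2_ring K) p q = restr (faces K) (p * q)" "monoid.one (sr2_ring K) = 1"
  "ring.zero (sr2_ring K) = 0" "ring.add (sr2_ring K) p q = p + q"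
  by (simp_all add: sr2_ring_def)

lemma sr2_carrier_iff: "p \<in> carrier (sr2_ring K) \<longleftrightarrow> restr (faces K) p = p"
proof
  assume "restr (faces K) p = p"
  then show "p \<in> carrier (sr2_ring K)"
    using keys_restr[of "faces K" p] by (metis (mono_tags) inf_le2 mem_Collect_eq partial_object.select_convs(1) sr2_ring_def)
qed (simp add: sr2_ring_def restr_id)

lemma restr_in_sr2 [simp]: "restr (faces K) p \<in> carrier (sr2_ring K)"
  by (simp add: sr2_carrier_iff restr_restr)

lemma cring_sr2_ring:
  assumes "simplicial_complex K"
  shows "cring (sr2_ring K)"
proof (rule cringI)
  show "abelian_group (sr2_ring K)"
  proof (rule abelian_groupI)
    fix p assume "p \<in> carrier (sr2_ring K)"
    then show "\<exists>q\<in>carrier (sr2_ring K). q \<oplus>\<^bsub>sr2_ring K\<^esub> p = \<zero>\<^bsub>sr2_ring K\<^esub>"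
      by (intro bexI[of _ p]) simp_all
  qed (simp_all add: sr2_carrier_iff restr_add add.assoc add.commute)
  show "comm_monoid (sr2_ring K)"
  proof (rule comm_monoidI)
    show "\<one>\<^bsub>sr2_ring K\<^esub> \<in> carrier (sr2_ring K)"
      using assms by (simp add: sr2_ring_def faces_def simplicial_complex_def)
    fix p q r
    show "p \<otimes>\<^bsub>sr2_ring K\<^esub> q \<otimes>\<^bsub>sr2_ring K\<^esub> r = p \<otimes>\<^bsub>sr2_ring K\<^esub> (q \<otimes>\<^bsub>sr2_ring K\<^esub> r)"
      by (simp add: restr_faces_mult_left[OF assms] restr_faces_mult_right[OF assms] mult.assoc)
    show "p \<otimes>\<^bsub>sr2_ring K\<^esub> q = q \<otimes>\<^bsub>sr2_ring K\<^esub> p"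
      by (simp add: mult.commute)
  qed (simp_all add: sr2_carrier_iff restr_restr)
next
  fix p q r
  show "(p \<oplus>\<^bsub>sr2_ring K\<^esub> q) \<otimes>\<^bsub>sr2_ring K\<^esub> r = p \<otimes>\<^bsub>sr2_ring K\<^esub> r \<oplus>\<^bsub>sr2_ring K\<^esub> q \<otimes>\<^bsub>sr2_ring K\<^esub> r"
    by (simp add: ring_distribs restr_add)
qed

lemma finsum_sr2_ring:
  assumes "simplicial_complex K" "\<And>i. i \<in> I \<Longrightarrow> f i \<in> carrier (sr2_ring K)" "finite I"
  shows "finsum (sr2_ring K) f I = sum f I"
proof -
  interpret cring "sr2_ring K" by (rule cring_sr2_ring) fact
  show ?thesis using assms(3,2) by induction (simp_all add: Pi_def)
qed

section \<open>From colourings to actions\<close>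

section \<open>The Steenrod action defined by a colouring\<close>

lemma A_complex_iff:
  "\<sigma> \<in> A_complex n V E \<longleftrightarrow> (\<exists>\<alpha> \<tau>. \<sigma> = \<alpha> \<union> \<tau> \<and> \<alpha> \<subseteq> X ` {..<n} \<and> \<tau> \<in> graph_complex V E)"
  by (auto simp: A_complex_def complex_join_def full_simplex_def)

lemma graph_complex_subset:
  assumes "finite_simple_graph V E" "\<tau> \<in> graph_complex V E" "\<rho> \<subseteq> \<tau>"
  shows "\<rho> \<in> graph_complex V E"
proof -
  consider "\<tau> = {}" | v where "v \<in> V" "\<tau> = {Y v}" | e where "e \<in> E" "\<tau> = Y ` e"
    using assms(2) by (auto simp: graph_complex_def)
  then show ?thesis
  proof cases
    case 3
    then obtain u v where "e = {u, v}" "u \<in> V" "v \<in> V"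
      using assms(1) by (auto simp: finite_simple_graph_def)
    then have "\<rho> = {} \<or> \<rho> = {Y u} \<or> \<rho> = {Y v} \<or> \<rho> = \<tau>"
      using assms(3) 3 by auto
    then show ?thesis
      using assms(2) \<open>u \<in> V\<close> \<open>v \<in> V\<close> by (auto simp: graph_complex_def)
  qed (use assms(3) in \<open>auto simp: graph_complex_def subset_singleton_iff\<close>)
qed

lemma simplicial_A_complex:
  assumes "finite_simple_graph V E"
  shows "simplicial_complex (A_complex n V E)"
  unfolding simplicial_complex_def
proof (intro conjI ballI subsetI)
  show "{} \<in> A_complex n V E"
    by (auto simp: A_complex_iff graph_complex_def)
next
  fix \<sigma> \<rho> assume "\<sigma> \<in> A_complex n V E" "\<rho> \<in> Pow \<sigma>"
  then obtain \<alpha> \<tau> where *: "\<sigma> = \<alpha> \<union> \<tau>" "\<alpha> \<subseteq> X ` {..<n}" "\<tau> \<in> graph_complex V E" "\<rho> \<subseteq> \<sigma>"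
    by (auto simp: A_complex_iff)
  then have "\<rho> = (\<rho> \<inter> \<alpha>) \<union> (\<rho> \<inter> \<tau>)" "\<rho> \<inter> \<alpha> \<subseteq> X ` {..<n}" "\<rho> \<inter> \<tau> \<in> graph_complex V E"
    using graph_complex_subset[OF assms *(3)] by auto
  then show "\<rho> \<in> A_complex n V E"
    unfolding A_complex_iff by blast
qed

text \<open>The vertices x_i with i < n are cone points: adding them to a face gives a face. Hence a
  non-face stays a non-face when they are deleted.\<close>

lemma A_complex_cone:
  assumes "\<sigma> - X ` {..<n} \<in> A_complex n V E"
  shows "\<sigma> \<in> A_complex n V E"
proof -
  obtain \<alpha> \<tau> where *: "\<sigma> - X ` {..<n} = \<alpha> \<union> \<tau>" "\<alpha> \<subseteq> X ` {..<n}" "\<tau> \<in> graph_complex V E"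
    using assms unfolding A_complex_iff by blast
  have "\<sigma> = (\<sigma> \<inter> X ` {..<n}) \<union> (\<sigma> - X ` {..<n})" by blast
  also have "\<dots> = ((\<sigma> \<inter> X ` {..<n}) \<union> \<alpha>) \<union> \<tau>" unfolding *(1) by blast
  finally have "\<sigma> = ((\<sigma> \<inter> X ` {..<n}) \<union> \<alpha>) \<union> \<tau>" .
  moreover have "(\<sigma> \<inter> X ` {..<n}) \<union> \<alpha> \<subseteq> X ` {..<n}" using *(2) by blast
  ultimately show ?thesis using *(3) unfolding A_complex_iff by blast
qed

lemma Y_mem_A_complex: "Y v \<in> \<sigma> \<Longrightarrow> \<sigma> \<in> A_complex n V E \<Longrightarrow> finite_simple_graph V E \<Longrightarrow> v \<in> V"
  by (fastforce simp: A_complex_iff graph_complex_def finite_simple_graph_def)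

lemma Y_pair_A_complex:
  assumes "{Y u, Y v} \<subseteq> \<sigma>" "\<sigma> \<in> A_complex n V E" "u \<noteq> v" "finite_simple_graph V E"
  shows "{u, v} \<in> E"
proof -
  obtain \<alpha> \<tau> where *: "\<sigma> = \<alpha> \<union> \<tau>" "\<alpha> \<subseteq> X ` {..<n}" "\<tau> \<in> graph_complex V E"
    using assms(2) unfolding A_complex_iff by blast
  have "Y u \<notin> \<alpha>" "Y v \<notin> \<alpha>" using *(2) by auto
  then have uv: "Y u \<in> \<tau>" "Y v \<in> \<tau>" using assms(1) *(1) by auto
  then obtain e where e: "e \<in> E" "\<tau> = Y ` e"
    using *(3) assms(3) by (auto simp: graph_complex_def)
  then obtain w z where "e = {w, z}" using assms(4) by (auto simp: finite_simple_graph_def)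
  then have "e = {u, v}" using uv e assms(3) by auto
  then show ?thesis using e by simp
qed

abbreviation cst :: "bit \<Rightarrow> ('v \<Rightarrow>\<^sub>0 nat) \<Rightarrow>\<^sub>0 bit" where
  "cst c \<equiv> Poly_Mapping.single 0 c"

lemma sum_power2_char2:
  assumes "(2 :: 'r::comm_ring_1) = 0"
  shows "(\<Sum>i\<in>I. f i :: 'r)^2 = (\<Sum>i\<in>I. (f i)^2)"
  by (induction I rule: infinite_finite_induct) (simp_all add: power2_sum assms)

lemma cst_power2 [simp]: "(cst c)^2 = cst c"
  by (cases c) (simp_all add: power2_eq_square mult_single)

lemma homog_cst [simp]: "cst c \<in> homog deg 0"
  by (simp add: homog_single)

text \<open>A span colouring in coordinates: U_v is the line through \<open>a v\<close> and V_v the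
  kernel of \<open>\<phi> v\<close>. Over two elements a functional is determined by its kernel, and
  its only nonzero value is 1, so U_v not being contained in V_v becomes \<open>dual\<close>. Edges
  are unordered, so \<open>orth\<close> expresses both inclusions.\<close>

locale vector_colouring =
  fixes n :: nat and V :: "'a set" and E :: "'a set set" and a \<phi> :: "'a \<Rightarrow> nat \<Rightarrow> bit"
  assumes graph: "finite_simple_graph V E"
    and dual: "v \<in> V \<Longrightarrow> (\<Sum>i<n. \<phi> v i * a v i) = 1"
    and orth: "{u, v} \<in> E \<Longrightarrow> (\<Sum>i<n. \<phi> u i * a v i) = 0"
    and supp: "n \<le> i \<Longrightarrow> \<phi> v i = 0"
begin

abbreviation K :: "'a var set set" where "K \<equiv> A_complex n V E"

lemma finV: "finite V" using graph by (simp add: finite_simple_graph_def)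

lemma simpK: "simplicial_complex K" by (rule simplicial_A_complex[OF graph])

definition F :: "nat \<Rightarrow> ('a var \<Rightarrow>\<^sub>0 nat) \<Rightarrow>\<^sub>0 bit" where
  "F i = (\<Sum>v\<in>V. cst (\<phi> v i) * var2 (Y v))"

definition A :: "'a \<Rightarrow> ('a var \<Rightarrow>\<^sub>0 nat) \<Rightarrow>\<^sub>0 bit" where
  "A v = (\<Sum>i<n. cst (a v i) * var2 (X i))"

fun gen :: "'a var \<Rightarrow> (('a var \<Rightarrow>\<^sub>0 nat) \<Rightarrow>\<^sub>0 bit) poly" where
  "gen (X i) = [:var2 (X i), 0, F i, 0, (var2 (X i))^2:]"
| "gen (Y v) = [:var2 (Y v), 0, 0, 0, A v * var2 (Y v), 0, (var2 (Y v))^2:]"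

text \<open>The total square, with its parameter as the polynomial variable. The images of the
  variables can be prescribed freely; additivity and the Cartan formula then come from the
  substitution homomorphism.\<close>

definition S :: "(('a var \<Rightarrow>\<^sub>0 nat) \<Rightarrow>\<^sub>0 bit) \<Rightarrow> (('a var \<Rightarrow>\<^sub>0 nat) \<Rightarrow>\<^sub>0 bit) poly" where
  "S p = subst gen p"

lemma hom_S: "comm_ring_hom_fun S"
  by standard (simp_all add: S_def subst_add subst_mult)

definition sq :: "nat \<Rightarrow> (('a var \<Rightarrow>\<^sub>0 nat) \<Rightarrow>\<^sub>0 bit) \<Rightarrow> ('a var \<Rightarrow>\<^sub>0 nat) \<Rightarrow>\<^sub>0 bit" where
  "sq k p = coeff (S p) k"

lemma sq_add: "sq k (p + q) = sq k p + sq k q"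
  by (simp add: sq_def comm_ring_hom_fun.e_add[OF hom_S])

lemma sq_zero [simp]: "sq k 0 = 0"
  by (simp add: sq_def comm_ring_hom_fun.e_zero[OF hom_S])

lemma sq_sum: "sq k (sum f I) = (\<Sum>i\<in>I. sq k (f i))"
  by (induction I rule: infinite_finite_induct) (simp_all add: sq_add)

lemma sq_mult: "sq k (p * q) = (\<Sum>i\<le>k. sq i p * sq (k - i) q)"
  by (simp add: sq_def comm_ring_hom_fun.e_mult[OF hom_S] coeff_mult)

lemma sq_one: "sq k 1 = (if k = 0 then 1 else 0)"
  by (simp add: sq_def comm_ring_hom_fun.e_one[OF hom_S])

lemma S_var: "S (var2 v) = gen v"
  by (simp add: S_def subst_var)

lemma S_cst: "S (cst c) = [:cst c:]"
  by (cases c) (simp_all add: comm_ring_hom_fun.e_zero[OF hom_S] comm_ring_hom_fun.e_one[OF hom_S] one_pCons)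

lemma sq_X: "sq k (var2 (X i)) = (if k = 0 then var2 (X i) else if k = 2 then F i else if k = 4 then (var2 (X i))^2 else 0)"
  by (auto simp: sq_def S_var coeff_pCons split: nat.splits)

lemma sq_Y: "sq k (var2 (Y v)) = (if k = 0 then var2 (Y v) else if k = 4 then A v * var2 (Y v) else if k = 6 then (var2 (Y v))^2 else 0)"
  by (auto simp: sq_def S_var coeff_pCons split: nat.splits)

lemma sq_0: "sq 0 p = p"
proof (induction p rule: mpoly_ring_induct)
  case (var v)
  then show ?case by (cases v) (simp_all add: sq_X sq_Y)
qed (simp_all add: sq_one sq_add sq_mult)

subsection \<open>Degrees and instability\<close>

text \<open>Degrees and instability are bundled because the induction over products needs them
  together: the vanishing of the high squares isolates the top one.\<close>

definition unst :: "nat \<Rightarrow> (('a var \<Rightarrow>\<^sub>0 nat) \<Rightarrow>\<^sub>0 bit) \<Rightarrow> bool" where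
  "unst d p \<longleftrightarrow> p \<in> homog var_degree d \<and> (\<forall>k. sq k p \<in> homog var_degree (d + k)) \<and>
     (\<forall>k>d. sq k p = 0) \<and> sq d p = p * p"

text \<open>In the Cartan sum for Sq^k with k >= d + e, a nonzero term needs i <= d and k - i <= e.
  This leaves only i = d, and only for k = d + e.\<close>

lemma unst_mult:
  assumes "unst d p" "unst e q"
  shows "unst (d + e) (p * q)"
proof -
  have "sq i p * sq (k - i) q \<in> homog var_degree (d + e + k)" if "i \<le> k" for i k
  proof -
    have "sq i p * sq (k - i) q \<in> homog var_degree ((d + i) + (e + (k - i)))"
      by (rule homog_mult) (use assms in \<open>unfold unst_def, blast+\<close>)
    moreover have "(d + i) + (e + (k - i)) = d + e + k" using that by simp
    ultimately show ?thesis by (simp only:)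
  qed
  then have "sq k (p * q) \<in> homog var_degree (d + e + k)" for k
    by (auto simp: sq_mult intro!: homog_sum)
  moreover have zero: "sq i p * sq (k - i) q = 0" if "d + e \<le> k" "\<not> (i = d \<and> k = d + e)" for i k
  proof -
    have "d < i \<or> e < k - i" using that by auto
    then show ?thesis using assms by (auto simp: unst_def)
  qed
  then have "sq k (p * q) = 0" if "k > d + e" for k
    using that by (auto simp: sq_mult intro!: sum.neutral)
  moreover have "sq (d + e) (p * q) = (\<Sum>i\<le>d + e. if i = d then sq d p * sq e q else 0)"
    unfolding sq_mult by (rule sum.cong) (use zero in auto)
  then have "sq (d + e) (p * q) = (p * q) * (p * q)"
    using assms by (simp add: unst_def sum.delta mult_ac)
  ultimately show ?thesis
    using assms homog_mult[of p var_degree d q e] by (simp add: unst_def)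
qed

lemma homog_var: "var2 v \<in> homog var_degree (var_degree v)"
  by (simp add: var2_def homog_single)

lemma homog_F: "F i \<in> homog var_degree 6"
  unfolding F_def using homog_mult[OF homog_cst homog_var[of "Y _"]] by (auto intro!: homog_sum)

lemma homog_A: "A v \<in> homog var_degree 4"
  unfolding A_def using homog_mult[OF homog_cst homog_var[of "X _"]] by (auto intro!: homog_sum)

lemma unst_var: "unst (var_degree v) (var2 v)"
proof (cases v)
  case (X i)
  then show ?thesis
    using homog_F[of i] homog_var[of v] homog_mult[OF homog_var[of v] homog_var[of v]]
    by (auto simp: unst_def sq_X power2_eq_square)
next
  case (Y u)
  then show ?thesis
    using homog_mult[OF homog_A[of u] homog_var[of v]] homog_var[of v] homog_mult[OF homog_var[of v] homog_var[of v]]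
    by (auto simp: unst_def sq_Y power2_eq_square)
qed

lemma unst_add: "unst d p \<Longrightarrow> unst d q \<Longrightarrow> unst d (p + q)"
proof -
  have "p * p + q * q = (p + q) * (p + q)"
    using add_self_eq_zero[of "p * q"] by (simp add: algebra_simps)
  then show "unst d p \<Longrightarrow> unst d q \<Longrightarrow> unst d (p + q)"
    by (simp add: unst_def sq_add homog_add)
qed

lemma unst_homog:
  assumes "p \<in> homog var_degree d"
  shows "unst d p"
proof -
  have monomial: "\<exists>d. unst d (Poly_Mapping.single m 1)" for m
  proof (induction m rule: monomial_mult_induct)
    case one
    have "unst 0 1" by (simp add: unst_def sq_one)
    then show ?case ..
  qed (use unst_var unst_mult in blast)+
  \<comment> \<open>The multiplicative induction provides some degree. It must be the weight,
    because a monomial is not zero.\<close>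
  have "unst d (Poly_Mapping.single m 1)" if "weight var_degree m = d" for m
  proof -
    obtain e where e: "unst e (Poly_Mapping.single m 1)" using monomial by blast
    then have "e = d" using that by (auto simp: unst_def homog_def)
    then show ?thesis using e by simp
  qed
  moreover have "Poly_Mapping.lookup p m = 1" if "m \<in> Poly_Mapping.keys p" for m
    using that by (metis bit_not_one_iff in_keys_iff)
  ultimately have *: "unst d (Poly_Mapping.single m (Poly_Mapping.lookup p m))" if "m \<in> Poly_Mapping.keys p" for m
    using assms that by (simp add: homog_def)
  have "unst d 0" by (simp add: unst_def)
  have "finite M \<Longrightarrow> M \<subseteq> Poly_Mapping.keys p \<Longrightarrow> unst d (\<Sum>m\<in>M. Poly_Mapping.single m (Poly_Mapping.lookup p m))" for M
  proof (induction M rule: finite_induct)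
    case (insert m M)
    then show ?case using * unst_add by simp
  qed (simp add: \<open>unst d 0\<close>)
  from this[OF finite_keys order_refl] show ?thesis by (simp only: sum_single_eq)
qed

lemma degree_S: "p \<in> homog var_degree d \<Longrightarrow> degree (S p) \<le> d"
  using unst_homog[of p d] by (intro degree_le) (simp add: unst_def sq_def)

subsection \<open>The squares preserve the Stanley-Reisner ideal\<close>

text \<open>Membership in the Stanley-Reisner ideal modulo two, read off the monomials: none of them
  is a face. Variables that are not vertices of \<open>K\<close> count as non-faces.\<close>

definition inI :: "(('a var \<Rightarrow>\<^sub>0 nat) \<Rightarrow>\<^sub>0 bit) \<Rightarrow> bool" where
  "inI p \<longleftrightarrow> restr (faces K) p = 0"

lemma inI_zero [simp]: "inI 0" by (simp add: inI_def)

lemma inI_add: "inI p \<Longrightarrow> inI q \<Longrightarrow> inI (p + q)"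
  by (simp add: inI_def restr_add)

lemma inI_sum: "(\<And>i. i \<in> I \<Longrightarrow> inI (f i)) \<Longrightarrow> inI (sum f I)"
  by (simp add: inI_def restr_sum)

lemma inI_mult: "inI p \<Longrightarrow> inI (p * q)"
  using restr_faces_mult_left[OF simpK, of p q] by (simp add: inI_def)

lemma inI_dvd: "inI p \<Longrightarrow> p dvd q \<Longrightarrow> inI q"
  by (auto simp: dvd_def inI_mult)

text \<open>For x_i with i < n divisibility fails in general, as Sq^2 x_i is a combination of the
  y_v. For i >= n the support condition makes \<open>F i\<close> vanish.\<close>

lemma gen_dvd:
  assumes "v \<notin> X ` {..<n}"
  shows "[:var2 v:] dvd gen v"
proof (cases v)
  case (X i)
  then have "n \<le> i" using assms by auto
  then have "F i = 0" by (simp add: F_def supp)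
  then have "gen v = [:var2 v:] * [:1, 0, 0, 0, var2 v:]" using X by (simp add: power2_eq_square)
  then show ?thesis by (rule dvdI)
next
  case (Y u)
  then have "gen v = [:var2 v:] * [:1, 0, 0, 0, A u, 0, var2 v:]" by (simp add: power2_eq_square mult.commute)
  then show ?thesis by (rule dvdI)
qed

lemma prod_var2: "finite \<sigma> \<Longrightarrow> (\<Prod>v\<in>\<sigma>. var2 v) = Poly_Mapping.single (\<Sum>v\<in>\<sigma>. Poly_Mapping.single v 1) 1"
  by (induction rule: finite_induct) (simp_all add: var2_def mult_single)

lemma const_poly_prod: "(\<Prod>v\<in>\<sigma>. [:f v:]) = [:\<Prod>v\<in>\<sigma>. f v:]"
  by (induction \<sigma> rule: infinite_finite_induct) (simp_all add: one_pCons mult.commute)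

text \<open>After deleting the cone points the support of \<open>m\<close> is still a non-face. Each
  remaining variable divides its own total square, so the squarefree monomial of this smaller
  non-face divides every coefficient of the total square of \<open>m\<close>.\<close>

lemma sq_inI_monomial:
  assumes "m \<notin> faces K"
  shows "inI (sq k (Poly_Mapping.single m 1))"
proof -
  define \<sigma> where "\<sigma> = Poly_Mapping.keys m - X ` {..<n}"
  have fin: "finite \<sigma>" by (simp add: \<sigma>_def)
  have "\<sigma> \<notin> K" using assms A_complex_cone[of "Poly_Mapping.keys m" n V E] by (auto simp: \<sigma>_def faces_def)
  then have "inI (\<Prod>v\<in>\<sigma>. var2 v)"
    using fin by (simp add: prod_var2 inI_def restr_eq_zero_iff faces_def keys_sum_single[unfolded One_nat_def])
  moreover have "(\<Prod>v\<in>\<sigma>. [:var2 v:]) dvd (\<Prod>v\<in>Poly_Mapping.keys m. gen v ^ Poly_Mapping.lookup m v)"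
  proof (rule dvd_trans)
    show "(\<Prod>v\<in>\<sigma>. [:var2 v:]) dvd (\<Prod>v\<in>\<sigma>. gen v ^ Poly_Mapping.lookup m v)"
    proof (rule prod_dvd_prod)
      fix v assume "v \<in> \<sigma>"
      then have "[:var2 v:] dvd gen v" "Poly_Mapping.lookup m v \<noteq> 0"
        by (auto simp: \<sigma>_def in_keys_iff intro!: gen_dvd)
      then show "[:var2 v:] dvd gen v ^ Poly_Mapping.lookup m v"
        using dvd_trans[OF _ dvd_power[of "Poly_Mapping.lookup m v" "gen v"]] by simp
    qed
  qed (auto simp: \<sigma>_def intro!: prod_dvd_prod_subset)
  then have "(\<Prod>v\<in>\<sigma>. var2 v) dvd sq k (Poly_Mapping.single m 1)"
    unfolding const_poly_prod sq_def S_def subst_single mon_def by (elim dvdE) simp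
  ultimately show ?thesis by (rule inI_dvd)
qed

lemma sq_inI:
  assumes "inI p"
  shows "inI (sq k p)"
proof -
  have "inI (\<Sum>m\<in>Poly_Mapping.keys p. sq k (Poly_Mapping.single m (Poly_Mapping.lookup p m)))"
  proof (rule inI_sum)
    fix m assume "m \<in> Poly_Mapping.keys p"
    then have "m \<notin> faces K" using assms by (auto simp: inI_def restr_eq_zero_iff)
    then show "inI (sq k (Poly_Mapping.single m (Poly_Mapping.lookup p m)))"
      using sq_inI_monomial[of m k] by (cases "Poly_Mapping.lookup p m") simp_all
  qed
  then show ?thesis by (simp add: sum_single_eq flip: sq_sum)
qed

text \<open>The squares descend to normal forms: what truncation removes lies in the ideal, and the
  squares preserve the ideal.\<close>

lemma restr_sq_restr: "restr (faces K) (sq k (restr (faces K) p)) = restr (faces K) (sq k p)"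
proof -
  have "inI (restr (- faces K) p)" by (auto simp: inI_def restr_eq_zero_iff keys_restr)
  then have "restr (faces K) (sq k (restr (- faces K) p)) = 0" using sq_inI by (simp add: inI_def)
  then show ?thesis
    using arg_cong[OF restr_split[of p "faces K"], of "\<lambda>p. restr (faces K) (sq k p)"]
    by (simp add: sq_add restr_add)
qed

end

subsection \<open>The Bullett-Macdonald identity\<close>

context vector_colouring
begin

definition polyI :: "(('a var \<Rightarrow>\<^sub>0 nat) \<Rightarrow>\<^sub>0 bit) poly \<Rightarrow> bool" where
  "polyI f \<longleftrightarrow> (\<forall>k. inI (coeff f k))"

lemma polyI_zero [simp]: "polyI 0"
  by (simp add: polyI_def)

lemma polyI_const: "inI c \<Longrightarrow> polyI [:c:]"
  by (simp add: polyI_def coeff_pCons split: nat.splits)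

lemma polyI_add: "polyI f \<Longrightarrow> polyI g \<Longrightarrow> polyI (f + g)"
  by (simp add: polyI_def inI_add)

lemma polyI_mult: "polyI f \<Longrightarrow> polyI (f * g)"
  by (auto simp: polyI_def coeff_mult intro!: inI_sum inI_mult)

lemma polyI_dvd: "polyI f \<Longrightarrow> f dvd g \<Longrightarrow> polyI g"
  by (auto simp: dvd_def polyI_mult)

text \<open>The total square with parameter \<open>r\<close>, that is the sum of
  \<open>[:sq k p:] * r^k\<close>; \<open>r\<close> itself is a polynomial in the formal variable
  s.\<close>

definition Er :: "(('a var \<Rightarrow>\<^sub>0 nat) \<Rightarrow>\<^sub>0 bit) poly \<Rightarrow> (('a var \<Rightarrow>\<^sub>0 nat) \<Rightarrow>\<^sub>0 bit) \<Rightarrow> (('a var \<Rightarrow>\<^sub>0 nat) \<Rightarrow>\<^sub>0 bit) poly" where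
  "Er r p = eval_hom (\<lambda>c. [:c:]) r (S p)"

lemma hom_Er: "comm_ring_hom_fun (Er r)"
  unfolding Er_def
  by (intro comm_ring_hom_fun_compose[OF _ hom_S] comm_ring_hom_fun.comm_ring_hom_fun_eval_hom comm_ring_hom_fun_const)

lemma hom_id: "comm_ring_hom_fun (\<lambda>c. c)"
  by standard simp_all

text \<open>In terms of the squares, \<open>H1 p\<close> is the sum of \<open>(s + s\<^sup>2)^k Sq\<^sup>k Sq\<^sup>l p\<close> and \<open>H2 p\<close> the sum of
  \<open>(1 + s)^k s^(2 l) Sq\<^sup>k Sq\<^sup>l p\<close> over all \<open>k\<close> and \<open>l\<close>.\<close>

definition H1 :: "(('a var \<Rightarrow>\<^sub>0 nat) \<Rightarrow>\<^sub>0 bit) \<Rightarrow> (('a var \<Rightarrow>\<^sub>0 nat) \<Rightarrow>\<^sub>0 bit) poly" where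
  "H1 p = Er ([:0, 1:] * (1 + [:0, 1:])) (eval_hom (\<lambda>c. c) 1 (S p))"

definition H2 :: "(('a var \<Rightarrow>\<^sub>0 nat) \<Rightarrow>\<^sub>0 bit) \<Rightarrow> (('a var \<Rightarrow>\<^sub>0 nat) \<Rightarrow>\<^sub>0 bit) poly" where
  "H2 p = eval_hom (Er (1 + [:0, 1:])) ([:0, 1:]^2) (S p)"

lemma hom_H1: "comm_ring_hom_fun H1"
  unfolding H1_def
  by (intro comm_ring_hom_fun_compose[OF hom_Er] comm_ring_hom_fun_compose[OF _ hom_S]
      comm_ring_hom_fun.comm_ring_hom_fun_eval_hom hom_id)

lemma hom_H2: "comm_ring_hom_fun H2"
  unfolding H2_def
  by (intro comm_ring_hom_fun_compose[OF _ hom_S] comm_ring_hom_fun.comm_ring_hom_fun_eval_hom hom_Er)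

text \<open>Written in r^2, since only even squares of the variables occur. For q = s^2 the two
  parameters satisfy (s (1 + s))^2 = q + q^2 and (1 + s)^2 = 1 + q, the quantities \<open>R\<close>
  and \<open>T\<close> of the polynomial identities.\<close>

lemma Er_X: "Er r (var2 (X i)) = [:var2 (X i):] + [:F i:] * r^2 + [:var2 (X i):]^2 * (r^2)^2"
proof -
  interpret comm_ring_hom_fun "\<lambda>c :: ('a var \<Rightarrow>\<^sub>0 nat) \<Rightarrow>\<^sub>0 bit. [:c:]" by (rule comm_ring_hom_fun_const)
  show ?thesis
    by (simp only: Er_def S_var gen.simps eval_hom_pCons eval_hom_zero e_zero e_power)
      (simp add: algebra_simps eval_nat_numeral)
qed

lemma Er_Y: "Er r (var2 (Y v)) = [:var2 (Y v):] + [:A v:] * [:var2 (Y v):] * (r^2)^2 + [:var2 (Y v):]^2 * (r^2)^3"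
proof -
  interpret comm_ring_hom_fun "\<lambda>c :: ('a var \<Rightarrow>\<^sub>0 nat) \<Rightarrow>\<^sub>0 bit. [:c:]" by (rule comm_ring_hom_fun_const)
  show ?thesis
    by (simp only: Er_def S_var gen.simps eval_hom_pCons eval_hom_zero e_zero e_power e_mult)
      (simp add: algebra_simps eval_nat_numeral)
qed

lemma Er_cst: "Er r (cst c) = [:cst c:]"
proof -
  interpret comm_ring_hom_fun "\<lambda>c :: ('a var \<Rightarrow>\<^sub>0 nat) \<Rightarrow>\<^sub>0 bit. [:c:]" by (rule comm_ring_hom_fun_const)
  show ?thesis by (simp only: Er_def S_cst eval_hom_pCons eval_hom_zero mult_zero_right add_0_right)
qed

text \<open>Squaring is additive in characteristic two, so the top terms contributed by the y_v
  assemble to the square of \<open>F i\<close>.\<close>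

lemma Er_F: "Er r (F i) = [:F i:] + [:\<Sum>v\<in>V. cst (\<phi> v i) * A v * var2 (Y v):] * (r^2)^2 + [:F i:]^2 * (r^2)^3"
proof -
  interpret c: comm_ring_hom_fun "\<lambda>c :: ('a var \<Rightarrow>\<^sub>0 nat) \<Rightarrow>\<^sub>0 bit. [:c:]" by (rule comm_ring_hom_fun_const)
  interpret e: comm_ring_hom_fun "Er r" by (rule hom_Er)
  have "(F i)^2 = (\<Sum>v\<in>V. cst (\<phi> v i) * (var2 (Y v))^2)"
    unfolding F_def by (simp only: sum_power2_char2[OF mpoly_two_eq_zero] power_mult_distrib cst_power2)
  then show ?thesis
    unfolding c.e_power[symmetric]
    by (simp only: F_def e.e_sum e.e_mult Er_cst Er_Y c.e_sum c.e_mult c.e_power sum_distrib_right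
        distrib_left sum.distrib mult.assoc ring_distribs)
qed

lemma Er_A: "Er r (A v) = [:A v:] + [:\<Sum>i<n. cst (a v i) * F i:] * r^2 + [:A v:]^2 * (r^2)^2"
proof -
  interpret c: comm_ring_hom_fun "\<lambda>c :: ('a var \<Rightarrow>\<^sub>0 nat) \<Rightarrow>\<^sub>0 bit. [:c:]" by (rule comm_ring_hom_fun_const)
  interpret e: comm_ring_hom_fun "Er r" by (rule hom_Er)
  have "(A v)^2 = (\<Sum>i<n. cst (a v i) * (var2 (X i))^2)"
    unfolding A_def by (simp only: sum_power2_char2[OF mpoly_two_eq_zero] power_mult_distrib cst_power2)
  then show ?thesis
    unfolding c.e_power[symmetric]
    by (simp only: A_def e.e_sum e.e_mult Er_cst Er_X c.e_sum c.e_mult c.e_power sum_distrib_right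
        distrib_left sum.distrib mult.assoc ring_distribs)
qed

text \<open>This is where the conditions on a colouring enter.\<close>

lemma colouring_relation: "inI ((\<Sum>i<n. cst (a v i) * F i) * var2 (Y v) - (var2 (Y v))^2)"
proof (cases "v \<in> V")
  case True
  have sum_cst: "(\<Sum>i<n. cst (c i)) = (cst (\<Sum>i<n. c i) :: ('a var \<Rightarrow>\<^sub>0 nat) \<Rightarrow>\<^sub>0 bit)" for c
    by (induction n) (simp_all only: single_add sum.lessThan_Suc lessThan_0 sum.empty single_zero)
  have "cst (a v i) * (cst (\<phi> w i) * z) = cst (\<phi> w i * a v i) * z" for i w and z :: "('a var \<Rightarrow>\<^sub>0 nat) \<Rightarrow>\<^sub>0 bit"
    by (simp only: mult.assoc[symmetric] mult_single add_0_left mult.commute[of "\<phi> w i"])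
  then have "(\<Sum>i<n. cst (a v i) * F i) = (\<Sum>i<n. \<Sum>w\<in>V. cst (\<phi> w i * a v i) * var2 (Y w))"
    by (simp only: F_def sum_distrib_left)
  also have "\<dots> = (\<Sum>w\<in>V. cst (\<Sum>i<n. \<phi> w i * a v i) * var2 (Y w))"
    by (subst sum.swap) (simp only: sum_distrib_right sum_cst[symmetric])
  also have "\<dots> = cst 1 * var2 (Y v) + (\<Sum>w\<in>V - {v}. cst (\<Sum>i<n. \<phi> w i * a v i) * var2 (Y w))"
    using finV True dual[OF True] by (simp only: sum.remove[of V v])
  finally have "(\<Sum>i<n. cst (a v i) * F i) * var2 (Y v) - (var2 (Y v))^2
      = (\<Sum>w\<in>V - {v}. cst (\<Sum>i<n. \<phi> w i * a v i) * (var2 (Y w) * var2 (Y v)))"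
    by (simp add: ring_distribs sum_distrib_right power2_eq_square mult.assoc)
  \<comment> \<open>Duality has turned the term w = v into y_v^2, which cancelled. In every other
    term either y_w y_v is a non-face monomial or orthogonality kills the scalar.\<close>
  also have "inI \<dots>"
  proof (rule inI_sum)
    fix w assume w: "w \<in> V - {v}"
    show "inI (cst (\<Sum>i<n. \<phi> w i * a v i) * (var2 (Y w) * var2 (Y v)))"
    proof (cases "{w, v} \<in> E")
      case False
      have "Poly_Mapping.single (Y w) (1::nat) + Poly_Mapping.single (Y v) 1 \<notin> faces K"
        using Y_pair_A_complex[of w v _ n V E] w False graph by (auto simp: faces_def keys_add_nat)
      then have "inI (var2 (Y w) * var2 (Y v))"
        by (simp add: var2_def mult_single inI_def restr_eq_zero_iff)
      then show ?thesis by (metis inI_mult mult.commute)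
    qed (simp only: orth single_zero mult_zero_left inI_zero)
  qed
  finally show ?thesis .
next
  \<comment> \<open>For a label outside \<open>V\<close> the variable itself lies in the
    ideal.\<close>
  case False
  then have "Poly_Mapping.single (Y v) (1::nat) \<notin> faces K"
    using Y_mem_A_complex[of v _ n V E] graph by (auto simp: faces_def)
  then have "inI (var2 (Y v))"
    by (simp add: var2_def inI_def restr_eq_zero_iff)
  then have "inI (var2 (Y v) * ((\<Sum>i<n. cst (a v i) * F i) - var2 (Y v)))"
    by (rule inI_mult)
  then show ?thesis by (simp add: right_diff_distrib power2_eq_square mult.commute)
qed

text \<open>On x_i the two sides agree in the polynomial ring; on y_v their difference is a multiple
  of the colouring relation.\<close>

lemma bullett_macdonald_var: "polyI (H1 (var2 v) - H2 (var2 v))"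
proof -
  define s :: "(('a var \<Rightarrow>\<^sub>0 nat) \<Rightarrow>\<^sub>0 bit) poly" where "s = [:0, 1:]"
  define q where "q = s^2"
  interpret c: comm_ring_hom_fun "\<lambda>c :: ('a var \<Rightarrow>\<^sub>0 nat) \<Rightarrow>\<^sub>0 bit. [:c:]" by (rule comm_ring_hom_fun_const)
  interpret i: comm_ring_hom_fun "\<lambda>c :: ('a var \<Rightarrow>\<^sub>0 nat) \<Rightarrow>\<^sub>0 bit. c" by (rule hom_id)
  have r1: "(s * (1 + s))^2 = q + q^2" and r2: "(1 + s)^2 = 1 + q"
    by (simp_all add: q_def power2_eq_square algebra_simps flip: mult_2)
  interpret e1: comm_ring_hom_fun "Er (s * (1 + s))" by (rule hom_Er)
  interpret e2: comm_ring_hom_fun "Er (1 + s)" by (rule hom_Er)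
  have "H1 (var2 (X i)) = H2 (var2 (X i))" for i
  proof -
    have 1: "H1 (var2 (X i)) = Er (s * (1 + s)) (var2 (X i)) + Er (s * (1 + s)) (F i) + (Er (s * (1 + s)) (var2 (X i)))^2"
      by (simp only: H1_def S_var gen.simps s_def[symmetric] i.eval_hom_pCons i.eval_hom_zero e1.e_add e1.e_power
          mult_1_left mult_zero_right add_0_left add_0_right add.assoc)
    have 2: "H2 (var2 (X i)) = Er (1 + s) (var2 (X i)) + q^2 * Er (1 + s) (F i) + q^4 * (Er (1 + s) (var2 (X i)))^2"
      by (simp only: H2_def S_var gen.simps s_def[symmetric] q_def[symmetric] e2.eval_hom_pCons e2.eval_hom_zero
          e2.e_zero e2.e_power) (simp add: algebra_simps eval_nat_numeral)
    show ?thesis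
      unfolding 1 2 Er_X Er_F r1 r2 by (rule char2_identity_X) simp
  qed
  moreover have "polyI (H1 (var2 (Y u)) - H2 (var2 (Y u)))" for u
  proof -
    have 1: "H1 (var2 (Y u)) = Er (s * (1 + s)) (var2 (Y u)) + Er (s * (1 + s)) (A u) * Er (s * (1 + s)) (var2 (Y u)) + (Er (s * (1 + s)) (var2 (Y u)))^2"
      by (simp only: H1_def S_var gen.simps s_def[symmetric] i.eval_hom_pCons i.eval_hom_zero e1.e_add e1.e_power
          e1.e_mult mult_1_left mult_zero_right add_0_left add_0_right add.assoc)
    have 2: "H2 (var2 (Y u)) = Er (1 + s) (var2 (Y u)) + q^4 * (Er (1 + s) (A u) * Er (1 + s) (var2 (Y u))) + q^6 * (Er (1 + s) (var2 (Y u)))^2"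
      by (simp only: H2_def S_var gen.simps s_def[symmetric] q_def[symmetric] e2.eval_hom_pCons e2.eval_hom_zero
          e2.e_zero e2.e_power e2.e_mult) (simp add: algebra_simps eval_nat_numeral)
    have "polyI ([:\<Sum>i<n. cst (a u i) * F i:] * [:var2 (Y u):] - [:var2 (Y u):]^2)"
      unfolding c.e_mult[symmetric] c.e_power[symmetric] diff_pCons diff_0_right
      by (rule polyI_const[OF colouring_relation])
    then show ?thesis
      unfolding 1 2 Er_Y Er_A r1 r2 by (rule polyI_dvd) (rule char2_identity_Y, simp)
  qed
  ultimately show ?thesis by (cases v) simp_all
qed

text \<open>Two ring homomorphisms that agree on generators modulo an ideal agree modulo it
  everywhere.\<close>

lemma bullett_macdonald: "polyI (H1 p - H2 p)"
proof -
  interpret h1: comm_ring_hom_fun H1 by (rule hom_H1)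
  interpret h2: comm_ring_hom_fun H2 by (rule hom_H2)
  show ?thesis
  proof (induction p rule: mpoly_ring_induct)
    case (add p q)
    have "H1 (p + q) - H2 (p + q) = (H1 p - H2 p) + (H1 q - H2 q)"
      by (simp add: h1.e_add h2.e_add)
    then show ?case using add polyI_add by simp
  next
    case (mult p q)
    have "H1 (p * q) - H2 (p * q) = (H1 p - H2 p) * H1 q + (H1 q - H2 q) * H2 p"
      by (simp add: h1.e_mult h2.e_mult algebra_simps)
    then show ?case using mult polyI_add polyI_mult by simp
  qed (simp_all add: bullett_macdonald_var)
qed

end

subsection \<open>The Adem relations\<close>

context vector_colouring
begin

text \<open>The functional dual to the powers of \<open>s + s\<^sup>2\<close>, namely the residue of
  \<open>f ds / (s + s\<^sup>2)^(k + 1)\<close>.\<close>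

definition residue_at :: "nat \<Rightarrow> (('a var \<Rightarrow>\<^sub>0 nat) \<Rightarrow>\<^sub>0 bit) poly \<Rightarrow> ('a var \<Rightarrow>\<^sub>0 nat) \<Rightarrow>\<^sub>0 bit" where
  "residue_at k f = fps_nth (fps_of_poly f * neg_binomial k) k"

lemma residue_at_add: "residue_at k (f + g) = residue_at k f + residue_at k g"
  by (simp add: residue_at_def fps_of_poly_add ring_distribs)

lemma residue_at_zero [simp]: "residue_at k 0 = 0"
  by (simp add: residue_at_def)

lemma residue_at_sum: "residue_at k (sum f I) = (\<Sum>i\<in>I. residue_at k (f i))"
  by (induction I rule: infinite_finite_induct) (simp_all add: residue_at_add)

lemma residue_at_const: "residue_at k ([:c:] * f) = c * residue_at k f"
  by (simp only: residue_at_def fps_of_poly_mult fps_of_poly_const mult.assoc fps_mult_left_const_nth)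

lemma inI_residue_at: "polyI f \<Longrightarrow> inI (residue_at k f)"
  unfolding residue_at_def fps_mult_nth by (intro inI_sum inI_mult) (simp add: polyI_def)

lemma residue_at_lhs: "residue_at k (([:0, 1:] * (1 + [:0, 1:]))^e) = (if e = k then 1 else 0)"
  by (simp only: residue_at_def fps_of_poly_mult fps_of_poly_power fps_of_poly_add fps_of_poly_1
      fps_of_poly_fps_X nth_neg_binomial_X_power[OF mpoly_two_eq_zero])

lemma residue_at_rhs_eq:
  "residue_at k ((1 + [:0, 1:])^e * ([:0, 1:]^2)^b) = fps_nth (fps_X ^ (2 * b) * (1 + fps_X)^e * neg_binomial k) k"
  by (simp only: residue_at_def fps_of_poly_mult fps_of_poly_power fps_of_poly_add fps_of_poly_1
      fps_of_poly_fps_X power_mult[symmetric] mult.commute[of "(1 + fps_X)^e"])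

lemma residue_at_rhs:
  "k < e \<Longrightarrow> residue_at k ((1 + [:0, 1:])^e * ([:0, 1:]^2)^b)
    = (if 2 * b \<le> k \<and> odd ((e - Suc k) choose (k - 2 * b)) then 1 else 0)"
  unfolding residue_at_rhs_eq by (rule nth_neg_binomial_power[OF mpoly_two_eq_zero])

lemma residue_at_rhs_zero: "k < 2 * b \<Longrightarrow> residue_at k ((1 + [:0, 1:])^e * ([:0, 1:]^2)^b) = 0"
  unfolding residue_at_rhs_eq mult.assoc by (simp only: fps_X_power_mult_nth'[OF mpoly_two_eq_zero]) simp

text \<open>Being 0 or 1, the residues are scalars, so multiplying by them respects weights when
  homogeneous parts are extracted. For e <= k the residue is a coefficient of (1 + X)^-(k - e +
  1).\<close>

lemma residue_at_rhs_cases: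
  "residue_at k ((1 + [:0, 1:])^e * ([:0, 1:]^2)^b) \<in> {0, 1}"
proof (cases "k < e")
  case False
  then have e: "e \<le> k" by simp
  show ?thesis
    unfolding residue_at_rhs_eq mult.assoc neg_binomial_mult_le[OF mpoly_two_eq_zero e]
      fps_X_power_mult_nth'[OF mpoly_two_eq_zero]
    by (simp only: neg_binomial_def fps_nth_Abs_fps char2_of_nat[OF mpoly_two_eq_zero]) simp
qed (simp add: residue_at_rhs)

lemma Er_sum:
  assumes "p \<in> homog var_degree d" "d \<le> N"
  shows "Er r p = (\<Sum>e\<le>N. [:sq e p:] * r^e)"
proof -
  interpret c: comm_ring_hom_fun "\<lambda>c :: ('a var \<Rightarrow>\<^sub>0 nat) \<Rightarrow>\<^sub>0 bit. [:c:]" by (rule comm_ring_hom_fun_const)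
  show ?thesis
    using c.eval_hom_altdef[of "S p" N r] degree_S[OF assms(1)] assms(2) by (simp add: Er_def sq_def)
qed

text \<open>The bound 2 d covers iterated total squares: Sq^b p is zero for b > d, and otherwise its
  degree d + b <= 2 d bounds the squares that act on it.\<close>

context
  fixes p :: "('a var \<Rightarrow>\<^sub>0 nat) \<Rightarrow>\<^sub>0 bit" and d N :: nat
  assumes p: "p \<in> homog var_degree d" and N: "2 * d \<le> N"
begin

lemma Er_sq_sum: "Er r (sq b p) = (\<Sum>e\<le>N. [:sq e (sq b p):] * r^e)"
proof (cases "b \<le> d")
  case True
  then show ?thesis using unst_homog[OF p] N by (intro Er_sum[of _ "d + b"]) (auto simp: unst_def)
next
  case False
  then show ?thesis using unst_homog[OF p] by (intro Er_sum[of _ 0]) (auto simp: unst_def)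
qed

lemma degree_S_le: "degree (S p) \<le> N"
  using degree_S[OF p] N by linarith

lemma residue_at_H1: "residue_at k (H1 p) = (\<Sum>b\<le>N. \<Sum>e\<le>N. sq e (sq b p) * (if e = k then 1 else 0))"
proof -
  interpret i: comm_ring_hom_fun "\<lambda>c :: ('a var \<Rightarrow>\<^sub>0 nat) \<Rightarrow>\<^sub>0 bit. c" by (rule hom_id)
  interpret e: comm_ring_hom_fun "Er ([:0, 1:] * (1 + [:0, 1:]))" by (rule hom_Er)
  have "eval_hom (\<lambda>c. c) 1 (S p) = (\<Sum>b\<le>N. sq b p)"
    using i.eval_hom_altdef[OF degree_S_le, of 1] by (simp only: sq_def power_one mult_1_right)
  then show ?thesis
    by (simp only: H1_def e.e_sum Er_sq_sum residue_at_sum residue_at_const residue_at_lhs)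
qed

lemma residue_at_H2: "residue_at k (H2 p) = (\<Sum>b\<le>N. \<Sum>e\<le>N. sq e (sq b p) * residue_at k ((1 + [:0, 1:])^e * ([:0, 1:]^2)^b))"
proof -
  interpret e: comm_ring_hom_fun "Er (1 + [:0, 1:])" by (rule hom_Er)
  have "H2 p = (\<Sum>b\<le>N. Er (1 + [:0, 1:]) (sq b p) * ([:0, 1:]^2)^b)"
    using e.eval_hom_altdef[OF degree_S_le, of "[:0, 1:]^2"] by (simp only: H2_def sq_def)
  then show ?thesis
    by (simp only: Er_sq_sum residue_at_sum residue_at_const sum_distrib_right mult.assoc)
qed

text \<open>The part of weight d + k collects exactly the compositions Sq^e Sq^b with e + b = k.
  This replaces the second parameter of the Bullett-Macdonald identity.\<close>

lemma restr_weight_term: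
  assumes "c \<in> {0, 1}"
  shows "restr {m. weight var_degree m = d + k} (sq e (sq b p) * c) = (if e + b = k then sq e (sq b p) * c else 0)"
proof -
  have "sq b p \<in> homog var_degree (d + b)"
    using unst_homog[OF p] by (simp add: unst_def)
  then have "sq e (sq b p) \<in> homog var_degree (d + b + e)"
    using unst_homog by (simp add: unst_def)
  then have "restr {m. weight var_degree m = d + k} (sq e (sq b p)) = (if d + b + e = d + k then sq e (sq b p) else 0)"
    by (rule restr_weight)
  then show ?thesis using assms by auto
qed

end

text \<open>Apply the residue functional at a' to both sides of the Bullett-Macdonald identity and
  keep weight d + a' + b'. On the left only e = a', b = b' survives. On the right each b = j forces
  e = a' + b' - j, and the residue is the Adem coefficient.\<close>

lemma adem_homog:
  assumes p: "p \<in> homog var_degree d" and ab: "a' < 2 * b'"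
  shows "restr (faces K) (sq a' (sq b' p))
    = restr (faces K) (\<Sum>j\<le>a' div 2. if odd ((b' - 1 - j) choose (a' - 2 * j)) then sq (a' + b' - j) (sq j p) else 0)"
proof -
  \<comment> \<open>Large enough for the degree bound and for every index a', b' and a' + b' - j
    that is picked out of a sum.\<close>
  define N where "N = 2 * d + a' + b'"
  have N: "2 * d \<le> N" by (simp add: N_def)
  define W where "W = {m :: 'a var \<Rightarrow>\<^sub>0 nat. weight var_degree m = d + (a' + b')}"
  define \<mu> where "\<mu> e b = residue_at a' ((1 + [:0, 1:])^e * ([:0, 1:]^2)^b)" for e b
  note term_eq = restr_weight_term[OF p N, where k = "a' + b'", folded W_def]
  have "restr W (residue_at a' (H1 p)) = (\<Sum>b\<le>N. \<Sum>e\<le>N. restr W (sq e (sq b p) * (if e = a' then 1 else 0)))"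
    by (simp only: residue_at_H1[OF p N] restr_sum)
  also have "\<dots> = (\<Sum>b\<le>N. if b = b' then sq a' (sq b' p) else 0)"
  proof (rule sum.cong[OF HOL.refl])
    fix b
    have "(\<Sum>e\<le>N. restr W (sq e (sq b p) * (if e = a' then 1 else 0)))
      = (\<Sum>e\<le>N. if e = a' then (if b = b' then sq a' (sq b' p) else 0) else 0)"
      by (rule sum.cong[OF HOL.refl], subst term_eq) auto
    then show "(\<Sum>e\<le>N. restr W (sq e (sq b p) * (if e = a' then 1 else 0))) = (if b = b' then sq a' (sq b' p) else 0)"
      by (simp add: N_def)
  qed
  also have "\<dots> = sq a' (sq b' p)" by (simp add: N_def)
  finally have lhs: "restr W (residue_at a' (H1 p)) = sq a' (sq b' p)" .
  have inner: "(\<Sum>e\<le>N. restr W (sq e (sq b p) * \<mu> e b))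
    = (if b \<in> {..a' div 2} then if odd ((b' - 1 - b) choose (a' - 2 * b)) then sq (a' + b' - b) (sq b p) else 0 else 0)" for b
  proof (cases "b \<le> a' div 2")
    case True
    \<comment> \<open>The Adem condition a' < 2 b' enters here: it gives b < b', hence e = a' + b' -
      b > a', the range in which the residue is an ordinary binomial coefficient.\<close>
    then have b: "b < b'" "2 * b \<le> a'" using ab by auto
    have "(\<Sum>e\<le>N. restr W (sq e (sq b p) * \<mu> e b))
      = (\<Sum>e\<le>N. if e = a' + b' - b then sq (a' + b' - b) (sq b p) * \<mu> (a' + b' - b) b else 0)"
      using b residue_at_rhs_cases by (intro sum.cong[OF HOL.refl], subst term_eq) (auto simp: \<mu>_def)
    also have "\<dots> = sq (a' + b' - b) (sq b p) * \<mu> (a' + b' - b) b"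
      by (simp add: N_def)
    also have "\<mu> (a' + b' - b) b = (if odd ((b' - 1 - b) choose (a' - 2 * b)) then 1 else 0)"
      using b residue_at_rhs[of a' "a' + b' - b" b] by (simp add: \<mu>_def)
    finally show ?thesis using True by simp
  next
    case False
    then have "\<mu> e b = 0" for e unfolding \<mu>_def by (intro residue_at_rhs_zero) simp
    then show ?thesis using False by simp
  qed
  have "restr W (residue_at a' (H2 p)) = (\<Sum>b\<le>N. \<Sum>e\<le>N. restr W (sq e (sq b p) * \<mu> e b))"
    by (simp only: residue_at_H2[OF p N] restr_sum \<mu>_def)
  also have "\<dots> = (\<Sum>b\<in>{..N} \<inter> {..a' div 2}. if odd ((b' - 1 - b) choose (a' - 2 * b)) then sq (a' + b' - b) (sq b p) else 0)"
    by (simp only: inner sum.inter_restrict[OF finite_atMost])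
  also have "{..N} \<inter> {..a' div 2} = {..a' div 2}" by (auto simp: N_def)
  finally have rhs: "restr W (residue_at a' (H2 p))
    = (\<Sum>b\<le>a' div 2. if odd ((b' - 1 - b) choose (a' - 2 * b)) then sq (a' + b' - b) (sq b p) else 0)" .
  have "inI (residue_at a' (H1 p - H2 p))"
    by (rule inI_residue_at[OF bullett_macdonald])
  moreover have "residue_at a' (H1 p) = residue_at a' (H1 p - H2 p) + residue_at a' (H2 p)"
    by (simp only: residue_at_add[symmetric] diff_add_cancel)
  ultimately have "restr (faces K) (residue_at a' (H1 p)) = restr (faces K) (residue_at a' (H2 p))"
    by (simp only: inI_def restr_add add_0_left)
  then have "restr W (restr (faces K) (residue_at a' (H1 p))) = restr W (restr (faces K) (residue_at a' (H2 p)))"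
    by (rule arg_cong)
  \<comment> \<open>The identity is known only after truncation to faces, the evaluated sums only
    after restriction by weight; the two projections commute.\<close>
  then have "restr (faces K) (restr W (residue_at a' (H1 p))) = restr (faces K) (restr W (residue_at a' (H2 p)))"
    by (simp only: restr_restr Int_commute)
  then show ?thesis by (simp only: lhs rhs)
qed

lemma adem_sq:
  assumes "a' < 2 * b'"
  shows "restr (faces K) (sq a' (sq b' p))
    = restr (faces K) (\<Sum>j\<le>a' div 2. if odd ((b' - 1 - j) choose (a' - 2 * j)) then sq (a' + b' - j) (sq j p) else 0)"
proof (induction p rule: mpoly_induct)
  case (monomial m)
  show ?case by (rule adem_homog[OF homog_single[OF HOL.refl] assms])
next
  case (add p q)
  have "(\<Sum>j\<le>a' div 2. if odd ((b' - 1 - j) choose (a' - 2 * j)) then sq (a' + b' - j) (sq j (p + q)) else 0)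
    = (\<Sum>j\<le>a' div 2. if odd ((b' - 1 - j) choose (a' - 2 * j)) then sq (a' + b' - j) (sq j p) else 0)
      + (\<Sum>j\<le>a' div 2. if odd ((b' - 1 - j) choose (a' - 2 * j)) then sq (a' + b' - j) (sq j q) else 0)"
    unfolding sum.distrib[symmetric] by (rule sum.cong[OF HOL.refl]) (simp add: sq_add)
  then show ?case by (simp only: add sq_add restr_add)
qed (simp cong: if_cong)

subsection \<open>The action of the Steenrod algebra\<close>

text \<open>\<open>OneT\<close> acts as truncation rather than as the identity, so that congruent
  terms act equally on all polynomials and not only on normal forms.\<close>

primrec act_term :: "sq_term \<Rightarrow> (('a var \<Rightarrow>\<^sub>0 nat) \<Rightarrow>\<^sub>0 bit) \<Rightarrow> ('a var \<Rightarrow>\<^sub>0 nat) \<Rightarrow>\<^sub>0 bit" where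
  "act_term (SqT i) p = restr (faces K) (sq i p)"
| "act_term ZeroT p = 0"
| "act_term OneT p = restr (faces K) p"
| "act_term (AddT s t) p = act_term s p + act_term t p"
| "act_term (MulT s t) p = act_term s (act_term t p)"

lemma act_term_add: "act_term t (p + q) = act_term t p + act_term t q"
  by (induction t arbitrary: p q) (simp_all add: sq_add restr_add add_ac)

lemma restr_act_term: "restr (faces K) (act_term t p) = act_term t p"
  by (induction t arbitrary: p) (simp_all add: restr_restr restr_add)

lemma act_term_restr: "act_term t (restr (faces K) p) = act_term t p"
  by (induction t) (simp_all add: restr_sq_restr restr_restr)

lemma act_sum_term: "act_term (sum_term ts) p = (\<Sum>t\<leftarrow>ts. act_term t p)"
  by (induction ts) simp_all

lemma act_adem_rhs: "act_term (adem_rhs a' b') p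
  = restr (faces K) (\<Sum>j\<le>a' div 2. if odd ((b' - 1 - j) choose (a' - 2 * j)) then sq (a' + b' - j) (sq j p) else 0)"
proof -
  have "act_term (adem_rhs a' b') p
    = (\<Sum>j\<leftarrow>[0..<a' div 2 + 1]. if odd ((b' - 1 - j) choose (a' - 2 * j)) then restr (faces K) (sq (a' + b' - j) (sq j p)) else 0)"
    unfolding adem_rhs_def act_sum_term map_map comp_def
    by (intro arg_cong[of _ _ sum_list] map_cong HOL.refl) (simp add: restr_sq_restr)
  also have "\<dots> = (\<Sum>j\<le>a' div 2. if odd ((b' - 1 - j) choose (a' - 2 * j)) then restr (faces K) (sq (a' + b' - j) (sq j p)) else 0)"
    by (simp only: sum_list_distinct_conv_sum_set[OF distinct_upt] set_upt atLeast0LessThan Suc_eq_plus1[symmetric] lessThan_Suc_atMost)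
  also have "\<dots> = restr (faces K) (\<Sum>j\<le>a' div 2. if odd ((b' - 1 - j) choose (a' - 2 * j)) then sq (a' + b' - j) (sq j p) else 0)"
    unfolding restr_sum by (rule sum.cong[OF HOL.refl]) simp
  finally show ?thesis .
qed

lemma act_term_cong: "steenrod_eq s t \<Longrightarrow> act_term s = act_term t"
proof (induction rule: steenrod_eq.induct)
  case (adem a' b')
  show ?case
    by (rule ext) (simp only: act_term.simps restr_sq_restr act_adem_rhs adem_sq[OF adem(2)])
qed (auto simp: fun_eq_iff act_term_add restr_act_term act_term_restr sq_0 add_ac)

definition act :: "steenrod \<Rightarrow> (('a var \<Rightarrow>\<^sub>0 nat) \<Rightarrow>\<^sub>0 bit) \<Rightarrow> ('a var \<Rightarrow>\<^sub>0 nat) \<Rightarrow>\<^sub>0 bit" where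
  "act x = act_term (rep_steenrod x)"

lemma act_abs: "act (abs_steenrod t) = act_term t"
  unfolding act_def by (rule act_term_cong) (rule Quotient3_rep_abs[OF Quotient3_steenrod steenrod_eq.refl])

lemma act_Sq: "act (Sq k) p = restr (faces K) (sq k p)"
  by (simp add: Sq.abs_eq act_abs)

lemma act_plus: "act (x + y) p = act x p + act y p"
  by (induction x rule: steenrod.abs_induct, induction y rule: steenrod.abs_induct) (simp add: plus_steenrod.abs_eq act_abs)

lemma act_times: "act (x * y) p = act x (act y p)"
  by (induction x rule: steenrod.abs_induct, induction y rule: steenrod.abs_induct) (simp add: times_steenrod.abs_eq act_abs)

lemma act_one: "act 1 p = restr (faces K) p"
  by (simp add: one_steenrod.abs_eq act_abs)

lemma act_zero: "act 0 p = 0"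
  by (simp add: zero_steenrod.abs_eq act_abs)

lemma act_homog:
  assumes "x \<in> steenrod_grading k" "p \<in> homog var_degree d"
  shows "act x p \<in> homog var_degree (k + d)"
  using assms(1)
proof (induction rule: steenrod_grading.induct)
  case (mono ks)
  have "act (prod_list (map Sq ks)) p \<in> homog var_degree (sum_list ks + d)"
  proof (induction ks)
    case (Cons i ks)
    have "sq i (act (prod_list (map Sq ks)) p) \<in> homog var_degree (sum_list ks + d + i)"
      using unst_homog[OF Cons] by (simp add: unst_def)
    then show ?case by (simp add: act_times act_Sq homog_restr add_ac)
  qed (simp add: act_one homog_restr assms)
  then show ?case using mono by simp
qed (simp_all add: act_zero act_plus homog_add)

lemma steenrod_action_act: "steenrod_action (sr2_ring K) (sr2_grading var_degree K) act"
  unfolding steenrod_action_def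
proof (intro conjI allI ballI impI)
  fix x y p q
  assume p: "p \<in> carrier (sr2_ring K)"
  show "act x p \<in> carrier (sr2_ring K)"
    by (simp add: act_def sr2_carrier_iff restr_act_term)
  show "act x (p \<oplus>\<^bsub>sr2_ring K\<^esub> q) = act x p \<oplus>\<^bsub>sr2_ring K\<^esub> act x q"
    by (simp add: act_def act_term_add)
  show "act (x + y) p = act x p \<oplus>\<^bsub>sr2_ring K\<^esub> act y p"
    by (simp add: act_plus)
  show "act 1 p = p"
    using p by (simp add: act_one sr2_carrier_iff)
  show "act (x * y) p = act x (act y p)"
    by (rule act_times)
next
  fix k d x p
  assume "x \<in> steenrod_grading k" "p \<in> sr2_grading var_degree K d"
  then show "act x p \<in> sr2_grading var_degree K (k + d)"
    by (simp add: sr2_grading_def act_homog) (simp add: act_def sr2_carrier_iff restr_act_term)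
next
  fix k p q
  assume "p \<in> carrier (sr2_ring K)" "q \<in> carrier (sr2_ring K)"
  have "(\<Oplus>\<^bsub>sr2_ring K\<^esub>i\<in>{..k}. act (Sq i) p \<otimes>\<^bsub>sr2_ring K\<^esub> act (Sq (k - i)) q)
    = (\<Sum>i\<le>k. restr (faces K) (sq i p * sq (k - i) q))"
    by (subst finsum_sr2_ring[OF simpK])
      (simp_all add: act_Sq restr_faces_mult_left[OF simpK] restr_faces_mult_right[OF simpK])
  then show "act (Sq k) (p \<otimes>\<^bsub>sr2_ring K\<^esub> q)
    = (\<Oplus>\<^bsub>sr2_ring K\<^esub>i\<in>{..k}. act (Sq i) p \<otimes>\<^bsub>sr2_ring K\<^esub> act (Sq (k - i)) q)"
    by (simp add: act_Sq restr_sq_restr sq_mult restr_sum)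
next
  fix d p
  assume "p \<in> sr2_grading var_degree K d"
  then have "unst d p" by (simp add: sr2_grading_def unst_homog)
  then show "act (Sq d) p = p \<otimes>\<^bsub>sr2_ring K\<^esub> p" "\<And>k. d < k \<Longrightarrow> act (Sq k) p = \<zero>\<^bsub>sr2_ring K\<^esub>"
    by (simp_all add: act_Sq unst_def)
qed

end

section \<open>From actions to colourings\<close>

section \<open>The colouring defined by a Steenrod action\<close>

declare add_bit_eq_xor [simp del] mult_bit_eq_and [simp del]

lemma Sq_0: "Sq 0 = 1"
  by transfer (rule steenrod_eq.Sq_zero)

text \<open>The Adem coefficients are (3 choose 2) = 3 for j = 0 and (2 choose 0) = 1 for j = 1,
  both odd. This is the only Adem relation drawn upon in the passage from an action to a
  colouring.\<close>

lemma Sq_2_Sq_4: "Sq 2 * Sq 4 = Sq 6 + Sq 5 * Sq 1"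
proof -
  have "adem_rhs 2 4 = AddT (MulT (SqT 6) (SqT 0)) (AddT (MulT (SqT 5) (SqT 1)) ZeroT)"
  proof -
    have "(3::nat) choose 2 = 3" by (simp add: eval_nat_numeral)
    moreover have "[0..<2] = [0, 1]" by (simp add: upt_rec)
    ultimately show ?thesis by (simp add: adem_rhs_def)
  qed
  then have "steenrod_eq (MulT (SqT 2) (SqT 4)) (AddT (MulT (SqT 6) (SqT 0)) (AddT (MulT (SqT 5) (SqT 1)) ZeroT))"
    using steenrod_eq.adem[of 2 4] by simp
  then have "Sq 2 * Sq 4 = Sq 6 * Sq 0 + (Sq 5 * Sq 1 + 0)"
    by transfer
  then show ?thesis by (simp add: Sq_0)
qed

lemma lookup_mult_single: "Poly_Mapping.lookup (p * Poly_Mapping.single k c) (m + k) = Poly_Mapping.lookup p m * (c :: bit)"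
  for k m :: "'v \<Rightarrow>\<^sub>0 nat"
  by (induction p rule: poly_mapping_add_induct)
    (simp_all add: mult_single lookup_single when_def ring_distribs lookup_add)

lemma lookup_mult_single_eq_zero:
  fixes k m :: "'v \<Rightarrow>\<^sub>0 nat" and p :: "('v \<Rightarrow>\<^sub>0 nat) \<Rightarrow>\<^sub>0 bit"
  assumes "\<not> Poly_Mapping.keys k \<subseteq> Poly_Mapping.keys m"
  shows "Poly_Mapping.lookup (p * Poly_Mapping.single k c) m = 0"
proof -
  have "m \<notin> Poly_Mapping.keys (p * Poly_Mapping.single k c)"
  proof
    assume "m \<in> Poly_Mapping.keys (p * Poly_Mapping.single k c)"
    then obtain m' k' where "m = m' + k'" "k' \<in> Poly_Mapping.keys (Poly_Mapping.single k c)"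
      using keys_mult[of p "Poly_Mapping.single k c"] by blast
    then show False using assms by (auto simp: keys_add_nat split: if_splits)
  qed
  then show ?thesis by (simp add: in_keys_iff)
qed

lemma sum_single_superset:
  assumes "finite M" "Poly_Mapping.keys p \<subseteq> M"
  shows "p = (\<Sum>m\<in>M. Poly_Mapping.single m (Poly_Mapping.lookup p m))"
proof -
  have "p = (\<Sum>m\<in>Poly_Mapping.keys p. Poly_Mapping.single m (Poly_Mapping.lookup p m))"
    by (simp add: sum_single_eq)
  also have "\<dots> = (\<Sum>m\<in>M. Poly_Mapping.single m (Poly_Mapping.lookup p m))"
    using assms by (intro sum.mono_neutral_left) (auto simp: in_keys_iff)
  finally show ?thesis .
qed

subsection \<open>Monomials of small degree\<close>

definition xm :: "nat \<Rightarrow> 'a var \<Rightarrow>\<^sub>0 nat" where "xm i = Poly_Mapping.single (X i) 1"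
definition ym :: "'a \<Rightarrow> 'a var \<Rightarrow>\<^sub>0 nat" where "ym v = Poly_Mapping.single (Y v) 1"

lemma keys_xm [simp]: "Poly_Mapping.keys (xm i) = {X i}"
  and keys_ym [simp]: "Poly_Mapping.keys (ym v) = {Y v}"
  by (simp_all add: xm_def ym_def)

lemma lookup_xm: "Poly_Mapping.lookup (xm i) v = (if v = X i then 1 else 0)"
  and lookup_ym: "Poly_Mapping.lookup (ym w) v = (if v = Y w then 1 else 0)"
  by (simp_all add: xm_def ym_def lookup_single when_def)

lemma var2_X: "var2 (X i) = Poly_Mapping.single (xm i) 1"
  and var2_Y: "var2 (Y v) = Poly_Mapping.single (ym v) 1"
  by (simp_all add: var2_def xm_def ym_def)

text \<open>Peels off one variable, so that the monomials of a given degree are found by descent in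
  steps of 4 and 6.\<close>

lemma weight_cases:
  obtains "m = 0" "weight var_degree m = 0"
  | i m' where "m = xm i + m'" "weight var_degree m = 4 + weight var_degree m'"
  | v m' where "m = ym v + m'" "weight var_degree m = 6 + weight var_degree m'"
proof (cases "m = 0")
  case False
  then obtain v where v: "Poly_Mapping.lookup m v \<noteq> 0"
    by (metis lookup_zero poly_mapping_eqI)
  define m' where "m' = m - Poly_Mapping.single v 1"
  have m: "m = Poly_Mapping.single v 1 + m'"
    by (rule poly_mapping_eqI) (use v in \<open>auto simp: m'_def lookup_add lookup_minus lookup_single when_def\<close>)
  then have "weight var_degree m = var_degree v + weight var_degree m'"
    by (simp only: weight_add weight_single mult_1_left)
  then show ?thesis
    using that(2,3)[of _ m'] m by (cases v) (simp_all only: xm_def ym_def var_degree.simps)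
qed (use that(1) in simp)

lemma even_weight: "even (weight var_degree m)"
  unfolding weight_def
proof (rule dvd_sum)
  fix v assume "v \<in> Poly_Mapping.keys m"
  show "2 dvd Poly_Mapping.lookup m v * var_degree v" by (cases v) simp_all
qed

lemma weight_eq_0: "weight var_degree m = 0 \<Longrightarrow> m = 0"
  by (cases m rule: weight_cases) auto

lemma weight_eq_2: "weight var_degree m \<noteq> 2"
  by (cases m rule: weight_cases) auto

lemma weight_eq_4:
  assumes "weight var_degree m = 4"
  obtains i where "m = xm i"
  using assms by (cases m rule: weight_cases) (auto dest: weight_eq_0 intro: that)

lemma weight_eq_6:
  assumes "weight var_degree m = 6"
  obtains v where "m = ym v"
  using assms weight_eq_2 by (cases m rule: weight_cases) (auto dest: weight_eq_0 intro: that)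

lemma weight_eq_8:
  assumes "weight var_degree m = 8"
  obtains i j where "m = xm i + xm j"
  using assms weight_eq_2 by (cases m rule: weight_cases) (auto elim!: weight_eq_4 intro: that)

lemma weight_eq_10:
  assumes "weight var_degree m = 10"
  obtains i v where "m = xm i + ym v"
proof (cases m rule: weight_cases)
  case (2 i m')
  then show ?thesis using assms that by (auto elim: weight_eq_6[of m'])
next
  case (3 v m')
  then show ?thesis using assms that by (auto simp: add.commute elim: weight_eq_4[of m'])
qed (use assms in simp)

lemma homog_odd: "odd d \<Longrightarrow> p \<in> homog var_degree d \<Longrightarrow> p = 0"
proof (rule ccontr)
  assume "odd d" "p \<in> homog var_degree d" "p \<noteq> 0"
  then obtain m where "m \<in> Poly_Mapping.keys p" by (metis in_keys_iff lookup_zero poly_mapping_eqI)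
  then show False using even_weight[of m] \<open>odd d\<close> \<open>p \<in> homog var_degree d\<close> by (simp add: homog_def)
qed

subsection \<open>The coefficients of an action\<close>

lemma A_complex_X: "i < n \<Longrightarrow> {X i} \<in> A_complex n V E"
  unfolding A_complex_iff graph_complex_def by (rule exI[of _ "{X i}"], rule exI[of _ "{}"]) auto

lemma A_complex_XY: "i < n \<Longrightarrow> v \<in> V \<Longrightarrow> {X i, Y v} \<in> A_complex n V E"
  unfolding A_complex_iff graph_complex_def by (rule exI[of _ "{X i}"], rule exI[of _ "{Y v}"]) auto

lemma A_complex_Y: "v \<in> V \<Longrightarrow> {Y v} \<in> A_complex n V E"
  unfolding A_complex_iff graph_complex_def by (rule exI[of _ "{}"], rule exI[of _ "{Y v}"]) auto

lemma A_complex_YY: "{u, v} \<in> E \<Longrightarrow> {Y u, Y v} \<in> A_complex n V E"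
  unfolding A_complex_iff graph_complex_def by (rule exI[of _ "{}"], rule exI[of _ "Y ` {u, v}"]) auto

lemma A_complex_XYY: "i < n \<Longrightarrow> {u, v} \<in> E \<Longrightarrow> {X i, Y u, Y v} \<in> A_complex n V E"
  unfolding A_complex_iff graph_complex_def by (rule exI[of _ "{X i}"], rule exI[of _ "Y ` {u, v}"]) auto

text \<open>The complex of a graph is one-dimensional: even a triangle of edges is not
  filled.\<close>

lemma A_complex_YYY:
  assumes "finite_simple_graph V E" "u \<noteq> v" "v \<noteq> w" "u \<noteq> w"
  shows "{Y u, Y v, Y w} \<notin> A_complex n V E"
proof
  assume *: "{Y u, Y v, Y w} \<in> A_complex n V E"
  then obtain \<alpha> \<tau> where a: "{Y u, Y v, Y w} = \<alpha> \<union> \<tau>" "\<alpha> \<subseteq> X ` {..<n}" "\<tau> \<in> graph_complex V E"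
    unfolding A_complex_iff by blast
  have "\<alpha> \<subseteq> {Y u, Y v, Y w}" using a(1) by blast
  then have "\<alpha> = {}" using a(2) by fastforce
  then have \<tau>: "\<tau> = {Y u, Y v, Y w}" using a(1) by simp
  then obtain e where e: "e \<in> E" "\<tau> = Y ` e"
    using a(3) assms(2) by (auto simp: graph_complex_def)
  then obtain s t where "e = {s, t}" using assms(1) by (auto simp: finite_simple_graph_def)
  then have "card \<tau> \<le> 2" using e by (simp add: card_insert_le_m1)
  then show False using \<tau> assms by simp
qed

lemma steenrod_actionD:
  assumes "steenrod_action R Gr act"
  shows "x \<in> carrier R \<Longrightarrow> act s x \<in> carrier R"
    and "x \<in> carrier R \<Longrightarrow> y \<in> carrier R \<Longrightarrow> act s (x \<oplus>\<^bsub>R\<^esub> y) = act s x \<oplus>\<^bsub>R\<^esub> act s y"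
    and "x \<in> carrier R \<Longrightarrow> act (s + t) x = act s x \<oplus>\<^bsub>R\<^esub> act t x"
    and "x \<in> carrier R \<Longrightarrow> act 1 x = x"
    and "x \<in> carrier R \<Longrightarrow> act (s * t) x = act s (act t x)"
    and "s \<in> steenrod_grading k \<Longrightarrow> x \<in> Gr d \<Longrightarrow> act s x \<in> Gr (k + d)"
    and "x \<in> carrier R \<Longrightarrow> y \<in> carrier R \<Longrightarrow> act (Sq k) (x \<otimes>\<^bsub>R\<^esub> y)
      = (\<Oplus>\<^bsub>R\<^esub>i\<in>{..k}. act (Sq i) x \<otimes>\<^bsub>R\<^esub> act (Sq (k - i)) y)"
    and "x \<in> Gr d \<Longrightarrow> act (Sq d) x = x \<otimes>\<^bsub>R\<^esub> x"
    and "x \<in> Gr d \<Longrightarrow> d < k \<Longrightarrow> act (Sq k) x = \<zero>\<^bsub>R\<^esub>"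
proof -
  note * = assms[unfolded steenrod_action_def]
  show "x \<in> carrier R \<Longrightarrow> act s x \<in> carrier R"
    by (rule *[THEN conjunct1, rule_format])
  show "x \<in> carrier R \<Longrightarrow> y \<in> carrier R \<Longrightarrow> act s (x \<oplus>\<^bsub>R\<^esub> y) = act s x \<oplus>\<^bsub>R\<^esub> act s y"
    by (rule *[THEN conjunct2, THEN conjunct1, rule_format])
  show "x \<in> carrier R \<Longrightarrow> act (s + t) x = act s x \<oplus>\<^bsub>R\<^esub> act t x"
    by (rule *[THEN conjunct2, THEN conjunct2, THEN conjunct1, rule_format])
  show "x \<in> carrier R \<Longrightarrow> act 1 x = x"
    by (rule *[THEN conjunct2, THEN conjunct2, THEN conjunct2, THEN conjunct1, rule_format])
  show "x \<in> carrier R \<Longrightarrow> act (s * t) x = act s (act t x)"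
    by (rule *[THEN conjunct2, THEN conjunct2, THEN conjunct2, THEN conjunct2, THEN conjunct1, rule_format])
  show "s \<in> steenrod_grading k \<Longrightarrow> x \<in> Gr d \<Longrightarrow> act s x \<in> Gr (k + d)"
    by (rule *[THEN conjunct2, THEN conjunct2, THEN conjunct2, THEN conjunct2, THEN conjunct2, THEN conjunct1, rule_format])
  show "x \<in> carrier R \<Longrightarrow> y \<in> carrier R \<Longrightarrow> act (Sq k) (x \<otimes>\<^bsub>R\<^esub> y)
      = (\<Oplus>\<^bsub>R\<^esub>i\<in>{..k}. act (Sq i) x \<otimes>\<^bsub>R\<^esub> act (Sq (k - i)) y)"
    by (rule *[THEN conjunct2, THEN conjunct2, THEN conjunct2, THEN conjunct2, THEN conjunct2, THEN conjunct2, THEN conjunct1, rule_format])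
  note ** = *[THEN conjunct2, THEN conjunct2, THEN conjunct2, THEN conjunct2, THEN conjunct2, THEN conjunct2, THEN conjunct2]
  show "x \<in> Gr d \<Longrightarrow> act (Sq d) x = x \<otimes>\<^bsub>R\<^esub> x" "x \<in> Gr d \<Longrightarrow> d < k \<Longrightarrow> act (Sq k) x = \<zero>\<^bsub>R\<^esub>"
    using ** by auto
qed

locale sr2_action =
  fixes n :: nat and V :: "'a set" and E :: "'a set set"
    and act :: "steenrod \<Rightarrow> (('a var \<Rightarrow>\<^sub>0 nat) \<Rightarrow>\<^sub>0 bit) \<Rightarrow> ('a var \<Rightarrow>\<^sub>0 nat) \<Rightarrow>\<^sub>0 bit"
  assumes graph: "finite_simple_graph V E"
    and action: "steenrod_action (sr2_ring (A_complex n V E)) (sr2_grading var_degree (A_complex n V E)) act"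
begin

abbreviation K :: "'a var set set" where "K \<equiv> A_complex n V E"
abbreviation B :: "(('a var \<Rightarrow>\<^sub>0 nat) \<Rightarrow>\<^sub>0 bit) set" where "B \<equiv> carrier (sr2_ring K)"

lemma simpK: "simplicial_complex K" by (rule simplicial_A_complex[OF graph])

lemma finV: "finite V" using graph by (simp add: finite_simple_graph_def)

lemma edge_vertex: "{u, v} \<in> E \<Longrightarrow> u \<in> V \<and> v \<in> V \<and> u \<noteq> v"
  using graph by (fastforce simp: finite_simple_graph_def doubleton_eq_iff)

definition P :: "nat \<Rightarrow> (('a var \<Rightarrow>\<^sub>0 nat) \<Rightarrow>\<^sub>0 bit) \<Rightarrow> ('a var \<Rightarrow>\<^sub>0 nat) \<Rightarrow>\<^sub>0 bit" where
  "P k = act (Sq k)"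

lemma P_closed: "p \<in> B \<Longrightarrow> P k p \<in> B"
  unfolding P_def by (rule steenrod_actionD(1)[OF action])

lemma P_add: "p \<in> B \<Longrightarrow> q \<in> B \<Longrightarrow> P k (p + q) = P k p + P k q"
  unfolding P_def by (rule steenrod_actionD(2)[OF action, unfolded sr2_ring_simps])

lemma zero_in_B [simp]: "0 \<in> B"
  by (simp add: sr2_carrier_iff)

lemma P_zero [simp]: "P k 0 = 0"
  using P_add[of 0 0 k] by (simp only: zero_in_B add_0_left add_self_eq_zero)

lemma P_sum: "(\<And>i. i \<in> I \<Longrightarrow> f i \<in> B) \<Longrightarrow> P k (sum f I) = (\<Sum>i\<in>I. P k (f i))"
proof (induction I rule: infinite_finite_induct)
  case (insert i I)
  then have "sum f I \<in> B" by (simp add: sr2_carrier_iff restr_sum)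
  then show ?case using insert by (simp add: P_add)
qed simp_all

lemma P_0: "p \<in> B \<Longrightarrow> P 0 p = p"
  unfolding P_def Sq_0 by (rule steenrod_actionD(4)[OF action])

lemma P_Adem:
  assumes "p \<in> B"
  shows "P 2 (P 4 p) = P 6 p + P 5 (P 1 p)"
  using steenrod_actionD(3)[OF action assms, of "Sq 6" "Sq 5 * Sq 1"]
  by (simp only: P_def Sq_2_Sq_4[symmetric] steenrod_actionD(5)[OF action assms] sr2_ring_simps)

lemma P_mult: "p \<in> B \<Longrightarrow> q \<in> B \<Longrightarrow>
  P k (restr (faces K) (p * q)) = (\<Sum>i\<le>k. restr (faces K) (P i p * P (k - i) q))"
proof -
  assume pq: "p \<in> B" "q \<in> B"
  have "P k (restr (faces K) (p * q)) = (\<Oplus>\<^bsub>sr2_ring K\<^esub>i\<in>{..k}. restr (faces K) (P i p * P (k - i) q))"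
    unfolding P_def by (rule steenrod_actionD(7)[OF action pq, unfolded sr2_ring_simps])
  also have "\<dots> = (\<Sum>i\<le>k. restr (faces K) (P i p * P (k - i) q))"
    by (rule finsum_sr2_ring[OF simpK]) simp_all
  finally show ?thesis .
qed

lemma Sq_grading: "Sq k \<in> steenrod_grading k"
  using steenrod_grading.mono[of "[k]" k] by simp

lemma P_homog:
  assumes "p \<in> B" "p \<in> homog var_degree d"
  shows "P k p \<in> homog var_degree (k + d)"
proof -
  have "p \<in> sr2_grading var_degree K d" using assms by (simp add: sr2_grading_def)
  then have "P k p \<in> sr2_grading var_degree K (k + d)"
    unfolding P_def by (rule steenrod_actionD(6)[OF action Sq_grading])
  then show ?thesis by (simp add: sr2_grading_def)
qed

lemma P_top:
  assumes "p \<in> B" "p \<in> homog var_degree d"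
  shows "P d p = restr (faces K) (p * p)"
proof -
  have "p \<in> sr2_grading var_degree K d" using assms by (simp add: sr2_grading_def)
  then show ?thesis
    unfolding P_def by (rule steenrod_actionD(8)[OF action, unfolded sr2_ring_simps])
qed

lemma monomial_in_B: "Poly_Mapping.keys m \<in> K \<Longrightarrow> Poly_Mapping.single m c \<in> B"
  by (simp add: sr2_ring_def faces_def)

lemma keys_in_K: "p \<in> B \<Longrightarrow> m \<in> Poly_Mapping.keys p \<Longrightarrow> Poly_Mapping.keys m \<in> K"
  by (auto simp: sr2_ring_def faces_def)

lemma P_odd: "odd k \<Longrightarrow> even d \<Longrightarrow> p \<in> B \<Longrightarrow> p \<in> homog var_degree d \<Longrightarrow> P k p = 0"
  by (rule homog_odd[OF _ P_homog]) auto

text \<open>The cut-off supplies the support condition of a colouring; for i >= n the variable is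
  not an element of the ring.\<close>

definition \<phi> :: "'a \<Rightarrow> nat \<Rightarrow> bit" where
  "\<phi> v i = (if i < n then Poly_Mapping.lookup (P 2 (var2 (X i))) (ym v) else 0)"

definition a :: "'a \<Rightarrow> 'a \<Rightarrow> nat \<Rightarrow> bit" where
  "a v w i = Poly_Mapping.lookup (P 4 (var2 (Y v))) (xm i + ym w)"

lemma X_in_B: "i < n \<Longrightarrow> var2 (X i) \<in> B"
  unfolding var2_X by (rule monomial_in_B) (simp add: A_complex_X)

lemma Y_in_B: "v \<in> V \<Longrightarrow> var2 (Y v) \<in> B"
  unfolding var2_Y by (rule monomial_in_B) (simp add: A_complex_Y)

lemma var2_homog: "var2 v \<in> homog var_degree (var_degree v)"
  unfolding var2_def by (rule homog_single) simp

lemma P_odd_var: "odd k \<Longrightarrow> var2 v \<in> B \<Longrightarrow> P k (var2 v) = 0"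
  by (rule P_odd[OF _ _ _ var2_homog]) (cases v; simp)+

lemma sum_atMost_2: "(\<Sum>j\<le>2::nat. f j) = f 0 + f 1 + f 2"
  and sum_atMost_4: "(\<Sum>j\<le>4::nat. f j) = f 0 + f 1 + f 2 + f 3 + f 4"
  by (simp_all add: eval_nat_numeral)

text \<open>Degree 10 leaves only the monomials x_i y_w. The sum runs over the full rectangle,
  absent monomials having coefficient 0.\<close>

lemma P_4_Y:
  assumes "v \<in> V"
  shows "P 4 (var2 (Y v)) = (\<Sum>i<n. \<Sum>w\<in>V. Poly_Mapping.single (xm i + ym w) (a v w i))"
proof -
  let ?g = "P 4 (var2 (Y v))" and ?m = "\<lambda>(i, w). xm i + ym w"
  have "Poly_Mapping.keys ?g \<subseteq> ?m ` ({..<n} \<times> V)"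
  proof
    fix m assume m: "m \<in> Poly_Mapping.keys ?g"
    have "?g \<in> homog var_degree 10"
      using P_homog[OF Y_in_B[OF assms] var2_homog, of 4] by simp
    then have "weight var_degree m = 10" using m by (simp add: homog_def)
    then obtain i w where iw: "m = xm i + ym w" by (rule weight_eq_10)
    have "Poly_Mapping.keys m \<in> K" using keys_in_K[OF P_closed[OF Y_in_B[OF assms]] m] .
    then have K: "{X i, Y w} \<in> K" using iw by (simp add: keys_add_nat insert_commute)
    then have "w \<in> V" using Y_mem_A_complex[OF _ K graph] by simp
    moreover have "i < n" using K by (auto simp: A_complex_iff graph_complex_def)
    ultimately show "m \<in> ?m ` ({..<n} \<times> V)" using iw by auto
  qed
  then have "?g = (\<Sum>m\<in>?m ` ({..<n} \<times> V). Poly_Mapping.single m (Poly_Mapping.lookup ?g m))"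
    using finV by (intro sum_single_superset) simp_all
  also have "\<dots> = (\<Sum>p\<in>{..<n} \<times> V. Poly_Mapping.single (?m p) (Poly_Mapping.lookup ?g (?m p)))"
  proof (subst sum.reindex)
    show "inj_on ?m ({..<n} \<times> V)"
    proof (rule inj_onI, clarify)
      fix i w j z assume "xm i + ym w = xm j + ym z"
      then have "Poly_Mapping.keys (xm i + ym w) = Poly_Mapping.keys (xm j + ym z)" by simp
      then show "i = j \<and> w = z" by (auto simp: keys_add_nat doubleton_eq_iff)
    qed
  qed simp
  also have "\<dots> = (\<Sum>i<n. \<Sum>w\<in>V. Poly_Mapping.single (xm i + ym w) (a v w i))"
    by (simp only: a_def sum.cartesian_product) (simp add: case_prod_unfold)
  finally show ?thesis .
qed

text \<open>Sq^2 (x_i y_z) is the sum of (Sq^2 x_i) y_z and x_i Sq^2 y_z, as Sq^1 vanishes. The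
  second summand has only multiples of x_i; in the first, y_u y_w arises from y_z and the remaining
  variable, whose coefficient is a value of \<open>\<phi>\<close>.\<close>

lemma lookup_P_2_XY:
  assumes i: "i < n" and z: "z \<in> V" and M: "Poly_Mapping.keys (ym u + ym w) \<in> K"
  shows "Poly_Mapping.lookup (P 2 (Poly_Mapping.single (xm i + ym z) 1)) (ym u + ym w)
    = (if z = w then \<phi> u i else if z = u then \<phi> w i else 0)"
proof -
  have M': "ym u + ym w \<in> faces K" using M by (simp add: faces_def)
  have "Poly_Mapping.keys (xm i + ym z) \<in> K"
    using A_complex_XY[OF i z] by (simp add: keys_add_nat insert_commute)
  then have "restr (faces K) (var2 (X i) * var2 (Y z)) = Poly_Mapping.single (xm i + ym z) 1"
    unfolding var2_X var2_Y mult_single mult_1_left by (intro restr_id) (simp add: faces_def)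
  then have "P 2 (Poly_Mapping.single (xm i + ym z) 1)
      = (\<Sum>j\<le>2. restr (faces K) (P j (var2 (X i)) * P (2 - j) (var2 (Y z))))"
    using P_mult[OF X_in_B[OF i] Y_in_B[OF z], of 2] by simp
  also have "\<dots> = restr (faces K) (P 2 (var2 (Y z)) * var2 (X i)) + restr (faces K) (P 2 (var2 (X i)) * var2 (Y z))"
    using P_odd_var[OF _ X_in_B[OF i], of 1]
    by (simp add: sum_atMost_2 P_0 X_in_B[OF i] Y_in_B[OF z] mult.commute)
  finally have "Poly_Mapping.lookup (P 2 (Poly_Mapping.single (xm i + ym z) 1)) (ym u + ym w)
      = Poly_Mapping.lookup (P 2 (var2 (Y z)) * var2 (X i)) (ym u + ym w)
        + Poly_Mapping.lookup (P 2 (var2 (X i)) * var2 (Y z)) (ym u + ym w)"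
    using M' by (simp only: lookup_add lookup_restr if_True)
  also have "Poly_Mapping.lookup (P 2 (var2 (Y z)) * var2 (X i)) (ym u + ym w) = 0"
    unfolding var2_X by (rule lookup_mult_single_eq_zero) (simp add: keys_add_nat)
  also have "Poly_Mapping.lookup (P 2 (var2 (X i)) * var2 (Y z)) (ym u + ym w)
      = (if z = w then \<phi> u i else if z = u then \<phi> w i else 0)"
  proof -
    consider "z = w" | "z \<noteq> w" "z = u" | "z \<noteq> w" "z \<noteq> u" by blast
    then show ?thesis
    proof cases
      case 1
      then show ?thesis
        unfolding var2_Y by (simp add: lookup_mult_single \<phi>_def i)
    next
      case 2
      then show ?thesis
        unfolding var2_Y add.commute[of "ym u"]
        by (simp add: lookup_mult_single \<phi>_def i)
    next
      case 3
      then have "Poly_Mapping.lookup (P 2 (var2 (X i)) * var2 (Y z)) (ym u + ym w) = 0"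
        unfolding var2_Y by (intro lookup_mult_single_eq_zero) (simp add: keys_add_nat)
      then show ?thesis using 3 by simp
    qed
  qed
  finally show ?thesis by simp
qed

text \<open>Reads the coefficient of y_u y_w in Sq^2 Sq^4 y_v = Sq^6 y_v = y_v^2; the summand Sq^5
  Sq^1 y_v is zero because the ring has no odd degrees. The case u = w is included.\<close>

lemma lookup_P_2_P_4:
  assumes v: "v \<in> V" and M: "Poly_Mapping.keys (ym u + ym w) \<in> K"
  shows "(\<Sum>i<n. \<Sum>z\<in>V. a v z i * (if z = w then \<phi> u i else if z = u then \<phi> w i else 0))
    = (if u = v \<and> w = v then 1 else 0)"
proof -
  let ?L = "\<lambda>p. Poly_Mapping.lookup p (ym u + ym w)"
  have B: "Poly_Mapping.single (xm i + ym z) c \<in> B" if "i < n" "z \<in> V" for i z c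
    using A_complex_XY[OF that] by (intro monomial_in_B) (simp add: keys_add_nat insert_commute)
  have "?L (P 2 (P 4 (var2 (Y v)))) = (\<Sum>i<n. \<Sum>z\<in>V. ?L (P 2 (Poly_Mapping.single (xm i + ym z) (a v z i))))"
  proof -
    have "(\<Sum>z\<in>V. Poly_Mapping.single (xm i + ym z) (a v z i)) \<in> B" if "i < n" for i
      using B[OF that] by (simp add: sr2_carrier_iff restr_sum)
    then have "P 2 (P 4 (var2 (Y v))) = (\<Sum>i<n. P 2 (\<Sum>z\<in>V. Poly_Mapping.single (xm i + ym z) (a v z i)))"
      unfolding P_4_Y[OF v] by (intro P_sum) simp
    also have "\<dots> = (\<Sum>i<n. \<Sum>z\<in>V. P 2 (Poly_Mapping.single (xm i + ym z) (a v z i)))"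
      by (intro sum.cong HOL.refl P_sum B) simp_all
    finally show ?thesis by (simp only: lookup_sum)
  qed
  also have "\<dots> = (\<Sum>i<n. \<Sum>z\<in>V. a v z i * (if z = w then \<phi> u i else if z = u then \<phi> w i else 0))"
  proof (intro sum.cong HOL.refl)
    fix i z assume iz: "i \<in> {..<n}" "z \<in> V"
    show "?L (P 2 (Poly_Mapping.single (xm i + ym z) (a v z i)))
      = a v z i * (if z = w then \<phi> u i else if z = u then \<phi> w i else 0)"
      using lookup_P_2_XY[OF _ iz(2) M, of i] iz(1) by (cases "a v z i") simp_all
  qed
  finally have "?L (P 2 (P 4 (var2 (Y v)))) = \<dots>" .
  moreover have "P 2 (P 4 (var2 (Y v))) = restr (faces K) (var2 (Y v) * var2 (Y v))"
    using P_Adem[OF Y_in_B[OF v]] P_odd_var[OF _ Y_in_B[OF v], of 1] P_top[OF Y_in_B[OF v] var2_homog]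
    by simp
  moreover have "?L (restr (faces K) (var2 (Y v) * var2 (Y v))) = (if u = v \<and> w = v then 1 else 0)"
  proof -
    have "ym v + ym v = ym u + ym w \<longleftrightarrow> u = v \<and> w = v"
    proof
      assume "ym v + ym v = ym u + ym w"
      then have "Poly_Mapping.keys (ym v + ym v) = Poly_Mapping.keys (ym u + ym w)" by simp
      then show "u = v \<and> w = v" by (auto simp: keys_add_nat)
    qed simp
    then show ?thesis
      using M by (simp add: var2_Y mult_single lookup_restr lookup_single when_def faces_def)
  qed
  ultimately show ?thesis by simp
qed

lemma \<phi>_a_diag:
  assumes "v \<in> V" "w \<in> V"
  shows "(\<Sum>i<n. \<phi> w i * a v w i) = (if w = v then 1 else 0)"
proof -
  have "(\<Sum>z\<in>V. a v z i * (if z = w then \<phi> w i else if z = w then \<phi> w i else 0)) = \<phi> w i * a v w i" for i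
  proof -
    have "(\<Sum>z\<in>V. a v z i * (if z = w then \<phi> w i else if z = w then \<phi> w i else 0))
      = (\<Sum>z\<in>V. if z = w then \<phi> w i * a v w i else 0)"
      by (rule sum.cong) (auto simp: mult.commute)
    then show ?thesis using finV assms by simp
  qed
  then show ?thesis
    using lookup_P_2_P_4[OF assms(1), of w w] A_complex_Y[OF assms(2)] by (simp add: keys_add_nat)
qed

text \<open>For u different from w the monomial y_u y_w does not occur in y_v^2. Its two
  contributions add up to 0, so over two elements they are equal.\<close>

lemma \<phi>_a_edge:
  assumes "v \<in> V" "{u, w} \<in> E"
  shows "(\<Sum>i<n. \<phi> u i * a v w i) = (\<Sum>i<n. \<phi> w i * a v u i)"
proof -
  have uw: "u \<in> V" "w \<in> V" "u \<noteq> w" using edge_vertex[OF assms(2)] by auto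
  have "(\<Sum>z\<in>V. a v z i * (if z = w then \<phi> u i else if z = u then \<phi> w i else 0))
    = \<phi> u i * a v w i + \<phi> w i * a v u i" for i
  proof -
    have "(\<Sum>z\<in>V. a v z i * (if z = w then \<phi> u i else if z = u then \<phi> w i else 0))
      = (\<Sum>z\<in>V. (if z = w then \<phi> u i * a v w i else 0) + (if z = u then \<phi> w i * a v u i else 0))"
      by (rule sum.cong) (use uw in \<open>auto simp: mult.commute\<close>)
    then show ?thesis using finV uw by (simp add: sum.distrib)
  qed
  then have "(\<Sum>i<n. \<phi> u i * a v w i) + (\<Sum>i<n. \<phi> w i * a v u i) = 0"
    using lookup_P_2_P_4[OF assms(1), of u w] A_complex_YY[OF assms(2)] uw
    by (auto simp: keys_add_nat sum.distrib insert_commute)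
  moreover have "x + y = 0 \<Longrightarrow> x = y" for x y :: bit by (cases x; cases y) simp_all
  ultimately show ?thesis by blast
qed

text \<open>Apply Sq^4 to the relation y_u (y_w y_z) = 0 and compare coefficients of x_i y_w y_z^2,
  a face monomial. The term y_u Sq^4 (y_w y_z) has only multiples of y_u. In the middle term Sq^2
  y_u has degree 8, so it consists of products x_j x_k, one x too many. What remains is the
  coefficient of x_i y_z in Sq^4 y_u.\<close>

lemma a_eq_zero:
  assumes uz: "{u, z} \<in> E" and zw: "{z, w} \<in> E" and "u \<noteq> w" and i: "i < n"
  shows "a u z i = 0"
proof -
  have V: "u \<in> V" "z \<in> V" "w \<in> V" "u \<noteq> z" "z \<noteq> w"
    using edge_vertex[OF uz] edge_vertex[OF zw] by auto
  let ?M = "(xm i + ym z) + (ym w + ym z)" and ?q = "Poly_Mapping.single (ym w + ym z) (1::bit)"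
  have M: "?M \<in> faces K"
    using A_complex_XYY[OF i zw] by (simp add: faces_def keys_add_nat insert_commute)
  have q: "?q \<in> B" using A_complex_YY[OF zw] by (intro monomial_in_B) (simp add: keys_add_nat insert_commute)
  have "{Y u, Y w, Y z} \<notin> K" using A_complex_YYY[OF graph, of u w z] V assms(3) by auto
  then have "restr (faces K) (var2 (Y u) * ?q) = 0"
    by (simp add: var2_Y mult_single restr_eq_zero_iff faces_def keys_add_nat insert_commute)
  then have "0 = (\<Sum>j\<le>4. restr (faces K) (P j (var2 (Y u)) * P (4 - j) ?q))"
    using P_mult[OF Y_in_B[OF V(1)] q, of 4] by simp
  also have "\<dots> = restr (faces K) (P 4 ?q * var2 (Y u)) + restr (faces K) (P 2 (var2 (Y u)) * P 2 ?q)
      + restr (faces K) (P 4 (var2 (Y u)) * ?q)"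
    using P_odd_var[OF _ Y_in_B[OF V(1)], of 1] P_odd_var[OF _ Y_in_B[OF V(1)], of 3]
    by (simp add: sum_atMost_4 P_0 Y_in_B[OF V(1)] q mult.commute)
  finally have "Poly_Mapping.lookup 0 ?M = Poly_Mapping.lookup (restr (faces K) (P 4 ?q * var2 (Y u))
      + restr (faces K) (P 2 (var2 (Y u)) * P 2 ?q) + restr (faces K) (P 4 (var2 (Y u)) * ?q)) ?M"
    by (rule arg_cong)
  then have "0 = Poly_Mapping.lookup (P 4 ?q * var2 (Y u)) ?M + Poly_Mapping.lookup (P 2 (var2 (Y u)) * P 2 ?q) ?M
      + Poly_Mapping.lookup (P 4 (var2 (Y u)) * ?q) ?M"
    using M by (simp only: lookup_add[of "_ :: ('a var \<Rightarrow>\<^sub>0 nat) \<Rightarrow>\<^sub>0 bit"] lookup_restr lookup_zero if_True)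
  also have "Poly_Mapping.lookup (P 4 ?q * var2 (Y u)) ?M = 0"
    unfolding var2_Y by (rule lookup_mult_single_eq_zero) (use V assms(3) in \<open>simp add: keys_add_nat\<close>)
  also have "Poly_Mapping.lookup (P 2 (var2 (Y u)) * P 2 ?q) ?M = 0"
  proof (rule ccontr)
    assume "Poly_Mapping.lookup (P 2 (var2 (Y u)) * P 2 ?q) ?M \<noteq> 0"
    then have "?M \<in> Poly_Mapping.keys (P 2 (var2 (Y u)) * P 2 ?q)" by (simp add: in_keys_iff)
    then obtain m1 m2 where m: "?M = m1 + m2" "m1 \<in> Poly_Mapping.keys (P 2 (var2 (Y u)))"
      using keys_mult[of "P 2 (var2 (Y u))" "P 2 ?q"] by blast
    have "P 2 (var2 (Y u)) \<in> homog var_degree 8"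
      using P_homog[OF Y_in_B[OF V(1)] var2_homog, of 2] by simp
    then have "weight var_degree m1 = 8" using m(2) by (simp add: homog_def)
    then obtain j k where jk: "m1 = xm j + xm k" by (rule weight_eq_8)
    have "Poly_Mapping.lookup ?M (X l) = Poly_Mapping.lookup (xm j + xm k + m2) (X l)" for l
      using m(1) jk by simp
    from this[of j] this[of k] show False
      by (simp add: lookup_add lookup_xm lookup_ym split: if_splits)
  qed
  also have "Poly_Mapping.lookup (P 4 (var2 (Y u)) * ?q) ?M = a u z i"
    unfolding a_def by (simp only: lookup_mult_single mult_1_right)
  finally show ?thesis by simp
qed

end

subsection \<open>From the coefficients to a colouring\<close>

context sr2_action
begin

abbreviation dot :: "(nat \<Rightarrow> bit) \<Rightarrow> (nat \<Rightarrow> bit) \<Rightarrow> bit" where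
  "dot f b \<equiv> (\<Sum>i<n. f i * b i)"

text \<open>The naive colouring fails orthogonality for the functional at \<open>u\<close> and the
  vector at \<open>v\<close>. The order matters: \<open>bad v u\<close> need not follow.\<close>

definition bad :: "'a \<Rightarrow> 'a \<Rightarrow> bool" where
  "bad u v \<longleftrightarrow> {u, v} \<in> E \<and> dot (\<phi> u) (a v v) = 1"

text \<open>A vertex at which the naive choice \<open>(a u u, \<phi> u)\<close> fails is a leaf.\<close>

lemma bad_leaf:
  assumes "bad u v" "{u, w} \<in> E"
  shows "w = v"
proof (rule ccontr)
  assume "w \<noteq> v"
  have uv: "{v, u} \<in> E" "v \<in> V" using assms(1) edge_vertex by (auto simp: bad_def insert_commute)
  \<comment> \<open>The edge relation moves the failure to \<open>a v u\<close>, which vanishes as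
    soon as \<open>u\<close> has a second neighbour.\<close>
  have "dot (\<phi> u) (a v v) = dot (\<phi> v) (a v u)"
    using \<phi>_a_edge[of v u v] assms(1) uv by (simp add: bad_def)
  moreover have "a v u i = 0" if "i < n" for i
    using a_eq_zero[OF uv(1) assms(2) _ that] \<open>w \<noteq> v\<close> by simp
  ultimately show False using assms(1) by (simp add: bad_def)
qed

lemma bad_other:
  assumes "bad u v"
  shows "dot (\<phi> v) (a v u) = 1"
  using \<phi>_a_edge[of v u v] assms edge_vertex by (auto simp: bad_def)

text \<open>If \<open>bad u v\<close> holds in both orders, then uv is an isolated edge; the
  functionals stay and the vectors become the off-diagonal a u v and a v u. If only
  \<open>bad u v\<close> holds, \<open>\<phi> u\<close> becomes \<open>\<phi> u + \<phi> v\<close>: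
  on a v v this is 1 + 1 = 0, on a u u it is 1 + 0. Since u has no other neighbour, no other edge is
  affected.\<close>

lemma ex_vector_colouring: "\<exists>\<alpha> \<psi>. vector_colouring n V E \<alpha> \<psi>"
proof -
  \<comment> \<open>The choice is forced: by the leaf property at most one \<open>v\<close>
    satisfies \<open>bad u v\<close>.\<close>
  define nb where "nb u = (SOME v. bad u v)" for u
  have nb: "bad u (nb u)" if "bad u v" for u v
    unfolding nb_def using that by (rule someI)
  have nb_eq: "nb u = v" if "bad u v" for u v
    using bad_leaf[OF that] nb[OF that] by (simp add: bad_def)
  define \<alpha> where "\<alpha> u = (if \<exists>v. bad u v then (if bad (nb u) u then a u (nb u) else a u u) else a u u)" for u
  define \<psi> where "\<psi> u = (if \<exists>v. bad u v then (if bad (nb u) u then \<phi> u else (\<lambda>i. \<phi> u i + \<phi> (nb u) i)) else \<phi> u)" for u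
  have good: "\<alpha> u = a u u" "\<psi> u = \<phi> u" if "\<not> (\<exists>v. bad u v)" for u
    using that by (simp_all add: \<alpha>_def \<psi>_def)
  have bad1: "\<alpha> u = a u u" "\<psi> u = (\<lambda>i. \<phi> u i + \<phi> v i)" if "bad u v" "\<not> bad v u" for u v
    using that nb_eq[OF that(1)] by (auto simp: \<alpha>_def \<psi>_def)
  have bad2: "\<alpha> u = a u v" "\<psi> u = \<phi> u" if "bad u v" "bad v u" for u v
    using that nb_eq[OF that(1)] by (auto simp: \<alpha>_def \<psi>_def)
  have vert: "u \<in> V" "v \<in> V" "u \<noteq> v" if "bad u v" for u v
    using that edge_vertex by (auto simp: bad_def)
  have dot_add: "dot (\<lambda>i. f i + g i) b = dot f b + dot g b" for f g b
    by (simp add: ring_distribs sum.distrib)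
  have not_bad: "dot (\<phi> u) (a v v) = 0" if "{u, v} \<in> E" "\<not> bad u v" for u v
    using that by (simp add: bad_def)
  have "vector_colouring n V E \<alpha> \<psi>"
  proof
    show "finite_simple_graph V E" by (rule graph)
  next
    fix u assume u: "u \<in> V"
    show "dot (\<psi> u) (\<alpha> u) = 1"
    proof (cases "\<exists>v. bad u v")
      case True
      then obtain v where v: "bad u v" by blast
      show ?thesis
      proof (cases "bad v u")
        case True
        then show ?thesis using bad2[OF v True] bad_other[OF True] by simp
      next
        case False
        have "{v, u} \<in> E" using v by (simp add: bad_def insert_commute)
        then show ?thesis
          using bad1[OF v False] not_bad[of v u] False \<phi>_a_diag[OF u u] by (simp add: dot_add)
      qed
    next
      case False
      then show ?thesis using good[OF False] \<phi>_a_diag[OF u u] by simp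
    qed
  next
    fix u w assume uw: "{u, w} \<in> E"
    then have wu: "{w, u} \<in> E" by (simp add: insert_commute)
    have V: "u \<in> V" "w \<in> V" "u \<noteq> w" using edge_vertex[OF uw] by auto
    show "dot (\<psi> u) (\<alpha> w) = 0"
    proof (cases "\<exists>v. bad u v")
      case True
      then have u: "bad u w" using bad_leaf[OF _ uw] by blast
      show ?thesis
      proof (cases "bad w u")
        case True
        then show ?thesis using bad2[OF u True] bad2[OF True u] \<phi>_a_diag[OF V(2,1)] V by simp
      next
        case False
        then have "\<not> (\<exists>v. bad w v)" using bad_leaf[OF _ wu] by blast
        then show ?thesis
          using bad1[OF u False] good \<phi>_a_diag[OF V(2,2)] u by (simp add: dot_add bad_def)
      qed
    next
      case False
      then have u: "\<not> bad u w" by blast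
      have "\<alpha> w = a w w"
      proof (cases "\<exists>v. bad w v")
        case True
        then have "bad w u" using bad_leaf[OF _ wu] by blast
        then show ?thesis using bad1 u by blast
      qed (use good in blast)
      then show ?thesis using good[OF False] not_bad[OF uw u] by simp
    qed
  next
    fix v i assume "n \<le> i"
    then have "\<phi> w i = 0" for w by (simp add: \<phi>_def)
    then show "\<psi> v i = 0" by (simp add: \<psi>_def)
  qed
  then show ?thesis by blast
qed

end

section \<open>Subspaces versus vectors with functionals over two elements\<close>

section \<open>Span colourings over the field with two elements\<close>

definition unit_vec :: "nat \<Rightarrow> nat \<Rightarrow> bit" where
  "unit_vec i = (\<lambda>j. if j = i then 1 else 0)"

lemma subspace_coord_space: "coord.subspace (coord_space n :: (nat \<Rightarrow> 'k::field) set)"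
  by (auto simp: coord.subspace_def coord_space_def coord_scale_def)

lemma independent_unit_vec: "coord.independent (unit_vec ` {..<n})"
  and inj_unit_vec: "inj unit_vec"
proof -
  show "inj unit_vec"
    by (rule injI) (metis unit_vec_def zero_neq_one)
  show "coord.independent (unit_vec ` {..<n})"
  proof (induction n)
    case (Suc n)
    have "coord.span (unit_vec ` {..<n}) \<subseteq> coord_space n"
      by (rule coord.span_minimal[OF _ subspace_coord_space]) (auto simp: unit_vec_def coord_space_def)
    moreover have "unit_vec n \<notin> coord_space n" by (simp add: unit_vec_def coord_space_def)
    ultimately have "unit_vec n \<notin> coord.span (unit_vec ` {..<n})" by blast
    then show ?case using Suc by (simp add: lessThan_Suc coord.independent_insert)
  qed (simp add: coord.independent_empty)
qed

lemma coord_space_Suc_decomp: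
  fixes b :: "nat \<Rightarrow> bit"
  shows "(\<lambda>i. if i < Suc m then b i else 0) = (\<lambda>i. if i < m then b i else 0) + coord_scale (b m) (unit_vec m)"
  by (rule ext) (auto simp: unit_vec_def coord_scale_def less_Suc_eq)

lemma coord_space_span: "coord_space n \<subseteq> coord.span (unit_vec ` {..<n})"
proof
  fix b :: "nat \<Rightarrow> bit" assume "b \<in> coord_space n"
  then have b: "b = (\<lambda>i. if i < n then b i else 0)" by (auto simp: coord_space_def not_less)
  have "m \<le> n \<Longrightarrow> (\<lambda>i. if i < m then b i else 0) \<in> coord.span (unit_vec ` {..<n})" for m
  proof (induction m)
    case 0
    have "(\<lambda>i. if i < (0::nat) then b i else 0) = 0" by auto
    then show ?case by (simp only: coord.span_zero)
  next
    case (Suc m)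
    then have "unit_vec m \<in> coord.span (unit_vec ` {..<n})" by (intro coord.span_base) auto
    then show ?case
      unfolding coord_space_Suc_decomp using Suc by (intro coord.span_add coord.span_scale) simp_all
  qed
  from this[of n] b show "b \<in> coord.span (unit_vec ` {..<n})" by simp
qed

lemma card_unit_vec: "card (unit_vec ` {..<n}) = n"
  by (simp add: card_image inj_on_subset[OF inj_unit_vec])

lemma independent_coord_bound:
  fixes S :: "(nat \<Rightarrow> bit) set"
  assumes "coord.independent S" "S \<subseteq> coord_space n"
  shows "finite S \<and> card S \<le> n"
  using coord.independent_span_bound[of "unit_vec ` {..<n}" S] assms coord_space_span card_unit_vec by auto

lemma hyperplane_basis:
  fixes W :: "(nat \<Rightarrow> bit) set"
  assumes W: "coord.subspace W" "W \<subseteq> coord_space n" and a: "a \<in> coord_space n" "a \<notin> W"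
  obtains S where "finite S" "coord.span S = W" "coord.independent (insert a S)"
    "card S = coord.dim W" "card (insert a S) = Suc (coord.dim W)" "insert a S \<subseteq> coord_space n"
proof -
  obtain S where S: "S \<subseteq> W" "coord.independent S" "W \<subseteq> coord.span S" "card S = coord.dim W"
    using coord.basis_exists by blast
  have span: "coord.span S = W" using S W by (simp add: coord.span_minimal subset_antisym)
  then have "coord.independent (insert a S)" using S(2) a(2) by (simp add: coord.independent_insert)
  moreover have "insert a S \<subseteq> coord_space n" using a(1) S(1) W(2) by auto
  moreover have "finite S" using independent_coord_bound[OF S(2)] S(1) W(2) by blast
  moreover have "a \<notin> S" using S(1) a(2) by auto
  ultimately show ?thesis using that[of S] span S(4) by simp
qed

text \<open>A basis of \<open>W\<close> together with \<open>a\<close> has Suc (n - 1) >= n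
  elements, which leaves no room for a further independent vector. So \<open>b\<close> is a multiple
  of \<open>a\<close> modulo \<open>W\<close>, and the coefficient is 0 or 1.\<close>

lemma hyperplane_complement:
  fixes W :: "(nat \<Rightarrow> bit) set"
  assumes W: "coord_subspace n (n - 1) W" and a: "a \<in> coord_space n" "a \<notin> W" and b: "b \<in> coord_space n"
  shows "b \<in> W \<or> b - a \<in> W"
proof -
  have W': "coord.subspace W" "W \<subseteq> coord_space n" "coord.dim W = n - 1"
    using W by (auto simp: coord_subspace_def)
  obtain S where S: "finite S" "coord.span S = W" "coord.independent (insert a S)"
    "card (insert a S) = Suc (n - 1)" "insert a S \<subseteq> coord_space n"
    using hyperplane_basis[OF W'(1,2) a] W'(3) by metis
  have "b \<in> coord.span (insert a S)"
  proof (rule ccontr)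
    assume nb: "b \<notin> coord.span (insert a S)"
    then have "coord.independent (insert b (insert a S))" using S(3) by (simp add: coord.independent_insert)
    then have "card (insert b (insert a S)) \<le> n"
      using independent_coord_bound S(5) b by (metis insert_subset)
    moreover have "b \<notin> insert a S" using nb coord.span_base by blast
    ultimately show False using S(1,4) by simp
  qed
  then obtain k where k: "b - coord_scale k a \<in> coord.span S"
    using coord.span_breakdown_eq by blast
  have "coord_scale 0 a = 0" "coord_scale 1 a = a" by (auto simp: coord_scale_def)
  then show ?thesis using k S(2) by (cases k) auto
qed

lemma dot_add_right: "(\<Sum>i<n. f i * (b + c) i) = (\<Sum>i<n. f i * b i) + (\<Sum>i<n. f i * c i :: bit)"
  by (simp add: ring_distribs sum.distrib)

text \<open>A basis of the kernel together with \<open>a\<close> spans the whole space, because b +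
  f(b) a lies in the kernel; plus is minus here.\<close>

lemma dim_kernel:
  fixes f a :: "nat \<Rightarrow> bit"
  assumes a: "a \<in> coord_space n" "(\<Sum>i<n. f i * a i) = 1"
  shows "coord_subspace n (n - 1) {b \<in> coord_space n. (\<Sum>i<n. f i * b i) = 0}" (is "coord_subspace n _ ?W")
proof -
  have sub: "coord.subspace ?W"
  proof (rule coord.subspaceI)
    show "0 \<in> ?W" by (simp add: coord_space_def)
  next
    fix b c assume bc: "b \<in> ?W" "c \<in> ?W"
    then have "b + c \<in> coord_space n" by (intro coord.subspace_add[OF subspace_coord_space]) simp_all
    then show "b + c \<in> ?W" using bc by (simp only: mem_Collect_eq dot_add_right) simp
  next
    fix k b assume b: "b \<in> ?W"
    have "(\<Sum>i<n. f i * coord_scale k b i) = k * (\<Sum>i<n. f i * b i)"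
      by (simp add: coord_scale_def sum_distrib_left mult.left_commute)
    moreover have "coord_scale k b \<in> coord_space n"
      using b by (intro coord.subspace_scale[OF subspace_coord_space]) simp
    ultimately show "coord_scale k b \<in> ?W" using b by simp
  qed
  have "a \<notin> ?W" using a by simp
  then obtain S where S: "finite S" "coord.span S = ?W" "coord.independent (insert a S)"
    "card (insert a S) = Suc (coord.dim ?W)" "insert a S \<subseteq> coord_space n"
    using hyperplane_basis[OF sub _ a(1)] by (metis (no_types, lifting) mem_Collect_eq subsetI)
  have "coord_space n \<subseteq> coord.span (insert a S)"
  proof
    fix b :: "nat \<Rightarrow> bit" assume b: "b \<in> coord_space n"
    have "b + coord_scale (\<Sum>i<n. f i * b i) a \<in> ?W"
    proof (cases "\<Sum>i<n. f i * b i")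
      case zero
      then show ?thesis using b by (simp add: coord_scale_def coord_space_def)
    next
      case one
      then show ?thesis using b a by (simp add: coord_scale_def coord_space_def ring_distribs sum.distrib)
    qed
    then have "b + coord_scale (\<Sum>i<n. f i * b i) a \<in> coord.span (insert a S)"
      using S(2) coord.span_mono[of S "insert a S"] by blast
    moreover have "coord_scale (\<Sum>i<n. f i * b i) a \<in> coord.span (insert a S)"
      by (intro coord.span_scale coord.span_base) simp
    ultimately have "b + coord_scale (\<Sum>i<n. f i * b i) a - coord_scale (\<Sum>i<n. f i * b i) a \<in> coord.span (insert a S)"
      by (rule coord.span_diff)
    then show "b \<in> coord.span (insert a S)" by simp
  qed
  then have "unit_vec ` {..<n} \<subseteq> coord.span (insert a S)"
    by (auto simp: unit_vec_def coord_space_def)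
  then have "n \<le> card (insert a S)"
    using coord.independent_span_bound[OF _ independent_unit_vec, of "insert a S" n] S(1) card_unit_vec by auto
  moreover have "card (insert a S) \<le> n" using independent_coord_bound[OF S(3,5)] by simp
  ultimately have "coord.dim ?W = n - 1" using S(4) by simp
  then show ?thesis using sub by (auto simp: coord_subspace_def)
qed

lemma span_colouring_of_vectors:
  assumes "vector_colouring n V E a \<phi>"
  shows "\<exists>c :: 'a \<Rightarrow> (nat \<Rightarrow> bit) set \<times> (nat \<Rightarrow> bit) set. span_colouring n V E c"
proof -
  interpret vector_colouring n V E a \<phi> by fact
  \<comment> \<open>Entries of \<open>a v\<close> from position n on are unconstrained, while U_v
    has to lie in the coordinate space.\<close>
  define a' where "a' v = (\<lambda>i. if i < n then a v i else 0)" for v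
  have a': "a' v \<in> coord_space n" "(\<Sum>i<n. \<phi> u i * a' v i) = (\<Sum>i<n. \<phi> u i * a v i)" for u v
    by (simp_all add: a'_def coord_space_def)
  define W where "W v = {b \<in> coord_space n. (\<Sum>i<n. \<phi> v i * b i) = 0}" for v
  have "coord_subspace n 1 (coord.span {a' v})" "coord_subspace n (n - 1) (W v)" "\<not> coord.span {a' v} \<subseteq> W v"
    if "v \<in> V" for v
  proof -
    have d: "(\<Sum>i<n. \<phi> v i * a' v i) = 1" using dual[OF that] a' by simp
    then show "coord_subspace n (n - 1) (W v)" unfolding W_def by (rule dim_kernel[OF a'(1)])
    have "a' v \<notin> W v" using d by (simp add: W_def)
    then show "\<not> coord.span {a' v} \<subseteq> W v" using coord.span_base[of "a' v" "{a' v}"] by blast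
    have "a' v \<noteq> 0" using d by auto
    then have "coord.dim (coord.span {a' v}) = 1"
      by (simp add: coord.dim_eq_card_independent coord.independent_insert coord.dim_span coord.independent_empty)
    moreover have "coord.span {a' v} \<subseteq> coord_space n"
      using a' by (intro coord.span_minimal subspace_coord_space) simp
    ultimately show "coord_subspace n 1 (coord.span {a' v})"
      by (simp add: coord_subspace_def)
  qed
  moreover have "coord.span {a' x} \<subseteq> W y" if "{y, x} \<in> E" for x y
  proof (rule coord.span_minimal)
    have "x \<in> V" "y \<in> V" using that graph by (auto simp: finite_simple_graph_def doubleton_eq_iff)
    then show "coord.subspace (W y)"
      using dim_kernel[OF a'(1)[of y], of "\<phi> y"] dual a' by (simp add: W_def coord_subspace_def)
    show "{a' x} \<subseteq> W y" using orth[OF that] a' by (simp add: W_def)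
  qed
  ultimately have "span_colouring n V E (\<lambda>v. (coord.span {a' v}, W v))"
    unfolding span_colouring_def by (auto simp: insert_commute)
  then show ?thesis by blast
qed

text \<open>The functional at v is the indicator of the complement of the hyperplane. It is additive
  because over two elements this complement is a single coset, so the sum of two of its vectors lies
  in the hyperplane.\<close>

lemma vectors_of_span_colouring:
  fixes c :: "'a \<Rightarrow> (nat \<Rightarrow> bit) set \<times> (nat \<Rightarrow> bit) set"
  assumes graph: "finite_simple_graph V E" and c: "span_colouring n V E c"
  shows "\<exists>a \<phi>. vector_colouring n V E a \<phi>"
proof -
  have "\<exists>a. v \<in> V \<longrightarrow> a \<in> fst (c v) \<and> a \<notin> snd (c v)" for v
    using c by (auto simp: span_colouring_def)
  then obtain a where a: "\<And>v. v \<in> V \<Longrightarrow> a v \<in> fst (c v) \<and> a v \<notin> snd (c v)" by metis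
  define \<psi> where "\<psi> v b = (if b \<in> snd (c v) then 0 else 1 :: bit)" for v b
  define \<phi> where "\<phi> v i = (if i < n then \<psi> v (unit_vec i) else 0)" for v i
  have sub: "coord_subspace n (n - 1) (snd (c v))" "fst (c v) \<subseteq> coord_space n" if "v \<in> V" for v
    using c that by (auto simp: span_colouring_def coord_subspace_def)
  have add: "\<psi> v (b + b') = \<psi> v b + \<psi> v b'" if v: "v \<in> V" and b: "b \<in> coord_space n" "b' \<in> coord_space n" for v b b'
  proof -
    have W: "coord.subspace (snd (c v))" using sub[OF v] by (simp add: coord_subspace_def)
    have comp: "x \<in> coord_space n \<Longrightarrow> x \<notin> snd (c v) \<Longrightarrow> x - a v \<in> snd (c v)" for x
      using hyperplane_complement[OF sub(1)[OF v], of "a v" x] a[OF v] sub(2)[OF v] by blast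
    have "b + b' \<in> snd (c v)" if "b \<notin> snd (c v)" "b' \<notin> snd (c v)"
    proof -
      have "(b - a v) + (b' - a v) \<in> snd (c v)"
        using comp b that coord.subspace_add[OF W] by blast
      moreover have "(b - a v) + (b' - a v) = b + b'" by (rule ext) simp
      ultimately show ?thesis by simp
    qed
    moreover have "b' \<in> snd (c v)" if "b + b' \<in> snd (c v)" "b \<in> snd (c v)"
      using coord.subspace_diff[OF W that] by simp
    moreover have "b \<in> snd (c v)" if "b + b' \<in> snd (c v)" "b' \<in> snd (c v)"
      using coord.subspace_diff[OF W that] by simp
    moreover note coord.subspace_add[OF W, of b b']
    ultimately have iff: "b + b' \<in> snd (c v) \<longleftrightarrow> (b \<in> snd (c v) \<longleftrightarrow> b' \<in> snd (c v))" by blast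
    show ?thesis unfolding \<psi>_def iff by simp
  qed
  have dot: "(\<Sum>i<n. \<phi> v i * b i) = \<psi> v b" if v: "v \<in> V" and b: "b \<in> coord_space n" for v b
  proof -
    have zero: "\<psi> v 0 = 0" using coord.subspace_0 sub[OF v] by (auto simp: \<psi>_def coord_subspace_def)
    \<comment> \<open>Additivity is available inside \<open>coord_space n\<close>, so
      \<open>b\<close> is rebuilt there one coordinate at a time.\<close>
    have "m \<le> n \<Longrightarrow> \<psi> v (\<lambda>i. if i < m then b i else 0) = (\<Sum>i<m. \<phi> v i * b i)" for m
    proof (induction m)
      case 0
      have "(\<lambda>i. if i < (0::nat) then b i else 0) = 0" by auto
      then show ?case by (simp only: zero) simp
    next
      case (Suc m)
      have "\<psi> v (coord_scale (b m) (unit_vec m)) = \<phi> v m * b m"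
      proof (cases "b m")
        case zero
        then have "coord_scale (b m) (unit_vec m) = 0" by (auto simp: coord_scale_def)
        then show ?thesis using zero \<open>\<psi> v 0 = 0\<close> by simp
      next
        case one
        then have "coord_scale (b m) (unit_vec m) = unit_vec m" by (auto simp: coord_scale_def)
        then show ?thesis using one Suc by (simp add: \<phi>_def)
      qed
      then show ?case
        unfolding coord_space_Suc_decomp using Suc
        by (subst add[OF v]) (auto simp: coord_space_def coord_scale_def unit_vec_def)
    qed
    from this[of n] have "\<psi> v (\<lambda>i. if i < n then b i else 0) = (\<Sum>i<n. \<phi> v i * b i)" by simp
    moreover have "(\<lambda>i. if i < n then b i else 0) = b" using b by (auto simp: coord_space_def not_less)
    ultimately show ?thesis by simp
  qed
  have "vector_colouring n V E a \<phi>"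
  proof
    fix v assume "v \<in> V"
    then have "v \<in> V" "a v \<in> coord_space n" "a v \<notin> snd (c v)"
      using a[of v] sub(2)[of v] by auto
    then show "(\<Sum>i<n. \<phi> v i * a v i) = 1"
      by (simp add: dot \<psi>_def)
  next
    fix u v assume uv: "{u, v} \<in> E"
    then have "u \<in> V" "v \<in> V" using graph by (auto simp: finite_simple_graph_def doubleton_eq_iff)
    moreover have "fst (c v) \<subseteq> snd (c u)" using c uv by (simp add: span_colouring_def)
    ultimately have "u \<in> V" "a v \<in> coord_space n" "a v \<in> snd (c u)"
      using a[of v] sub(2)[of v] by auto
    then show "(\<Sum>i<n. \<phi> u i * a v i) = 0"
      by (simp add: dot \<psi>_def)
  qed (simp_all add: graph \<phi>_def)
  then show ?thesis by blast
qed

text \<open>The functionals vanish on the new coordinates. This carries a colouring from the least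
  dimension to every larger one.\<close>

lemma vector_colouring_mono:
  assumes "vector_colouring m V E a \<phi>" "m \<le> n"
  shows "vector_colouring n V E a \<phi>"
proof -
  interpret vector_colouring m V E a \<phi> by fact
  have "(\<Sum>i<n. \<phi> u i * a v i) = (\<Sum>i<m. \<phi> u i * a v i)" for u v
    using assms(2) supp by (intro sum.mono_neutral_right) auto
  then show ?thesis using assms(2) graph dual orth supp by unfold_locales auto
qed

text \<open>Distinct unit vectors serve both as vectors and as functionals. Existence in some
  dimension guarantees that the \<open>LEAST\<close> in the span chromatic number is
  attained.\<close>

lemma ex_vector_colouring_card:
  assumes graph: "finite_simple_graph V E"
  shows "\<exists>a \<phi>. vector_colouring (card V) V E a \<phi>"
proof -
  have "finite V" using graph by (simp add: finite_simple_graph_def)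
  then obtain f where f: "bij_betw f V {..<card V}"
    using ex_bij_betw_finite_nat atLeast0LessThan by metis
  define g where "g v = (if v \<in> V then unit_vec (f v) else 0)" for v
  have dot: "(\<Sum>i<card V. g u i * g v i) = (if u = v then 1 else 0)" if "u \<in> V" "v \<in> V" for u v
  proof -
    have "f u < card V" "f u = f v \<longleftrightarrow> u = v" using f that by (auto simp: bij_betw_def inj_on_eq_iff)
    moreover have "g u i * g v i = (if i = f u then (if f u = f v then 1 else 0) else 0)" for i
      using that by (simp add: g_def unit_vec_def)
    ultimately show ?thesis by simp
  qed
  have "vector_colouring (card V) V E g g"
  proof
    fix u v assume uv: "{u, v} \<in> E"
    then have "u \<in> V" "v \<in> V" "u \<noteq> v" using graph by (auto simp: finite_simple_graph_def doubleton_eq_iff)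
    then show "(\<Sum>i<card V. g u i * g v i) = 0" using dot by simp
  next
    fix i v assume "card V \<le> i"
    moreover have "f v < card V" if "v \<in> V" using f that by (auto simp: bij_betw_def)
    ultimately show "g v i = 0" by (auto simp: g_def unit_vec_def)
  qed (use graph dot in auto)
  then show ?thesis by blast
qed

lemma span_chromatic_number_le_iff:
  assumes graph: "finite_simple_graph V E"
  shows "span_chromatic_number TYPE(bit) V E \<le> n \<longleftrightarrow> (\<exists>a \<phi>. vector_colouring n V E a \<phi>)"
proof -
  have eq: "(\<exists>c :: 'a \<Rightarrow> (nat \<Rightarrow> bit) set \<times> (nat \<Rightarrow> bit) set. span_colouring m V E c)
      \<longleftrightarrow> (\<exists>a \<phi>. vector_colouring m V E a \<phi>)" for m
    using span_colouring_of_vectors vectors_of_span_colouring[OF graph] by blast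
  let ?Q = "\<lambda>m. \<exists>a \<phi>. vector_colouring m V E a \<phi>"
  have least: "?Q (LEAST m. ?Q m)"
    using ex_vector_colouring_card[OF graph] by (rule LeastI)
  show ?thesis
    unfolding span_chromatic_number_def eq
  proof
    assume "(LEAST m. ?Q m) \<le> n"
    then show "?Q n" using least vector_colouring_mono by meson
  qed (rule Least_le)
qed

section \<open>Identification of the tensor product with the ring of normal forms\<close>

section \<open>The tensor product as a Stanley-Reisner ring over the field with two elements\<close>

lemma keys_subset_induct [consumes 1, case_names zero single add]:
  assumes "Poly_Mapping.keys f \<subseteq> W" "P 0" "\<And>p z. p \<in> W \<Longrightarrow> P (Poly_Mapping.single p z)"
    "\<And>f g. Poly_Mapping.keys f \<subseteq> W \<Longrightarrow> Poly_Mapping.keys g \<subseteq> W \<Longrightarrow> P f \<Longrightarrow> P g \<Longrightarrow> P (f + g)"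
  shows "P (f :: 'k \<Rightarrow>\<^sub>0 'c::comm_monoid_add)"
proof -
  let ?s = "\<lambda>M. \<Sum>k\<in>M. Poly_Mapping.single k (Poly_Mapping.lookup f k)"
  have "finite M \<Longrightarrow> M \<subseteq> W \<Longrightarrow> Poly_Mapping.keys (?s M) \<subseteq> W \<and> P (?s M)" for M
  proof (induction M rule: finite_induct)
    case (insert k M)
    then have k: "Poly_Mapping.keys (Poly_Mapping.single k (Poly_Mapping.lookup f k)) \<subseteq> W"
      by auto
    then have "Poly_Mapping.keys (Poly_Mapping.single k (Poly_Mapping.lookup f k) + ?s M) \<subseteq> W"
      using insert keys_add[of "Poly_Mapping.single k (Poly_Mapping.lookup f k)" "?s M"] by blast
    then show ?case using insert k assms(3,4) by simp
  qed (simp add: assms(2))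
  from this[OF finite_keys assms(1)] show ?thesis by (simp add: sum_single_eq)
qed

subsection \<open>The polynomial ring\<close>

lemma poly_ring_simps [simp]:
  "monoid.mult (poly_ring vs) p q = p * q" "monoid.one (poly_ring vs) = 1"
  "ring.zero (poly_ring vs) = 0" "ring.add (poly_ring vs) p q = p + q"
  by (simp_all add: poly_ring_def)

lemma poly_ring_carrier: "p \<in> carrier (poly_ring vs) \<longleftrightarrow> (\<forall>m\<in>Poly_Mapping.keys p. Poly_Mapping.keys m \<subseteq> vs)"
  by (simp add: poly_ring_def)

lemma poly_ring_add_closed: "p \<in> carrier (poly_ring vs) \<Longrightarrow> q \<in> carrier (poly_ring vs) \<Longrightarrow> p + q \<in> carrier (poly_ring vs)"
  using keys_add[of p q] unfolding poly_ring_carrier by blast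

lemma cring_poly_ring: "cring (poly_ring vs)"
proof (rule cringI)
  show "abelian_group (poly_ring vs)"
  proof (rule abelian_groupI)
    fix p assume "p \<in> carrier (poly_ring vs)"
    then have "- p \<in> carrier (poly_ring vs)" by (simp add: poly_ring_carrier keys_minus)
    then show "\<exists>q\<in>carrier (poly_ring vs). q \<oplus>\<^bsub>poly_ring vs\<^esub> p = \<zero>\<^bsub>poly_ring vs\<^esub>"
      by (intro bexI[of _ "- p"]) simp_all
  qed (simp_all add: poly_ring_add_closed poly_ring_carrier[of 0] add.assoc add.commute)
  show "comm_monoid (poly_ring vs)"
  proof (rule comm_monoidI)
    fix p q assume pq: "p \<in> carrier (poly_ring vs)" "q \<in> carrier (poly_ring vs)"
    show "p \<otimes>\<^bsub>poly_ring vs\<^esub> q \<in> carrier (poly_ring vs)"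
      unfolding poly_ring_simps poly_ring_carrier
    proof
      fix m assume "m \<in> Poly_Mapping.keys (p * q)"
      then obtain m1 m2 where "m = m1 + m2" "m1 \<in> Poly_Mapping.keys p" "m2 \<in> Poly_Mapping.keys q"
        using keys_mult[of p q] by blast
      then show "Poly_Mapping.keys m \<subseteq> vs" using pq by (simp add: keys_add_nat poly_ring_carrier)
    qed
  qed (simp_all add: poly_ring_carrier mult.assoc mult.commute)
qed (simp add: ring_distribs)

subsection \<open>Reduction modulo two\<close>

lift_definition red :: "('k \<Rightarrow>\<^sub>0 int) \<Rightarrow> 'k \<Rightarrow>\<^sub>0 bit" is "\<lambda>f k. of_int (f k)"
  by (erule rev_finite_subset) auto

lift_definition half :: "('k \<Rightarrow>\<^sub>0 int) \<Rightarrow> 'k \<Rightarrow>\<^sub>0 int" is "\<lambda>f k. f k div 2"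
  by (erule rev_finite_subset) auto

text \<open>A set-theoretic section of \<open>red\<close>. It is not additive, but it keeps supports
  and therefore degrees.\<close>

lift_definition lift01 :: "('k \<Rightarrow>\<^sub>0 bit) \<Rightarrow> 'k \<Rightarrow>\<^sub>0 int" is "\<lambda>f k. if f k = 0 then 0 else 1"
  by (erule rev_finite_subset) auto

lemma lookup_red: "Poly_Mapping.lookup (red p) k = of_int (Poly_Mapping.lookup p k)"
  by transfer simp

lemma lookup_half: "Poly_Mapping.lookup (half p) k = Poly_Mapping.lookup p k div 2"
  by transfer simp

lemma lookup_lift01: "Poly_Mapping.lookup (lift01 p) k = (if Poly_Mapping.lookup p k = 0 then 0 else 1)"
  by transfer simp

lemma of_int_bit_eq_0_iff: "(of_int z :: bit) = 0 \<longleftrightarrow> even z"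
proof -
  have e: "(of_int (2 * k) :: bit) = 0" for k
    by (simp only: of_int_mult of_int_numeral bit_2_eq_0 mult_zero_left)
  have o: "(of_int (2 * k + 1) :: bit) = 1" for k
    by (simp only: of_int_add e of_int_1 add_0_left)
  show ?thesis
  proof (cases "even z")
    case True
    then obtain k where "z = 2 * k" by (rule evenE)
    then show ?thesis by (simp only: e) simp
  next
    case False
    then obtain k where "z = 2 * k + 1" by (rule oddE)
    then show ?thesis by (simp only: o) simp
  qed
qed

lemma red_add: "red (p + q) = red p + red q"
  by (rule poly_mapping_eqI) (simp only: lookup_red lookup_add of_int_add)

lemma red_single: "red (Poly_Mapping.single k z) = Poly_Mapping.single k (of_int z)"
  by (rule poly_mapping_eqI) (simp add: lookup_red lookup_single when_def)

lemma red_zero [simp]: "red 0 = 0"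
  by (rule poly_mapping_eqI) (simp add: lookup_red)

lemma red_one [simp]: "red 1 = 1"
  using red_single[of 0 1] by simp

lemma red_mult: "red (p * q) = red p * red q" for p q :: "('v \<Rightarrow>\<^sub>0 nat) \<Rightarrow>\<^sub>0 int"
proof (induction p rule: poly_mapping_add_induct)
  case (single k c)
  show ?case
    by (induction q rule: poly_mapping_add_induct)
      (simp_all only: red_add ring_distribs mult_single red_single of_int_mult red_zero mult_zero_right)
qed (simp_all add: red_add ring_distribs)

lemma red_lift01: "red (lift01 p) = p"
  by (rule poly_mapping_eqI) (simp add: lookup_red lookup_lift01)

lemma keys_lift01: "Poly_Mapping.keys (lift01 p) = Poly_Mapping.keys p"
  by (rule Set.set_eqI) (simp only: in_keys_iff lookup_lift01, simp)

lemma keys_red: "Poly_Mapping.keys (red p) \<subseteq> Poly_Mapping.keys p"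
  by (auto simp: in_keys_iff lookup_red)

subsection \<open>The Stanley-Reisner ring over the integers\<close>

locale finite_complex =
  fixes vs :: "'v set" and K :: "'v set set"
  assumes fin: "finite vs" and complex: "simplicial_complex K" and sub: "K \<subseteq> Pow vs"
begin

abbreviation "PR \<equiv> poly_ring vs"
abbreviation "I \<equiv> stanley_reisner_ideal vs K"
abbreviation "SR \<equiv> stanley_reisner_ring vs K"
abbreviation "B \<equiv> sr2_ring K"

sublocale PR: cring PR by (rule cring_poly_ring)
sublocale B: cring B by (rule cring_sr2_ring[OF complex])

definition \<rho> :: "(('v \<Rightarrow>\<^sub>0 nat) \<Rightarrow>\<^sub>0 int) \<Rightarrow> ('v \<Rightarrow>\<^sub>0 nat) \<Rightarrow>\<^sub>0 bit" where
  "\<rho> p = restr (faces K) (red p)"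

lemma \<rho>_hom: "ring_hom_ring PR B \<rho>"
proof (rule ring_hom_ringI[OF PR.ring_axioms B.ring_axioms])
  show "\<rho> \<one>\<^bsub>PR\<^esub> = \<one>\<^bsub>B\<^esub>"
    using complex by (simp add: \<rho>_def restr_id faces_def simplicial_complex_def)
qed (simp_all add: \<rho>_def red_mult red_add restr_add restr_faces_mult_left[OF complex] restr_faces_mult_right[OF complex])

lemma generators_carrier: "{squarefree_monomial \<sigma> | \<sigma>. \<sigma> \<subseteq> vs \<and> \<sigma> \<notin> K} \<subseteq> carrier PR"
proof clarify
  fix \<sigma> assume "\<sigma> \<subseteq> vs"
  then show "squarefree_monomial \<sigma> \<in> carrier PR"
    using keys_sum_single[OF finite_subset[OF _ fin]] by (simp add: squarefree_monomial_def poly_ring_carrier)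
qed

sublocale I: ideal I PR
  unfolding stanley_reisner_ideal_def by (rule PR.genideal_ideal[OF generators_carrier])

lemma I_subset_kernel: "I \<subseteq> a_kernel PR B \<rho>"
  unfolding stanley_reisner_ideal_def
proof (rule PR.genideal_minimal)
  interpret ring_hom_ring PR B \<rho> by (rule \<rho>_hom)
  show "ideal (a_kernel PR B \<rho>) PR" by (rule kernel_is_ideal)
  show "{squarefree_monomial \<sigma> | \<sigma>. \<sigma> \<subseteq> vs \<and> \<sigma> \<notin> K} \<subseteq> a_kernel PR B \<rho>"
  proof
    fix p assume "p \<in> {squarefree_monomial \<sigma> | \<sigma>. \<sigma> \<subseteq> vs \<and> \<sigma> \<notin> K}"
    then obtain \<sigma> where \<sigma>: "p = squarefree_monomial \<sigma>" "\<sigma> \<subseteq> vs" "\<sigma> \<notin> K" by blast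
    then have "finite \<sigma>" using fin finite_subset by blast
    then have "\<rho> p = 0"
      using \<sigma> keys_sum_single[of \<sigma>] by (simp add: \<rho>_def squarefree_monomial_def red_single restr_eq_zero_iff faces_def)
    moreover have "p \<in> carrier PR" using \<sigma> generators_carrier by blast
    ultimately show "p \<in> a_kernel PR B \<rho>" unfolding a_kernel_def' by simp
  qed
qed

text \<open>The squarefree generator of the support divides the monomial. The subtraction of
  exponents is exact, as every exponent in the support is at least 1.\<close>

lemma nonface_in_I:
  assumes "Poly_Mapping.keys m \<subseteq> vs" "m \<notin> faces K"
  shows "Poly_Mapping.single m z \<in> I"
proof -
  define s where "s = (\<Sum>v\<in>Poly_Mapping.keys m. Poly_Mapping.single v (1::nat))"
  have lookup_s: "Poly_Mapping.lookup s v = (if v \<in> Poly_Mapping.keys m then 1 else 0)" for v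
    by (simp add: s_def lookup_sum lookup_single when_def)
  have m: "m = s + (m - s)"
    by (rule poly_mapping_eqI) (simp add: lookup_add lookup_minus lookup_s in_keys_iff)
  have "Poly_Mapping.keys (m - s) \<subseteq> vs"
    using assms(1) by (auto simp: in_keys_iff lookup_minus)
  then have "Poly_Mapping.single (m - s) z \<in> carrier PR"
    by (simp add: poly_ring_carrier)
  moreover have "squarefree_monomial (Poly_Mapping.keys m) \<in> I"
    unfolding stanley_reisner_ideal_def
    using assms by (intro subsetD[OF PR.genideal_self[OF generators_carrier]]) (auto simp: faces_def)
  ultimately have "squarefree_monomial (Poly_Mapping.keys m) * Poly_Mapping.single (m - s) z \<in> I"
    using I.I_r_closed by simp
  then show ?thesis
    unfolding squarefree_monomial_def s_def[symmetric] mult_single using m by simp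
qed

lemma restr_nonface_in_I:
  assumes "p \<in> carrier PR"
  shows "restr (- faces K) p \<in> I"
proof -
  have "Poly_Mapping.keys (restr (- faces K) p) \<subseteq> {m. Poly_Mapping.keys m \<subseteq> vs \<and> m \<notin> faces K}"
    using assms by (auto simp: keys_restr poly_ring_carrier)
  then show ?thesis
  proof (induction rule: keys_subset_induct)
    case zero
    then show ?case using I.zero_closed by simp
  next
    case (add f g)
    then show ?case using I.a_closed[of f g] by simp
  qed (simp add: nonface_in_I)
qed

text \<open>The non-face part of \<open>p\<close> lies in the ideal, and the face part has even
  coefficients. So the kernel of reduction is the ideal plus the doubles, which is what tensoring
  with Z/2 kills.\<close>

lemma kernel_decomp:
  assumes "p \<in> carrier PR" "\<rho> p = 0"
  obtains p' i where "p' \<in> carrier PR" "i \<in> I" "p = i + (p' + p')"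
proof
  show "restr (- faces K) p \<in> I" by (rule restr_nonface_in_I[OF assms(1)])
  show "half (restr (faces K) p) \<in> carrier PR"
    using assms(1) by (auto simp: poly_ring_carrier in_keys_iff lookup_half lookup_restr split: if_splits)
  have "even (Poly_Mapping.lookup (restr (faces K) p) k)" for k
  proof -
    have "Poly_Mapping.lookup (\<rho> p) k = 0" using assms(2) by simp
    then show ?thesis by (auto simp: \<rho>_def lookup_restr lookup_red of_int_bit_eq_0_iff split: if_splits)
  qed
  then have "restr (faces K) p = half (restr (faces K) p) + half (restr (faces K) p)"
  proof (intro poly_mapping_eqI)
    fix k
    have "x = x div 2 + x div 2" if "even x" for x :: int using that by (elim evenE) simp
    then show "Poly_Mapping.lookup (restr (faces K) p) k
      = Poly_Mapping.lookup (half (restr (faces K) p) + half (restr (faces K) p)) k"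
      using \<open>even (Poly_Mapping.lookup (restr (faces K) p) k)\<close> by (simp only: lookup_add lookup_half)
  qed
  then show "p = restr (- faces K) p + (half (restr (faces K) p) + half (restr (faces K) p))"
    using restr_split[of p "faces K"] by (simp add: add.commute)
qed

lemma lift01_carrier: "q \<in> carrier B \<Longrightarrow> lift01 q \<in> carrier PR"
  using sub by (auto simp: poly_ring_carrier keys_lift01 sr2_ring_def faces_def)

lemma \<rho>_lift01: "q \<in> carrier B \<Longrightarrow> \<rho> (lift01 q) = q"
  by (simp add: \<rho>_def red_lift01 sr2_carrier_iff)

lemma SR_eq: "SR = PR Quot I"
  by (simp add: stanley_reisner_ring_def)

lemma cring_SR: "cring SR"
  unfolding SR_eq by (rule I.quotient_is_cring[OF PR.cring_axioms])

sublocale SR: cring SR by (rule cring_SR)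

definition cls :: "(('v \<Rightarrow>\<^sub>0 nat) \<Rightarrow>\<^sub>0 int) \<Rightarrow> (('v \<Rightarrow>\<^sub>0 nat) \<Rightarrow>\<^sub>0 int) set" where
  "cls p = I +>\<^bsub>PR\<^esub> p"

lemma cls_hom: "ring_hom_ring PR SR cls"
  unfolding cls_def[abs_def] SR_eq by (rule I.rcos_ring_hom_ring)

lemma SR_cases:
  assumes "c \<in> carrier SR"
  obtains p where "p \<in> carrier PR" "c = cls p"
  using assms unfolding SR_eq FactRing_def A_RCOSETS_def' cls_def by auto

lemma cls_closed: "p \<in> carrier PR \<Longrightarrow> cls p \<in> carrier SR"
  by (rule ring_hom_closed[OF ring_hom_ring.homh[OF cls_hom]])

lemma cls_add: "p \<in> carrier PR \<Longrightarrow> q \<in> carrier PR \<Longrightarrow> cls (p + q) = cls p \<oplus>\<^bsub>SR\<^esub> cls q"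
  using ring_hom_add[OF ring_hom_ring.homh[OF cls_hom], of p q] by simp

lemma cls_eq_zero: "i \<in> I \<Longrightarrow> cls i = \<zero>\<^bsub>SR\<^esub>"
  using PR.a_rcos_zero[OF I.ideal_axioms] by (simp add: cls_def SR_eq FactRing_def)

definition \<rho>' :: "(('v \<Rightarrow>\<^sub>0 nat) \<Rightarrow>\<^sub>0 int) set \<Rightarrow> ('v \<Rightarrow>\<^sub>0 nat) \<Rightarrow>\<^sub>0 bit" where
  "\<rho>' c = \<rho> (SOME p. p \<in> carrier PR \<and> c = cls p)"

text \<open>Independence of the chosen representative: two representatives differ by an element of
  the ideal, and \<open>\<rho>\<close> kills the ideal.\<close>

lemma \<rho>'_cls:
  assumes p: "p \<in> carrier PR"
  shows "\<rho>' (cls p) = \<rho> p"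
proof -
  interpret ring_hom_ring PR B \<rho> by (rule \<rho>_hom)
  define q where "q = (SOME q. q \<in> carrier PR \<and> cls p = cls q)"
  have "q \<in> carrier PR \<and> cls p = cls q"
    unfolding q_def by (rule someI[of _ p]) (simp add: p)
  then have q: "q \<in> carrier PR" "cls p = cls q" by auto
  have "q \<in> cls q" unfolding cls_def by (rule I.a_rcos_self[OF q(1)])
  then have "q \<in> cls p" by (simp only: q(2))
  then obtain i where i: "i \<in> I" "q = i + p"
    unfolding cls_def a_r_coset_def' by auto
  have "\<rho> i = 0" using I_subset_kernel i(1) unfolding a_kernel_def' by auto
  then have "\<rho> q = \<rho> p" using i(2) by (simp add: \<rho>_def red_add restr_add)
  then show ?thesis by (simp add: \<rho>'_def q_def)
qed

lemma \<rho>'_hom: "ring_hom_ring SR B \<rho>'"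
proof -
  interpret r: ring_hom_ring PR B \<rho> by (rule \<rho>_hom)
  interpret c: ring_hom_ring PR SR cls by (rule cls_hom)
  show ?thesis
  proof (rule ring_hom_ringI[OF SR.ring_axioms B.ring_axioms])
    fix c assume "c \<in> carrier SR"
    then show "\<rho>' c \<in> carrier B" by (elim SR_cases) (simp add: \<rho>'_cls)
  next
    fix c d assume "c \<in> carrier SR" "d \<in> carrier SR"
    then obtain p q where pq: "p \<in> carrier PR" "c = cls p" "q \<in> carrier PR" "d = cls q"
      by (elim SR_cases)
    show "\<rho>' (c \<otimes>\<^bsub>SR\<^esub> d) = \<rho>' c \<otimes>\<^bsub>B\<^esub> \<rho>' d"
      using pq \<rho>'_cls[OF PR.m_closed[OF pq(1,3)]] r.hom_mult[OF pq(1,3)] c.hom_mult[OF pq(1,3)] by (simp only: \<rho>'_cls)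
    show "\<rho>' (c \<oplus>\<^bsub>SR\<^esub> d) = \<rho>' c \<oplus>\<^bsub>B\<^esub> \<rho>' d"
      using pq \<rho>'_cls[OF PR.a_closed[OF pq(1,3)]] r.hom_add[OF pq(1,3)] c.hom_add[OF pq(1,3)] by (simp only: \<rho>'_cls)
  next
    show "\<rho>' \<one>\<^bsub>SR\<^esub> = \<one>\<^bsub>B\<^esub>"
      using \<rho>'_cls[OF PR.one_closed] r.hom_one c.hom_one by (simp only:)
  qed
qed

end

subsection \<open>The free ring on pairs\<close>

lemma free_pair_ring_simps [simp]:
  "monoid.one (free_pair_ring R S) = Poly_Mapping.single (\<one>\<^bsub>R\<^esub>, \<one>\<^bsub>S\<^esub>) 1"
  "ring.zero (free_pair_ring R S) = 0" "ring.add (free_pair_ring R S) f g = f + g"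
  "carrier (free_pair_ring R S) = {f. Poly_Mapping.keys f \<subseteq> carrier R \<times> carrier S}"
  by (simp_all add: free_pair_ring_def)

text \<open>Supports of sums can shrink by cancellation; fixed larger index sets make biadditivity
  of the product visible.\<close>

lemma free_pair_mult_superset:
  assumes "finite P" "Poly_Mapping.keys f \<subseteq> P" "finite Q" "Poly_Mapping.keys g \<subseteq> Q"
  shows "f \<otimes>\<^bsub>free_pair_ring R S\<^esub> g = (\<Sum>p\<in>P. \<Sum>q\<in>Q.
    Poly_Mapping.single (fst p \<otimes>\<^bsub>R\<^esub> fst q, snd p \<otimes>\<^bsub>S\<^esub> snd q) (Poly_Mapping.lookup f p * Poly_Mapping.lookup g q))"
proof -
  have "(\<Sum>q\<in>Poly_Mapping.keys g. Poly_Mapping.single (fst p \<otimes>\<^bsub>R\<^esub> fst q, snd p \<otimes>\<^bsub>S\<^esub> snd q) (Poly_Mapping.lookup f p * Poly_Mapping.lookup g q))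
    = (\<Sum>q\<in>Q. Poly_Mapping.single (fst p \<otimes>\<^bsub>R\<^esub> fst q, snd p \<otimes>\<^bsub>S\<^esub> snd q) (Poly_Mapping.lookup f p * Poly_Mapping.lookup g q))" for p
    using assms(3,4) by (intro sum.mono_neutral_left) (auto simp: in_keys_iff)
  then have "f \<otimes>\<^bsub>free_pair_ring R S\<^esub> g = (\<Sum>p\<in>Poly_Mapping.keys f. \<Sum>q\<in>Q.
    Poly_Mapping.single (fst p \<otimes>\<^bsub>R\<^esub> fst q, snd p \<otimes>\<^bsub>S\<^esub> snd q) (Poly_Mapping.lookup f p * Poly_Mapping.lookup g q))"
    by (simp add: free_pair_ring_def)
  also have "\<dots> = (\<Sum>p\<in>P. \<Sum>q\<in>Q.
    Poly_Mapping.single (fst p \<otimes>\<^bsub>R\<^esub> fst q, snd p \<otimes>\<^bsub>S\<^esub> snd q) (Poly_Mapping.lookup f p * Poly_Mapping.lookup g q))"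
    using assms(1,2) by (intro sum.mono_neutral_left) (auto simp: in_keys_iff)
  finally show ?thesis .
qed

lemma free_pair_mult_add_left: "(f + f') \<otimes>\<^bsub>free_pair_ring R S\<^esub> g
  = f \<otimes>\<^bsub>free_pair_ring R S\<^esub> g + f' \<otimes>\<^bsub>free_pair_ring R S\<^esub> g"
  using keys_add[of f f']
  by (simp add: free_pair_mult_superset[of "Poly_Mapping.keys f \<union> Poly_Mapping.keys f'" _ "Poly_Mapping.keys g"]
      lookup_add ring_distribs single_add sum.distrib)

lemma free_pair_mult_add_right: "f \<otimes>\<^bsub>free_pair_ring R S\<^esub> (g + g')
  = f \<otimes>\<^bsub>free_pair_ring R S\<^esub> g + f \<otimes>\<^bsub>free_pair_ring R S\<^esub> g'"
  using keys_add[of g g']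
  by (simp add: free_pair_mult_superset[of "Poly_Mapping.keys f" _ "Poly_Mapping.keys g \<union> Poly_Mapping.keys g'"]
      lookup_add ring_distribs single_add sum.distrib)

lemma free_pair_mult_single: "Poly_Mapping.single p z \<otimes>\<^bsub>free_pair_ring R S\<^esub> Poly_Mapping.single q w
  = Poly_Mapping.single (fst p \<otimes>\<^bsub>R\<^esub> fst q, snd p \<otimes>\<^bsub>S\<^esub> snd q) (z * w)"
  by (simp add: free_pair_mult_superset[of "{p}" _ "{q}"])

lemma free_pair_mult_zero [simp]:
  "0 \<otimes>\<^bsub>free_pair_ring R S\<^esub> g = 0" "g \<otimes>\<^bsub>free_pair_ring R S\<^esub> 0 = 0"
  by (simp_all add: free_pair_ring_def)

text \<open>By additivity in each argument the laws need checking only on single pairs, where they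
  are those of \<open>R\<close> and \<open>S\<close>.\<close>

lemma cring_free_pair_ring:
  assumes "cring R" "cring S"
  shows "cring (free_pair_ring R S)" (is "cring ?F")
proof -
  interpret R: cring R by fact
  interpret S: cring S by fact
  let ?X = "carrier R \<times> carrier S"
  have add_closed: "Poly_Mapping.keys (f + g) \<subseteq> ?X" if "Poly_Mapping.keys f \<subseteq> ?X" "Poly_Mapping.keys g \<subseteq> ?X"
    for f g :: "_ \<Rightarrow>\<^sub>0 int"
    using that keys_add[of f g] by blast
  show ?thesis
  proof (rule cringI)
    show "abelian_group ?F"
    proof (rule abelian_groupI)
      fix f assume "f \<in> carrier ?F"
      then show "\<exists>g\<in>carrier ?F. g \<oplus>\<^bsub>?F\<^esub> f = \<zero>\<^bsub>?F\<^esub>"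
        by (intro bexI[of _ "- f"]) (simp_all add: keys_minus)
    qed (simp_all add: add_closed add.assoc add.commute)
    show "comm_monoid ?F"
    proof (rule comm_monoidI)
      fix f g assume fg: "f \<in> carrier ?F" "g \<in> carrier ?F"
      then have f: "Poly_Mapping.keys f \<subseteq> ?X" and g: "Poly_Mapping.keys g \<subseteq> ?X" by simp_all
      have "Poly_Mapping.keys (f \<otimes>\<^bsub>?F\<^esub> g) \<subseteq> ?X"
        using f
      proof (induction f rule: keys_subset_induct)
        case (single p z)
        show ?case using g
        proof (induction g rule: keys_subset_induct)
          case (single q w)
          then show ?case using \<open>p \<in> ?X\<close> by (auto simp: free_pair_mult_single)
        qed (simp_all add: free_pair_mult_add_right add_closed)
      qed (simp_all add: free_pair_mult_add_left add_closed)
      then show "f \<otimes>\<^bsub>?F\<^esub> g \<in> carrier ?F" by simp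
      show "f \<otimes>\<^bsub>?F\<^esub> g = g \<otimes>\<^bsub>?F\<^esub> f"
        using f
      proof (induction f rule: keys_subset_induct)
        case (single p z)
        show ?case using g
        proof (induction g rule: keys_subset_induct)
          case (single q w)
          then show ?case using \<open>p \<in> ?X\<close>
            by (auto simp: free_pair_mult_single R.m_comm S.m_comm mult.commute)
        qed (simp_all add: free_pair_mult_add_right free_pair_mult_add_left)
      qed (simp_all add: free_pair_mult_add_left free_pair_mult_add_right)
    next
      fix f g h assume "f \<in> carrier ?F" "g \<in> carrier ?F" "h \<in> carrier ?F"
      then have f: "Poly_Mapping.keys f \<subseteq> ?X" and g: "Poly_Mapping.keys g \<subseteq> ?X"
        and h: "Poly_Mapping.keys h \<subseteq> ?X" by simp_all
      show "f \<otimes>\<^bsub>?F\<^esub> g \<otimes>\<^bsub>?F\<^esub> h = f \<otimes>\<^bsub>?F\<^esub> (g \<otimes>\<^bsub>?F\<^esub> h)"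
        using f
      proof (induction f rule: keys_subset_induct)
        case (single p z)
        show ?case using g
        proof (induction g rule: keys_subset_induct)
          case (single q w)
          show ?case using h
          proof (induction h rule: keys_subset_induct)
            case (single r x)
            then show ?case using \<open>p \<in> ?X\<close> \<open>q \<in> ?X\<close>
              by (auto simp: free_pair_mult_single R.m_assoc S.m_assoc mult.assoc)
          qed (simp_all add: free_pair_mult_add_right)
        qed (simp_all add: free_pair_mult_add_right free_pair_mult_add_left)
      qed (simp_all add: free_pair_mult_add_left)
    next
      fix f assume "f \<in> carrier ?F"
      then have f: "Poly_Mapping.keys f \<subseteq> ?X" by simp
      then show "\<one>\<^bsub>?F\<^esub> \<otimes>\<^bsub>?F\<^esub> f = f"
      proof (induction f rule: keys_subset_induct)
        case (single p z)
        then show ?case by (auto simp: free_pair_mult_single)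
      qed (simp_all add: free_pair_mult_add_right)
    qed simp
  qed (simp add: free_pair_mult_add_left)
qed

subsection \<open>The tensor product with the field with two elements\<close>

lemma Z2_ring_simps [simp]:
  "monoid.mult Z2_ring s t = s * t" "monoid.one Z2_ring = 1" "ring.zero Z2_ring = 0"
  "ring.add Z2_ring s t = s + t" "carrier Z2_ring = UNIV"
  by (simp_all add: Z2_ring_def)

lemma cring_Z2_ring: "cring Z2_ring"
proof (rule cringI)
  show "abelian_group Z2_ring"
  proof (rule abelian_groupI)
    fix s assume "s \<in> carrier Z2_ring"
    show "\<exists>t\<in>carrier Z2_ring. t \<oplus>\<^bsub>Z2_ring\<^esub> s = \<zero>\<^bsub>Z2_ring\<^esub>"
      by (rule bexI[of _ "- s"]) simp_all
  qed (simp_all add: add.assoc add.commute)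
  show "comm_monoid Z2_ring"
    by (rule comm_monoidI) (simp_all add: mult.assoc mult.commute)
qed (simp add: ring_distribs)

lemma restr_cst_mult: "restr M (cst b * p) = cst b * restr M p"
  by (cases b) simp_all

lemma cst_mult_cst_mult: "(cst b * p) * (cst c * q) = cst (b * c) * (p * q)"
  by (cases b; cases c) simp_all

context finite_complex
begin

abbreviation "F \<equiv> free_pair_ring SR Z2_ring"
abbreviation "REL \<equiv> tensor_relations SR Z2_ring"
abbreviation "J \<equiv> genideal F REL"
abbreviation "T \<equiv> tensor_ring SR Z2_ring"

sublocale F: cring F by (rule cring_free_pair_ring[OF cring_SR cring_Z2_ring])

text \<open>The extension of the biadditive map that sends (c, s) to s times
  \<open>\<rho>' c\<close> to formal sums of pairs.\<close>

definition ht :: "((('v \<Rightarrow>\<^sub>0 nat) \<Rightarrow>\<^sub>0 int) set \<times> bit \<Rightarrow>\<^sub>0 int) \<Rightarrow> ('v \<Rightarrow>\<^sub>0 nat) \<Rightarrow>\<^sub>0 bit" where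
  "ht f = (\<Sum>p\<in>Poly_Mapping.keys f. cst (of_int (Poly_Mapping.lookup f p) * snd p) * \<rho>' (fst p))"

lemma ht_superset: "finite P \<Longrightarrow> Poly_Mapping.keys f \<subseteq> P \<Longrightarrow>
  ht f = (\<Sum>p\<in>P. cst (of_int (Poly_Mapping.lookup f p) * snd p) * \<rho>' (fst p))"
  unfolding ht_def by (intro sum.mono_neutral_left) (auto simp: in_keys_iff)

lemma ht_add: "ht (f + g) = ht f + ht g"
proof -
  have "cst (of_int (z + w) * s) * p = cst (of_int z * s) * p + cst (of_int w * s) * p"
    for z w s and p :: "('v \<Rightarrow>\<^sub>0 nat) \<Rightarrow>\<^sub>0 bit"
    by (simp only: of_int_add ring_distribs single_add)
  then show ?thesis
    using keys_add[of f g]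
    by (simp only: ht_superset[of "Poly_Mapping.keys f \<union> Poly_Mapping.keys g"] finite_Un finite_keys
        Un_upper1 Un_upper2 lookup_add sum.distrib simp_thms)
qed

lemma ht_zero [simp]: "ht 0 = 0"
  by (simp add: ht_def)

lemma ht_diff: "ht (f - g) = ht f - ht g"
  using ht_add[of "f - g" g] by (metis add_diff_cancel_right' diff_add_cancel)

lemma ht_single: "ht (Poly_Mapping.single p z) = cst (of_int z * snd p) * \<rho>' (fst p)"
  by (subst ht_superset[of "{p}"]) simp_all

lemma \<rho>'_closed: "c \<in> carrier SR \<Longrightarrow> \<rho>' c \<in> carrier B"
  by (rule ring_hom_closed[OF ring_hom_ring.homh[OF \<rho>'_hom]])

lemma \<rho>'_add: "c \<in> carrier SR \<Longrightarrow> d \<in> carrier SR \<Longrightarrow> \<rho>' (c \<oplus>\<^bsub>SR\<^esub> d) = \<rho>' c + \<rho>' d"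
  using ring_hom_add[OF ring_hom_ring.homh[OF \<rho>'_hom], of c d] by simp

lemma \<rho>'_mult: "c \<in> carrier SR \<Longrightarrow> d \<in> carrier SR \<Longrightarrow> \<rho>' (c \<otimes>\<^bsub>SR\<^esub> d) = restr (faces K) (\<rho>' c * \<rho>' d)"
  using ring_hom_mult[OF ring_hom_ring.homh[OF \<rho>'_hom], of c d] by simp

lemma ht_hom: "ring_hom_ring F B ht"
proof (rule ring_hom_ringI[OF F.ring_axioms B.ring_axioms])
  fix f assume "f \<in> carrier F"
  then have "Poly_Mapping.keys f \<subseteq> carrier SR \<times> carrier Z2_ring" by simp
  then show "ht f \<in> carrier B"
  proof (induction f rule: keys_subset_induct)
    case (single p z)
    then show ?case using \<rho>'_closed[of "fst p"] by (auto simp: ht_single sr2_carrier_iff restr_cst_mult)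
  qed (simp_all add: ht_add sr2_carrier_iff restr_add)
next
  fix f g assume "f \<in> carrier F" "g \<in> carrier F"
  then have f: "Poly_Mapping.keys f \<subseteq> carrier SR \<times> carrier Z2_ring"
    and g: "Poly_Mapping.keys g \<subseteq> carrier SR \<times> carrier Z2_ring" by simp_all
  show "ht (f \<otimes>\<^bsub>F\<^esub> g) = ht f \<otimes>\<^bsub>B\<^esub> ht g"
    using f
  proof (induction f rule: keys_subset_induct)
    case (single p z)
    show ?case using g
    proof (induction g rule: keys_subset_induct)
      case (single q w)
      have "fst p \<in> carrier SR" "fst q \<in> carrier SR" using single \<open>p \<in> _\<close> by auto
      moreover have "of_int (z * w) * (snd p * snd q) = (of_int z * snd p) * (of_int w * snd q)"
        by (simp only: of_int_mult mult_ac)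
      ultimately show ?case
        by (simp only: free_pair_mult_single ht_single fst_conv snd_conv Z2_ring_simps sr2_ring_simps
            \<rho>'_mult cst_mult_cst_mult restr_cst_mult)
    qed (simp_all add: free_pair_mult_add_right ht_add ring_distribs restr_add)
  qed (simp_all add: free_pair_mult_add_left ht_add ring_distribs restr_add)
next
  have "\<rho>' \<one>\<^bsub>SR\<^esub> = 1"
    using ring_hom_one[OF ring_hom_ring.homh[OF \<rho>'_hom]] by simp
  then show "ht \<one>\<^bsub>F\<^esub> = \<one>\<^bsub>B\<^esub>" by (simp add: ht_single)
qed (simp add: ht_add)

abbreviation e :: "(('v \<Rightarrow>\<^sub>0 nat) \<Rightarrow>\<^sub>0 int) set \<Rightarrow> bit \<Rightarrow> (('v \<Rightarrow>\<^sub>0 nat) \<Rightarrow>\<^sub>0 int) set \<times> bit \<Rightarrow>\<^sub>0 int" where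
  "e c s \<equiv> Poly_Mapping.single (c, s) 1"

lemma e_in_F: "c \<in> carrier SR \<Longrightarrow> e c s \<in> carrier F"
  by simp

lemma F_uminus: "f \<in> carrier F \<Longrightarrow> \<ominus>\<^bsub>F\<^esub> f = - f"
  by (rule F.minus_equality) (simp_all add: keys_minus)

lemma F_diff_closed: "f \<in> carrier F \<Longrightarrow> g \<in> carrier F \<Longrightarrow> f - g \<in> carrier F"
  using F.minus_closed[of f g] by (simp only: F.minus_eq F_uminus free_pair_ring_simps diff_conv_add_uminus)

lemma REL_cases:
  assumes "f \<in> REL"
  obtains (left) c d s where "c \<in> carrier SR" "d \<in> carrier SR" "f = e (c \<oplus>\<^bsub>SR\<^esub> d) s - e c s - e d s"
  | (right) c s t where "c \<in> carrier SR" "f = e c (s + t) - e c s - e c t"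
  using assms unfolding tensor_relations_def Z2_ring_simps by blast

lemma REL_subset: "REL \<subseteq> carrier F"
proof
  fix f assume "f \<in> REL"
  then show "f \<in> carrier F"
  proof (cases rule: REL_cases)
    case (left c d s)
    then show ?thesis by (simp only: F_diff_closed e_in_F SR.a_closed)
  next
    case (right c s t)
    then show ?thesis by (simp only: F_diff_closed e_in_F)
  qed
qed

sublocale J: ideal J F by (rule F.genideal_ideal[OF REL_subset])

lemma J_add: "f \<in> J \<Longrightarrow> g \<in> J \<Longrightarrow> f + g \<in> J"
  using J.a_closed[of f g] by simp

lemma J_uminus: "f \<in> J \<Longrightarrow> - f \<in> J"
  using additive_subgroup.a_inv_closed[OF J.additive_subgroup_axioms, of f] F_uminus[OF J.Icarr]
  by (simp only:)

lemma J_diff: "f \<in> J \<Longrightarrow> g \<in> J \<Longrightarrow> f - g \<in> J"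
  using J_add[OF _ J_uminus] by (simp only: diff_conv_add_uminus)

lemma J_left: "c \<in> carrier SR \<Longrightarrow> d \<in> carrier SR \<Longrightarrow> e (c \<oplus>\<^bsub>SR\<^esub> d) s - e c s - e d s \<in> J"
  by (rule subsetD[OF F.genideal_self[OF REL_subset]]) (unfold tensor_relations_def Z2_ring_simps, blast)

lemma J_right: "c \<in> carrier SR \<Longrightarrow> e c (s + t) - e c s - e c t \<in> J"
  by (rule subsetD[OF F.genideal_self[OF REL_subset]]) (unfold tensor_relations_def Z2_ring_simps, blast)

lemma J_zero_right: "c \<in> carrier SR \<Longrightarrow> e c 0 \<in> J"
  using J_uminus[OF J_right[of c 0 0]] by simp

lemma J_zero_left: "e \<zero>\<^bsub>SR\<^esub> s \<in> J"
  using J_uminus[OF J_left[of "\<zero>\<^bsub>SR\<^esub>" "\<zero>\<^bsub>SR\<^esub>" s]] by simp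

lemma diff_cancel_1: "(x - a) - (y - b) + (a - z - b) = (x - y) - (z :: 'g::ab_group_add)"
  and diff_cancel_2: "(x - a) + ((a - b - b) - (z - b - b) + z) = (x :: 'g)"
  by simp_all

text \<open>Since Z/2 is generated by 1, every tensor is pure with second factor 1: a pair (c, 0) is
  trivial, (c, 1) has the right form, and differences are collected in the first factor.\<close>

lemma pure_mod_J:
  assumes "Poly_Mapping.keys f \<subseteq> carrier SR \<times> UNIV"
  shows "\<exists>c\<in>carrier SR. f - e c 1 \<in> J"
  using assms
proof (induction f rule: frag_induction)
  case zero
  show ?case using J_uminus[OF J_zero_left[of 1]] by (intro bexI[of _ "\<zero>\<^bsub>SR\<^esub>"]) simp_all
next
  case (one p)
  obtain c s where p: "p = (c, s)" "c \<in> carrier SR" using one by auto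
  show ?case
  proof (cases s)
    case zero
    then show ?thesis using p J_diff[OF J_zero_right[OF p(2)] J_zero_left[of 1]]
      by (intro bexI[of _ "\<zero>\<^bsub>SR\<^esub>"]) simp_all
  next
    case one
    then show ?thesis using p J_zero_right[OF p(2)] J_diff[of "e c 0" "e c 0"] by (intro bexI[of _ c]) simp_all
  qed
next
  case (diff f g)
  then obtain c d where cd: "c \<in> carrier SR" "f - e c 1 \<in> J" "d \<in> carrier SR" "g - e d 1 \<in> J" by blast
  have "(c \<ominus>\<^bsub>SR\<^esub> d) \<oplus>\<^bsub>SR\<^esub> d = c"
    using cd by (simp add: SR.minus_eq SR.a_assoc SR.l_neg)
  then have "e c 1 - e (c \<ominus>\<^bsub>SR\<^esub> d) 1 - e d 1 \<in> J"
    using J_left[of "c \<ominus>\<^bsub>SR\<^esub> d" d 1] cd by simp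
  from J_add[OF J_diff[OF cd(2,4)] this]
  have "(f - g) - e (c \<ominus>\<^bsub>SR\<^esub> d) 1 \<in> J" by (simp only: diff_cancel_1)
  then show ?case using cd by (intro bexI[of _ "c \<ominus>\<^bsub>SR\<^esub> d"]) simp_all
qed

lemma J_subset_kernel: "J \<subseteq> a_kernel F B ht"
proof (rule F.genideal_minimal[OF ring_hom_ring.kernel_is_ideal[OF ht_hom]], rule subsetI)
  fix f assume f: "f \<in> REL"
  then have "ht f = 0"
  proof (cases rule: REL_cases)
    case (left c d s)
    then show ?thesis by (simp add: ht_diff ht_single \<rho>'_add ring_distribs)
  next
    case (right c s t)
    then show ?thesis by (simp add: ht_diff ht_single single_add ring_distribs)
  qed
  then show "f \<in> a_kernel F B ht" using f REL_subset unfolding a_kernel_def' by auto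
qed

text \<open>For the hard inclusion, reduce to a single pair (c, 1) with
  \<open>\<rho>' c = 0\<close>. The description of the kernel of reduction gives c = d + d, and
  modulo the relations (d + d, 1) = (d, 1) + (d, 1) = (d, 1 + 1) = (d, 0) = 0.\<close>

lemma J_eq_kernel: "J = a_kernel F B ht"
proof
  show "J \<subseteq> a_kernel F B ht" by (rule J_subset_kernel)
next
  show "a_kernel F B ht \<subseteq> J"
  proof
    fix f assume "f \<in> a_kernel F B ht"
    then have f: "f \<in> carrier F" "ht f = 0" unfolding a_kernel_def' by auto
    then obtain c where c: "c \<in> carrier SR" "f - e c 1 \<in> J" using pure_mod_J[of f] by auto
    have "ht (f - e c 1) = 0" using J_subset_kernel c(2) unfolding a_kernel_def' by auto
    then have "\<rho>' c = 0" using f(2) by (simp add: ht_diff ht_single)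
    obtain p where p: "p \<in> carrier PR" "c = cls p" using SR_cases[OF c(1)] by blast
    have "\<rho> p = 0" using \<open>\<rho>' c = 0\<close> p \<rho>'_cls by simp
    then obtain p' i where p': "p' \<in> carrier PR" "i \<in> I" "p = i + (p' + p')"
      using kernel_decomp[OF p(1)] by blast
    define d where "d = cls p'"
    have d: "d \<in> carrier SR" unfolding d_def by (rule cls_closed[OF p'(1)])
    have "c = \<zero>\<^bsub>SR\<^esub> \<oplus>\<^bsub>SR\<^esub> (d \<oplus>\<^bsub>SR\<^esub> d)"
      unfolding p(2) p'(3) d_def
      using cls_add[OF I.Icarr[OF p'(2)] poly_ring_add_closed[OF p'(1) p'(1)]] cls_add[OF p'(1) p'(1)] cls_eq_zero[OF p'(2)]
      by (simp only:)
    then have "c = d \<oplus>\<^bsub>SR\<^esub> d" using d by simp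
    then have "e c 1 - e d 1 - e d 1 \<in> J" using J_left[OF d d, of 1] by simp
    moreover have "e d 0 - e d 1 - e d 1 \<in> J" using J_right[OF d, of 1 1] by simp
    ultimately have "(f - e c 1) + ((e c 1 - e d 1 - e d 1) - (e d 0 - e d 1 - e d 1) + e d 0) \<in> J"
      using J_add[OF c(2)] J_add[OF J_diff J_zero_right[OF d]] by blast
    then show "f \<in> J" by (simp only: diff_cancel_2)
  qed
qed

definition \<theta> :: "((('v \<Rightarrow>\<^sub>0 nat) \<Rightarrow>\<^sub>0 int) set \<times> bit \<Rightarrow>\<^sub>0 int) set \<Rightarrow> ('v \<Rightarrow>\<^sub>0 nat) \<Rightarrow>\<^sub>0 bit" where
  "\<theta> c = the_elem (ht ` c)"

lemma T_eq: "T = F Quot J"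
  by (simp add: tensor_ring_def)

lemma \<theta>_coset: "f \<in> carrier F \<Longrightarrow> \<theta> (J +>\<^bsub>F\<^esub> f) = ht f"
  unfolding \<theta>_def J_eq_kernel by (rule ring_hom_ring.the_elem_simp[OF ht_hom])

lemma ht_lift01: "q \<in> carrier B \<Longrightarrow> ht (e (cls (lift01 q)) 1) = q"
  by (simp add: ht_single \<rho>'_cls lift01_carrier \<rho>_lift01)

lemma \<theta>_iso: "\<theta> \<in> ring_iso T B"
proof -
  interpret ring_hom_ring F B ht by (rule ht_hom)
  have "ht ` carrier F = carrier B"
  proof
    show "carrier B \<subseteq> ht ` carrier F"
    proof
      fix q assume q: "q \<in> carrier B"
      have "e (cls (lift01 q)) 1 \<in> carrier F" by (rule e_in_F[OF cls_closed[OF lift01_carrier[OF q]]])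
      then show "q \<in> ht ` carrier F" using ht_lift01[OF q] by (metis image_eqI)
    qed
  qed (use hom_closed in blast)
  then show ?thesis
    unfolding \<theta>_def[abs_def] T_eq J_eq_kernel by (rule FactRing_iso_set)
qed

lemma ring_T: "ring T"
  unfolding T_eq by (rule J.quotient_is_ring)

lemma J_coset_closed: "f \<in> carrier F \<Longrightarrow> J +>\<^bsub>F\<^esub> f \<in> carrier T"
  unfolding T_eq by (rule ring_hom_closed[OF J.rcos_ring_hom])

lemma grading_generator:
  assumes "p \<in> carrier PR" "p \<in> homog deg d"
  shows "J +>\<^bsub>F\<^esub> e (cls p) s \<in> tensor_grading SR (stanley_reisner_grading deg vs K) Z2_ring d"
proof -
  have "cls p \<in> stanley_reisner_grading deg vs K d"
    using assms unfolding stanley_reisner_grading_def cls_def homog_def weight_def by auto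
  then show ?thesis
    unfolding tensor_grading_def pure_tensor_def Z2_ring_simps by (intro generate.incl) blast
qed

text \<open>The right side is a subgroup that contains the generators of the left. Conversely, a
  homogeneous normal form lifts to an integral polynomial with the same support, so each element on
  the right is a single pure tensor of a homogeneous class with 1.\<close>

lemma tensor_grading_eq:
  "tensor_grading SR (stanley_reisner_grading deg vs K) Z2_ring d
    = {x \<in> carrier T. \<theta> x \<in> sr2_grading deg K d}" (is "?G = ?H")
proof
  interpret T: ring T by (rule ring_T)
  interpret \<theta>: ring_hom_ring T B \<theta>
    using \<theta>_iso by (intro ring_hom_ringI2[OF ring_T B.ring_axioms]) (simp add: ring_iso_def)
  show "?G \<subseteq> ?H"
    unfolding tensor_grading_def
  proof (rule T.add.generate_subgroup_incl)
    show "subgroup ?H (add_monoid T)"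
    proof (rule T.add.subgroupI)
      have "\<zero>\<^bsub>T\<^esub> \<in> ?H" using \<theta>.hom_zero by (simp add: sr2_grading_def sr2_carrier_iff)
      then show "?H \<noteq> {}" by blast
    next
      fix x assume x: "x \<in> ?H"
      have "\<ominus>\<^bsub>B\<^esub> \<theta> x = \<theta> x"
        using x by (intro B.minus_equality) (simp_all add: sr2_grading_def)
      then show "\<ominus>\<^bsub>T\<^esub> x \<in> ?H"
        using x by simp
    next
      fix x y assume "x \<in> ?H" "y \<in> ?H"
      then show "x \<oplus>\<^bsub>T\<^esub> y \<in> ?H"
        by (simp add: sr2_grading_def homog_add sr2_carrier_iff restr_add)
    qed auto
    show "{pure_tensor SR Z2_ring r s | r s. r \<in> stanley_reisner_grading deg vs K d \<and> s \<in> carrier Z2_ring} \<subseteq> ?H"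
    proof clarify
      fix r s assume "r \<in> stanley_reisner_grading deg vs K d"
      then obtain p where p: "p \<in> carrier PR" "r = cls p" "p \<in> homog deg d"
        unfolding stanley_reisner_grading_def cls_def homog_def weight_def by auto
      have F: "e (cls p) s \<in> carrier F" by (rule e_in_F[OF cls_closed[OF p(1)]])
      have "red p \<in> homog deg d" using p(3) keys_red[of p] unfolding homog_def by blast
      then have "cst s * \<rho> p \<in> homog deg d"
        using homog_mult[OF homog_cst[of s deg] homog_restr] by (simp add: \<rho>_def)
      then have "ht (e (cls p) s) \<in> homog deg d"
        by (simp add: ht_single \<rho>'_cls[OF p(1)])
      then show "pure_tensor SR Z2_ring r s \<in> carrier T \<and> \<theta> (pure_tensor SR Z2_ring r s) \<in> sr2_grading deg K d"
        unfolding pure_tensor_def p(2) sr2_grading_def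
        using J_coset_closed[OF F] \<theta>_coset[OF F] ring_hom_closed[OF ring_hom_ring.homh[OF ht_hom] F] by simp
    qed
  qed
next
  show "?H \<subseteq> ?G"
  proof
    fix x assume "x \<in> ?H"
    then have x: "x \<in> carrier T" "\<theta> x \<in> carrier B" "\<theta> x \<in> homog deg d"
      by (simp_all add: sr2_grading_def)
    let ?y = "J +>\<^bsub>F\<^esub> e (cls (lift01 (\<theta> x))) 1"
    have F: "e (cls (lift01 (\<theta> x))) 1 \<in> carrier F" by (rule e_in_F[OF cls_closed[OF lift01_carrier[OF x(2)]]])
    have "\<theta> ?y = \<theta> x" using \<theta>_coset[OF F] ht_lift01[OF x(2)] by simp
    then have "?y = x"
      using \<theta>_iso J_coset_closed[OF F] x(1) by (auto simp: ring_iso_def bij_betw_def dest: inj_onD)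
    moreover have "lift01 (\<theta> x) \<in> homog deg d" using x(3) by (simp add: homog_def keys_lift01)
    ultimately show "x \<in> ?G" using grading_generator[OF lift01_carrier[OF x(2)]] by metis
  qed
qed

end

section \<open>Conjugation of actions by graded ring isomorphisms\<close>

section \<open>Transport of actions along isomorphisms\<close>

lemma (in ring_hom_ring) hom_finsum':
  assumes "finite A" "f \<in> A \<rightarrow> carrier R"
  shows "h (finsum R f A) = finsum S (\<lambda>i. h (f i)) A"
  using assms by (induction A rule: finite_induct) (simp_all add: Pi_def)

lemma steenrod_action_iso:
  assumes R: "ring R" and S: "ring S" and h: "h \<in> ring_iso R S"
    and Gr: "\<And>d. Gr d \<subseteq> carrier R" "\<And>d. Gr' d = h ` Gr d" and act: "steenrod_action R Gr act"
  shows "steenrod_action S Gr' (\<lambda>s y. h (act s (inv_into (carrier R) h y)))"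
proof -
  interpret ring_hom_ring R S h
    using h by (intro ring_hom_ringI2[OF R S]) (simp add: ring_iso_def)
  have inj: "inj_on h (carrier R)" and img: "h ` carrier R = carrier S"
    using h by (auto simp: ring_iso_def bij_betw_def)
  note D = steenrod_actionD[OF act]
  let ?g = "inv_into (carrier R) h"
  have g: "?g (h x) = x" if "x \<in> carrier R" for x
    by (rule inv_into_f_f[OF inj that])
  have S_all: "(\<forall>y\<in>carrier S. Q y) \<longleftrightarrow> (\<forall>x\<in>carrier R. Q (h x))" for Q
    unfolding img[symmetric] by blast
  have Gr_all: "(\<forall>y\<in>Gr' d. Q y) \<longleftrightarrow> (\<forall>x\<in>Gr d. Q (h x))" for Q d
    unfolding Gr(2) by blast
  have GrR: "x \<in> carrier R" if "x \<in> Gr d" for x d using Gr(1) that by blast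
  show ?thesis
    unfolding steenrod_action_def S_all Gr_all
  proof (intro conjI allI ballI impI)
    fix k x y assume xy: "x \<in> carrier R" "y \<in> carrier R"
    have "h (act (Sq k) (x \<otimes>\<^bsub>R\<^esub> y)) = (\<Oplus>\<^bsub>S\<^esub>i\<in>{..k}. h (act (Sq i) x \<otimes>\<^bsub>R\<^esub> act (Sq (k - i)) y))"
      unfolding D(7)[OF xy] by (rule hom_finsum') (simp_all add: Pi_def D(1) xy)
    also have "\<dots> = (\<Oplus>\<^bsub>S\<^esub>i\<in>{..k}. h (act (Sq i) x) \<otimes>\<^bsub>S\<^esub> h (act (Sq (k - i)) y))"
      by (simp only: hom_mult D(1) xy)
    finally show "h (act (Sq k) (?g (h x \<otimes>\<^bsub>S\<^esub> h y)))
      = (\<Oplus>\<^bsub>S\<^esub>i\<in>{..k}. h (act (Sq i) (?g (h x))) \<otimes>\<^bsub>S\<^esub> h (act (Sq (k - i)) (?g (h y))))"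
      using xy by (simp only: g hom_mult[symmetric] R.m_closed)
  next
    fix k d s x assume "s \<in> steenrod_grading k" "x \<in> Gr d"
    then show "h (act s (?g (h x))) \<in> Gr' (k + d)"
      using D(6) GrR by (simp only: g Gr(2) imageI)
  next
    fix d x assume "x \<in> Gr d"
    then show "h (act (Sq d) (?g (h x))) = h x \<otimes>\<^bsub>S\<^esub> h x"
      using D(8) GrR by (simp only: g hom_mult)
  next
    fix d x k assume "x \<in> Gr d" "d < k"
    then show "h (act (Sq k) (?g (h x))) = \<zero>\<^bsub>S\<^esub>"
      using D(9) GrR by (simp only: g hom_zero)
  next
    fix s x y assume "x \<in> carrier R" "y \<in> carrier R"
    then show "h (act s (?g (h x \<oplus>\<^bsub>S\<^esub> h y))) = h (act s (?g (h x))) \<oplus>\<^bsub>S\<^esub> h (act s (?g (h y)))"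
      by (simp only: g hom_add[symmetric] R.a_closed D(1,2))
  qed (simp_all add: g D)
qed

text \<open>The graded pieces are preimages under a bijection, so they correspond in both
  directions; the action is conjugated by \<open>h\<close> one way and by its inverse the other
  way.\<close>

lemma steenrod_action_iso_iff:
  assumes R: "ring R" and S: "ring S" and h: "h \<in> ring_iso R S"
    and Gr': "\<And>d. Gr' d \<subseteq> carrier S" and Gr: "\<And>d. Gr d = {x \<in> carrier R. h x \<in> Gr' d}"
  shows "(\<exists>act. steenrod_action R Gr act) \<longleftrightarrow> (\<exists>act. steenrod_action S Gr' act)"
proof -
  have bij: "bij_betw h (carrier R) (carrier S)" using h by (simp add: ring_iso_def)
  then have "Gr' d = h ` Gr d" for d
    using Gr'[of d] unfolding Gr bij_betw_def by auto
  moreover have "Gr d = inv_into (carrier R) h ` Gr' d" for d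
  proof -
    have "Gr d = inv_into (carrier R) h ` h ` Gr d"
      using bij unfolding bij_betw_def by (subst inv_into_image_cancel) (auto simp: Gr)
    then show ?thesis using \<open>\<And>d. Gr' d = h ` Gr d\<close> by simp
  qed
  moreover have "Gr d \<subseteq> carrier R" for d unfolding Gr by blast
  ultimately show ?thesis
    using steenrod_action_iso[OF R S h, of Gr Gr']
      steenrod_action_iso[OF S R ring_iso_set_sym[OF R h], of Gr' Gr] Gr' by blast
qed

section \<open>The theorem\<close>

lemma finite_complex_A:
  assumes "finite_simple_graph V E"
  shows "finite_complex (A_vars n V) (A_complex n V E)"
proof
  show "finite (A_vars n V)" using assms by (simp add: A_vars_def finite_simple_graph_def)
  show "simplicial_complex (A_complex n V E)" by (rule simplicial_A_complex[OF assms])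
  show "A_complex n V E \<subseteq> Pow (A_vars n V)"
    using assms unfolding A_vars_def finite_simple_graph_def
    by (fastforce simp: A_complex_iff graph_complex_def)
qed

theorem theorem1p5:
  fixes V :: "'a set" and E :: "'a set set" and n :: nat
  assumes "finite_simple_graph V E"
  shows "(\<exists>act. steenrod_action
            (tensor_ring (A_ring n V E) Z2_ring)
            (tensor_grading (A_ring n V E) (A_grading n V E) Z2_ring) act)
         \<longleftrightarrow> span_chromatic_number TYPE(bit) V E \<le> n"
proof -
  interpret finite_complex "A_vars n V" "A_complex n V E" by (rule finite_complex_A[OF assms])
  have "(\<exists>act. steenrod_action T (tensor_grading SR (A_grading n V E) Z2_ring) act)
    \<longleftrightarrow> (\<exists>act. steenrod_action B (sr2_grading var_degree (A_complex n V E)) act)"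
  proof (rule steenrod_action_iso_iff[OF ring_T B.ring_axioms \<theta>_iso])
    show "tensor_grading SR (A_grading n V E) Z2_ring d
      = {x \<in> carrier T. \<theta> x \<in> sr2_grading var_degree (A_complex n V E) d}" for d
      unfolding A_grading_def by (rule tensor_grading_eq)
  qed (auto simp: sr2_grading_def)
  also have "\<dots> \<longleftrightarrow> (\<exists>a \<phi>. vector_colouring n V E a \<phi>)"
  proof
    assume "\<exists>act. steenrod_action B (sr2_grading var_degree (A_complex n V E)) act"
    then obtain act where "sr2_action n V E act" using assms by (auto intro: sr2_action.intro)
    then show "\<exists>a \<phi>. vector_colouring n V E a \<phi>" by (rule sr2_action.ex_vector_colouring)
  next
    assume "\<exists>a \<phi>. vector_colouring n V E a \<phi>"
    then obtain a \<phi> where "vector_colouring n V E a \<phi>" by blast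
    then show "\<exists>act. steenrod_action B (sr2_grading var_degree (A_complex n V E)) act"
      by (intro exI) (rule vector_colouring.steenrod_action_act)
  qed
  also have "\<dots> \<longleftrightarrow> span_chromatic_number TYPE(bit) V E \<le> n"
    by (simp only: span_chromatic_number_le_iff[OF assms])
  finally show ?thesis unfolding A_ring_def .
qed

end
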